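(* Let $\|\cdot\|$ be a norm on $\mathbb{R}^2$. For all polygonal curves $P=\langle p_0,\dots,p_n\rangle$ and $Q=\langle q_0,\dots,q_m\rangle$ in $(\mathbb{R}^2,\|\cdot\|)$, the value $h_{n,m}$ returned by the propagation algorithm (defined in the context) under $\|\cdot\|$ is a factor-$5$ approximation of CDTW: $$\mathrm{cdtw}_{\|\cdot\|}(P,Q)\le h_{n,m}\le 5\cdot\mathrm{cdtw}_{\|\cdot\|}(P,Q).$$
   Context: Curves and CDTW. A polygonal curve $P=\langle p_0,\dots,p_n\rangle$ consists of the $n\ge1$ consecutive segments from $p_{i-1}$ to $p_i$ ($p_i\ne p_{i-1}$). $P_{\le i}:=\langle p_0,\dots,p_i\rangle$; $\|P\|:=\sum_{i=1}^n\|p_i-p_{i-1}\|$ is its arc length; $P_{\|\cdot\|}:[0,\|P\|]\to\mathbb{R}^2$ is its arc length parametrisation (speed $1$ under $\|\cdot\|$). $\Pi_{[a,b]}(P)$ is the set of piecewise continuously differentiable functions on $[a,b]$ that monotonically parametrise $P$. $\mathrm{cdtw}_{\|\cdot\|}(P,Q):=\inf_{(f,g)\in\Pi_{[0,1]}(P)\times\Pi_{[0,1]}(Q)}\int_0^1\|f(t)-g(t)\|\,(\|f'(t)\|+\|g'(t)\|)\,dt$. Parameter space. It is $[0,\|P\|]\times[0,\|Q\|]$, divided into cells $C_{i,j}=[\|P_{\le i-1}\|,\|P_{\le i}\|]\times[\|Q_{\le j-1}\|,\|Q_{\le j}\|]$, $1\le i\le n$, $1\le j\le m$. The north, south borders of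 $C_{i,j}$ are the maps $\mathcal N(t)=(t,\|Q_{\le j}\|)$, $\mathcal S(t)=(t,\|Q_{\le j-1}\|)$ with domain $[\|P_{\le i-1}\|,\|P_{\le i}\|]$; the east, west borders are $\mathcal E(t)=(\|P_{\le i}\|,t)$, $\mathcal W(t)=(\|P_{\le i-1}\|,t)$ with domain $[\|Q_{\le j-1}\|,\|Q_{\le j}\|]$. The south border of $C_{i,j}$ is identified with the north border of $C_{i,j-1}$ and the west border with the east border of $C_{i-1,j}$ (also for index $0$, where these are the bottom and left sides of the parameter space). Paths. Write $x\preceq y$ if $x_1\le y_1$ and $x_2\le y_2$. With $\sigma=\|P\|+\|Q\|$, let $\Gamma$ be the set of $\gamma:[0,\sigma]\to[0,\|P\|]\times[0,\|Q\|]$ for which there are $(f,g)\in\Pi_{[0,\sigma]}(P)\times\Pi_{[0,\sigma]}(Q)$ with $\gamma_1(s)=\int_0^s\|f'\|$, $\gamma_2(s)=\int_0^s\|g'\|$ and $\|\gamma'(s)\|_1=\|f'(s)\|+\|g'(s)\|=1$. For $x\preceq y$, an $(x,y)$-path is a restriction $\gamma|_{[\|x\|_1,\|y\|_1]}$ of a $\gamma\in\Gamma$ with $\gamma(\|x\|_1)=x$, $\gamma(\|y\|_1)=y$; its cost is $\int_{\|x\|_1}^{\|y\|_1}\|P_{\|\cdot\|}(\gamma_1(t))-Q_{\|\cdot\|}(\gamma_2(t))\|\,dt$. $\mathrm{opt}(x,y)$ denotes the minimum cost of an $(x,y)$-path. Propagation algorithm. It computes a function $\mathcal B.\mathrm{apx}:\mathrm{dom}(\mathcal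 B)\to\mathbb{R}_{\ge0}$ for every border $\mathcal B$ and values $h_{i,j}$. Base: on the bottom side borders, $\mathrm{apx}(t)=\mathrm{opt}(\mathbf 0,(t,0))$ and $h_{i,0}=\mathrm{opt}(\mathbf 0,(\|P_{\le i}\|,0))$; on the left side borders, $\mathrm{apx}(t)=\mathrm{opt}(\mathbf 0,(0,t))$ and $h_{0,j}=\mathrm{opt}(\mathbf 0,(0,\|Q_{\le j}\|))$. Then the cells $C=C_{i,j}$ are processed in order of increasing $i+j$, with $\mathcal S.\mathrm{apx},\mathcal W.\mathrm{apx}$ already known: (1) initialise $\mathcal N.\mathrm{apx}(t)=h_{i-1,j}+\mathrm{opt}(\mathcal W(\|Q_{\le j}\|),\mathcal N(t))$ and $\mathcal E.\mathrm{apx}(t)=h_{i,j-1}+\mathrm{opt}(\mathcal S(\|P_{\le i}\|),\mathcal E(t))$; (2) with $c=(\|P_{\le i}\|,\|Q_{\le j}\|)$ the north-east corner, for $\mathcal A\in\{\mathcal S,\mathcal W\}$ let $h^*_{\mathcal A}=\min_{s\in\mathrm{dom}(\mathcal A)}\bigl(\mathcal A.\mathrm{apx}(s)+\mathrm{opt}(\mathcal A(s),c)\bigr)$ and let $s^*_{\mathcal A}$ be a minimiser (ties arbitrary); (3) replace $\mathcal N.\mathrm{apx}$ by its pointwise minimum with $t\mapsto\mathcal W.\mathrm{apx}(s^*_{\mathcal W})+\mathrm{opt}(\mathcal W(s^*_{\mathcal W}),\mathcal N(t))$, and $\mathcal E.\mathrm{apx}$ by its pointwise minimum with $t\mapsto\mathcal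 S.\mathrm{apx}(s^*_{\mathcal S})+\mathrm{opt}(\mathcal S(s^*_{\mathcal S}),\mathcal E(t))$; (4) if $h^*_{\mathcal S}<h^*_{\mathcal W}$, replace $\mathcal N.\mathrm{apx}$ by its pointwise minimum with $t\mapsto\min_{s\le s^*_{\mathcal S},\,s\le t}\bigl(\mathcal S.\mathrm{apx}(s)+\mathrm{opt}(\mathcal S(s),\mathcal N(t))\bigr)$; if $h^*_{\mathcal W}<h^*_{\mathcal S}$, replace $\mathcal E.\mathrm{apx}$ by its pointwise minimum with $t\mapsto\min_{s\le s^*_{\mathcal W},\,s\le t}\bigl(\mathcal W.\mathrm{apx}(s)+\mathrm{opt}(\mathcal W(s),\mathcal E(t))\bigr)$; (5) set $h_{i,j}=\min\{h^*_{\mathcal S},h^*_{\mathcal W}\}$. The algorithm returns $h_{n,m}$. *)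

theory Defs
  imports "HOL-Analysis.Analysis" "HOL-Library.Product_Order"
begin

section \<open>Norms and polygonal curves\<close>

definition is_norm :: "('a::real_vector \<Rightarrow> real) \<Rightarrow> bool" where
  "is_norm N \<longleftrightarrow>
     (\<forall>x. N x = 0 \<longleftrightarrow> x = 0) \<and>
     (\<forall>c x. N (c *\<^sub>R x) = \<bar>c\<bar> * N x) \<and>
     (\<forall>x y. N (x + y) \<le> N x + N y)"

text \<open>
  The curve with vertices \<open>p 0, \<dots>, p n\<close> is given by \<open>p\<close> and \<open>n\<close>; the values of \<open>p\<close> beyond \<open>n\<close> are
  irrelevant. Its prefix with vertices \<open>p 0, \<dots>, p i\<close> is given by \<open>p\<close> and \<open>i\<close>, so that
  \<open>arc_len N p i\<close> is the arc length of that prefix.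
\<close>

definition polygonal_curve :: "(nat \<Rightarrow> real^2) \<Rightarrow> nat \<Rightarrow> bool" where
  "polygonal_curve p n \<longleftrightarrow> n \<ge> 1 \<and> (\<forall>i\<in>{1..n}. p i \<noteq> p (i - 1))"

definition arc_len :: "(real^2 \<Rightarrow> real) \<Rightarrow> (nat \<Rightarrow> real^2) \<Rightarrow> nat \<Rightarrow> real" where
  "arc_len N p i = (\<Sum>k=1..i. N (p k - p (k - 1)))"

text \<open>
  Arc length parametrisation, meaningful on \<open>{0..arc_len N p n}\<close>: for such \<open>s\<close> the index \<open>i\<close> is that of
  a segment of the curve (so \<open>i \<le> n\<close>) containing the point at arc length \<open>s\<close>.
\<close>

definition arc_param :: "(real^2 \<Rightarrow> real) \<Rightarrow> (nat \<Rightarrow> real^2) \<Rightarrow> real \<Rightarrow> real^2" where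
  "arc_param N p s =
     (let i = (LEAST i. i \<ge> 1 \<and> s \<le> arc_len N p i)
      in p (i - 1) + ((s - arc_len N p (i - 1)) / N (p i - p (i - 1))) *\<^sub>R (p i - p (i - 1)))"


section \<open>Continuous dynamic time warping\<close>

text \<open>
  Monotone parametrisations may pause (the reparametrisation \<open>\<phi>\<close> is nondecreasing, not necessarily
  strictly), but they traverse the whole curve.
\<close>

definition monotone_params ::
    "(real^2 \<Rightarrow> real) \<Rightarrow> (nat \<Rightarrow> real^2) \<Rightarrow> nat \<Rightarrow> real \<Rightarrow> real \<Rightarrow> (real \<Rightarrow> real^2) set" where
  "monotone_params N p n a b =
     {f. f piecewise_C1_differentiable_on {a..b} \<and>
         (\<exists>\<phi>. mono_on {a..b} \<phi> \<and> \<phi> ` {a..b} = {0..arc_len N p n} \<and>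
              (\<forall>t\<in>{a..b}. f t = arc_param N p (\<phi> t)))}"

text \<open>
  The derivative exists at all but finitely many points; its unspecified value at the others does not
  influence the integrals below.
\<close>

definition speed :: "(real^2 \<Rightarrow> real) \<Rightarrow> real \<Rightarrow> real \<Rightarrow> (real \<Rightarrow> real^2) \<Rightarrow> real \<Rightarrow> real" where
  "speed N a b f t = N (vector_derivative f (at t within {a..b}))"

definition cdtw ::
    "(real^2 \<Rightarrow> real) \<Rightarrow> (nat \<Rightarrow> real^2) \<Rightarrow> nat \<Rightarrow> (nat \<Rightarrow> real^2) \<Rightarrow> nat \<Rightarrow> real" where
  "cdtw N p n q m =
     (INF (f, g) \<in> monotone_params N p n 0 1 \<times> monotone_params N q m 0 1.
        integral {0..1} (\<lambda>t. N (f t - g t) * (speed N 0 1 f t + speed N 0 1 g t)))"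


section \<open>Paths in the parameter space\<close>

definition norm1 :: "real \<times> real \<Rightarrow> real" where
  "norm1 x = \<bar>fst x\<bar> + \<bar>snd x\<bar>"

definition Gamma ::
    "(real^2 \<Rightarrow> real) \<Rightarrow> (nat \<Rightarrow> real^2) \<Rightarrow> nat \<Rightarrow> (nat \<Rightarrow> real^2) \<Rightarrow> nat \<Rightarrow> (real \<Rightarrow> real \<times> real) set" where
  "Gamma N p n q m =
     (let \<sigma> = arc_len N p n + arc_len N q m in
      {\<gamma>. \<gamma> \<in> {0..\<sigma>} \<rightarrow> {0..arc_len N p n} \<times> {0..arc_len N q m} \<and>
          (\<exists>f\<in>monotone_params N p n 0 \<sigma>. \<exists>g\<in>monotone_params N q m 0 \<sigma>.
             (\<forall>s\<in>{0..\<sigma>}. \<gamma> s = (integral {0..s} (speed N 0 \<sigma> f), integral {0..s} (speed N 0 \<sigma> g))) \<and>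
             (\<exists>X. finite X \<and>
                (\<forall>s\<in>{0..\<sigma>} - X.
                   norm1 (vector_derivative \<gamma> (at s within {0..\<sigma>}))
                     = speed N 0 \<sigma> f s + speed N 0 \<sigma> g s \<and>
                   speed N 0 \<sigma> f s + speed N 0 \<sigma> g s = 1)))})"

text \<open>The order on \<open>real \<times> real\<close> is the componentwise one.\<close>

definition paths ::
    "(real^2 \<Rightarrow> real) \<Rightarrow> (nat \<Rightarrow> real^2) \<Rightarrow> nat \<Rightarrow> (nat \<Rightarrow> real^2) \<Rightarrow> nat \<Rightarrow>
     real \<times> real \<Rightarrow> real \<times> real \<Rightarrow> (real \<Rightarrow> real \<times> real) set" where
  "paths N p n q m x y =
     {restrict \<gamma> {norm1 x..norm1 y} | \<gamma>.
        x \<le> y \<and> \<gamma> \<in> Gamma N p n q m \<and> \<gamma> (norm1 x) = x \<and> \<gamma> (norm1 y) = y}"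

definition path_cost ::
    "(real^2 \<Rightarrow> real) \<Rightarrow> (nat \<Rightarrow> real^2) \<Rightarrow> (nat \<Rightarrow> real^2) \<Rightarrow>
     real \<times> real \<Rightarrow> real \<times> real \<Rightarrow> (real \<Rightarrow> real \<times> real) \<Rightarrow> real" where
  "path_cost N p q x y \<gamma> =
     integral {norm1 x..norm1 y} (\<lambda>t. N (arc_param N p (fst (\<gamma> t)) - arc_param N q (snd (\<gamma> t))))"

text \<open>
  Minima over infinite sets of reals are written as infima, here and in the algorithm; the two agree
  whenever the minimum is attained.
\<close>

definition opt ::
    "(real^2 \<Rightarrow> real) \<Rightarrow> (nat \<Rightarrow> real^2) \<Rightarrow> nat \<Rightarrow> (nat \<Rightarrow> real^2) \<Rightarrow> nat \<Rightarrow>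
     real \<times> real \<Rightarrow> real \<times> real \<Rightarrow> real" where
  "opt N p n q m x y = (INF \<gamma>\<in>paths N p n q m x y. path_cost N p q x y \<gamma>)"


section \<open>Propagation algorithm\<close>

datatype side = South | West

text \<open>
  The arbitrary choice among minimisers is modelled by a rule that may depend on the cell \<open>(i, j)\<close> and
  on the border. A rule has to return a minimiser of \<open>f\<close> on \<open>D\<close> whenever there is one, so that ranging
  over all rules covers every possible way of breaking ties.
\<close>

type_synonym selection = "side \<Rightarrow> nat \<Rightarrow> nat \<Rightarrow> real set \<Rightarrow> (real \<Rightarrow> real) \<Rightarrow> real"

definition minimiser_rule :: "selection \<Rightarrow> bool" where
  "minimiser_rule sel \<longleftrightarrow>
     (\<forall>A i j D f. (\<exists>s. is_arg_min f (\<lambda>s. s \<in> D) s) \<longrightarrow> is_arg_min f (\<lambda>s. s \<in> D) (sel A i j D f))"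

lemma ex_minimiser_rule: "minimiser_rule (\<lambda>A i j D f. arg_min_on f D)"
  unfolding minimiser_rule_def arg_min_on_def arg_min_def by (blast intro: someI_ex)

text \<open>
  Data computed for the cell \<open>(i, j)\<close>: the functions on its north and east borders and the value
  \<open>h\<close> at its north-east corner.
\<close>

record cell_data =
  north_apx :: "real \<Rightarrow> real"
  east_apx :: "real \<Rightarrow> real"
  corner_val :: real

text \<open>
  Processing of the cell \<open>(i, j)\<close>, where \<open>Sapx\<close> and \<open>Wapx\<close> are the functions on its south and west
  borders, \<open>hNW\<close> is the value for the index \<open>(i - 1, j)\<close> and \<open>hSE\<close> the one for \<open>(i, j - 1)\<close>.
\<close>

definition process_cell ::
    "(real^2 \<Rightarrow> real) \<Rightarrow> selection \<Rightarrow> (nat \<Rightarrow> real^2) \<Rightarrow> nat \<Rightarrow> (nat \<Rightarrow> real^2) \<Rightarrow> nat \<Rightarrow> nat \<Rightarrow> nat \<Rightarrow>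
     (real \<Rightarrow> real) \<Rightarrow> (real \<Rightarrow> real) \<Rightarrow> real \<Rightarrow> real \<Rightarrow> cell_data" where
  "process_cell N sel p n q m i j Sapx Wapx hNW hSE =
     (let
        x0 = arc_len N p (i - 1); x1 = arc_len N p i;
        y0 = arc_len N q (j - 1); y1 = arc_len N q j;
        domX = {x0..x1}; domY = {y0..y1};
        north = (\<lambda>t. (t, y1)); south = (\<lambda>t. (t, y0));
        east = (\<lambda>t. (x1, t)); west = (\<lambda>t. (x0, t));
        opt' = opt N p n q m;

        N1 = (\<lambda>t. hNW + opt' (west y1) (north t));
        E1 = (\<lambda>t. hSE + opt' (south x1) (east t));

        c = (x1, y1);
        fS = (\<lambda>s. Sapx s + opt' (south s) c);
        fW = (\<lambda>s. Wapx s + opt' (west s) c);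
        hS = (INF s\<in>domX. fS s);
        hW = (INF s\<in>domY. fW s);
        sS = sel South i j domX fS;
        sW = sel West i j domY fW;

        N2 = (\<lambda>t. min (N1 t) (Wapx sW + opt' (west sW) (north t)));
        E2 = (\<lambda>t. min (E1 t) (Sapx sS + opt' (south sS) (east t)));

        N3 = (if hS < hW
              then (\<lambda>t. min (N2 t) (INF s\<in>{s\<in>domX. s \<le> sS \<and> s \<le> t}. Sapx s + opt' (south s) (north t)))
              else N2);
        E3 = (if hW < hS
              then (\<lambda>t. min (E2 t) (INF s\<in>{s\<in>domY. s \<le> sW \<and> s \<le> t}. Wapx s + opt' (west s) (east t)))
              else E2)
      in \<lparr>north_apx = N3, east_apx = E3, corner_val = min hS hW\<rparr>)"

text \<open>
  Index \<open>0\<close> stands for the bottom and left sides of the parameter space, where only the bottom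
  borders (as north borders of row \<open>0\<close>) and the left borders (as east borders of column \<open>0\<close>) exist;
  the \<open>undefined\<close> fields are never read.
\<close>

fun propagate ::
    "(real^2 \<Rightarrow> real) \<Rightarrow> selection \<Rightarrow> (nat \<Rightarrow> real^2) \<Rightarrow> nat \<Rightarrow> (nat \<Rightarrow> real^2) \<Rightarrow> nat \<Rightarrow> nat \<Rightarrow> nat \<Rightarrow>
     cell_data" where
  "propagate N sel p n q m 0 0 =
     \<lparr>north_apx = undefined, east_apx = undefined, corner_val = opt N p n q m (0, 0) (0, 0)\<rparr>"
| "propagate N sel p n q m (Suc i) 0 =
     \<lparr>north_apx = (\<lambda>t. opt N p n q m (0, 0) (t, 0)),
      east_apx = undefined,
      corner_val = opt N p n q m (0, 0) (arc_len N p (Suc i), 0)\<rparr>"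
| "propagate N sel p n q m 0 (Suc j) =
     \<lparr>north_apx = undefined,
      east_apx = (\<lambda>t. opt N p n q m (0, 0) (0, t)),
      corner_val = opt N p n q m (0, 0) (0, arc_len N q (Suc j))\<rparr>"
| "propagate N sel p n q m (Suc i) (Suc j) =
     process_cell N sel p n q m (Suc i) (Suc j)
       (north_apx (propagate N sel p n q m (Suc i) j))
       (east_apx (propagate N sel p n q m i (Suc j)))
       (corner_val (propagate N sel p n q m i (Suc j)))
       (corner_val (propagate N sel p n q m (Suc i) j))"

definition propagation_value ::
    "(real^2 \<Rightarrow> real) \<Rightarrow> selection \<Rightarrow> (nat \<Rightarrow> real^2) \<Rightarrow> nat \<Rightarrow> (nat \<Rightarrow> real^2) \<Rightarrow> nat \<Rightarrow> real" where
  "propagation_value N sel p n q m = corner_val (propagate N sel p n q m n m)"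

end

theory Submission
  imports Defs
begin

text \<open>
  Write \<open>h\<close> for the height \<open>\<parallel>P x - Q y\<parallel>\<close> over the parameter space and \<open>D\<close> for the minimal integral of
  \<open>h\<close> along monotone paths; then \<open>opt = D\<close> and CDTW is \<open>D\<close> between the two extreme corners. All values
  of the algorithm are costs of actual paths, which gives the lower bound. For the upper bound it
  suffices that in every cell the value propagated to a border point is at most the value at any
  entry point plus five times the cost \<open>K\<close> of any path \<open>\<pi>\<close> between the two points.

  Propagation from south to north and from west to east loses nothing: a path to be simulated crosses
  an optimal path from \<open>s\<^sup>*\<close> to the north-east corner \<open>c\<close>, and exchanging tails at the crossing does not
  increase the cost. From west to north, let \<open>H\<close> be the height at the endpoint \<open>z\<close> of \<open>\<pi>\<close> and \<open>\<ell>\<close> its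
  length. The path around the north-west corner costs at most \<open>K + \<ell>\<^sup>2/2\<close>, since
  at time \<open>s\<close> the two paths differ by at most \<open>min (s, \<ell> - s)\<close> in each coordinate. This is at most \<open>5K\<close> if
  \<open>\<ell> \<le> 2H\<close>, or if every unit of progress inside the cell moves the difference vector by at least 1/2.
  Otherwise \<open>K \<ge> H\<^sup>2/2\<close>, and the height has a valley: a line of positive slope, with height 1/2-Lipschitz
  along it, towards which \<open>h\<close> decreases on every antidiagonal. Then rerouting the path from \<open>s\<^sup>*\<close> to \<open>c\<close>
  through \<open>z\<close> by a vertical and a horizontal leg costs at most \<open>H\<^sup>2\<close> extra per leg, hence \<open>4K\<close> in total.
\<close>

section \<open>Monotone paths in the parameter space\<close>

text \<open>The constant 5 is 1 + 4 in both ways of passing from west to north. For a path of length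
  \<open>L\<close>, the path around the corner costs at most \<open>K + L^2/2\<close>, which is at
  most \<open>5K\<close> once \<open>K >= L^2/8\<close>; the detour costs at most
  \<open>K + 2 H^2\<close>, which is at most \<open>5K\<close> once \<open>K >= H^2/2\<close>. The
  threshold 1/2 serves both: steep movement yields \<open>K >= L^2/8\<close>, and a valley along
  which the height changes at rate at most 1/2 keeps the excess of each leg below
  \<open>H^2\<close>. The factor does not compound from cell to cell. The error \<open>5K\<close> is
  charged only to the piece of path inside the current cell, so a value of at most
  \<open>5 D\<close> at the entry leads to at most \<open>5 D\<close> at the exit. The obstacle is
  that \<open>s*\<close> is optimal for the corner \<open>c\<close> and not for \<open>z\<close>. An
  inequality between the costs from \<open>s*\<close> and from \<open>s\<close>, to \<open>z\<close>
  and to \<open>c\<close>, transfers its optimality from \<open>c\<close> to \<open>z\<close>. Costs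
  of paths are only known to have infima, so estimates are shown for each single path and then
  passed to the infimum. East borders are north borders after exchanging the two curves.\<close>

text \<open>A path \<open>\<gamma>\<close> is represented by its first coordinate \<open>a\<close> as a function of the coordinate sum, so
  that \<open>\<gamma> s = (a s, s - a s)\<close>. Unlike the piecewise smooth paths of \<^term>\<open>Gamma\<close>, such Lipschitz
  paths are closed under taking maxima and minima.\<close>

definition mpath :: "(real \<Rightarrow> real) \<Rightarrow> bool" where
  "mpath a \<longleftrightarrow> (\<forall>s s'. s \<le> s' \<longrightarrow> a s \<le> a s' \<and> a s' - a s \<le> s' - s)"

lemma mpathD: "mpath a \<Longrightarrow> s \<le> s' \<Longrightarrow> a s \<le> a s'" "mpath a \<Longrightarrow> s \<le> s' \<Longrightarrow> a s' - a s \<le> s' - s"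
  by (auto simp: mpath_def)

lemma mpathI: "(\<And>s s'. s \<le> s' \<Longrightarrow> a s \<le> a s') \<Longrightarrow> (\<And>s s'. s \<le> s' \<Longrightarrow> a s' - a s \<le> s' - s) \<Longrightarrow> mpath a"
  by (auto simp: mpath_def)

text \<open>Both coordinates are nondecreasing, so their increments have the same sign and add up to
  the elapsed parameter.\<close>

lemma mpath_abs: "mpath a \<Longrightarrow> \<bar>a s - a s'\<bar> + \<bar>(s - a s) - (s' - a s')\<bar> = \<bar>s - s'\<bar>"
  using mpathD[of a s s'] mpathD[of a s' s] by (cases "s \<le> s'") auto

lemma mpath_continuous: "mpath a \<Longrightarrow> continuous_on S a"
proof -
  assume a: "mpath a"
  have "1-lipschitz_on S a"
    unfolding lipschitz_on_def using mpath_abs[OF a] by (auto simp: dist_real_def) (smt (verit))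
  then show ?thesis by (rule lipschitz_on_continuous_on)
qed

lemma mpath_const [intro]: "mpath (\<lambda>s. c)" and mpath_shift [intro]: "mpath (\<lambda>s. s - c)"
  by (auto simp: mpath_def)

lemma mpath_max: "mpath a \<Longrightarrow> mpath b \<Longrightarrow> mpath (\<lambda>s. max (a s) (b s))"
  and mpath_min: "mpath a \<Longrightarrow> mpath b \<Longrightarrow> mpath (\<lambda>s. min (a s) (b s))"
  and mpath_flip: "mpath a \<Longrightarrow> mpath (\<lambda>s. s - a s)"
  unfolding mpath_def by (smt (verit))+

lemma mpath_glue:
  assumes "mpath a" "mpath b" "a c = b c"
  shows "mpath (\<lambda>s. if s \<le> c then a s else b s)"
proof (rule mpathI)
  fix s s' :: real assume "s \<le> s'"
  then show "(if s \<le> c then a s else b s) \<le> (if s' \<le> c then a s' else b s')"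
    using mpathD[OF assms(1), of s s'] mpathD[OF assms(1), of s c] mpathD[OF assms(2), of s s']
      mpathD[OF assms(2), of c s'] assms(3) by auto
  show "(if s' \<le> c then a s' else b s') - (if s \<le> c then a s else b s) \<le> s' - s"
    using \<open>s \<le> s'\<close> mpathD[OF assms(1), of s s'] mpathD[OF assms(1), of s c] mpathD[OF assms(2), of s s']
      mpathD[OF assms(2), of c s'] assms(3) by auto
qed

definition cost :: "(real \<Rightarrow> real \<Rightarrow> real) \<Rightarrow> (real \<Rightarrow> real) \<Rightarrow> real \<Rightarrow> real \<Rightarrow> real" where
  "cost h a l r = integral {l..r} (\<lambda>s. h (a s) (s - a s))"

text \<open>Only two values are prescribed: at these parameters the second coordinate is then right
  as well, and outside the interval between them the path is arbitrary.\<close>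

definition mpaths :: "real \<times> real \<Rightarrow> real \<times> real \<Rightarrow> (real \<Rightarrow> real) set" where
  "mpaths x y = {a. mpath a \<and> a (fst x + snd x) = fst x \<and> a (fst y + snd y) = fst y}"

definition mincost :: "(real \<Rightarrow> real \<Rightarrow> real) \<Rightarrow> real \<times> real \<Rightarrow> real \<times> real \<Rightarrow> real" where
  "mincost h x y = (INF a\<in>mpaths x y. cost h a (fst x + snd x) (fst y + snd y))"

lemma mpathsI: "mpath a \<Longrightarrow> a (x1 + x2) = x1 \<Longrightarrow> a (y1 + y2) = y1 \<Longrightarrow> a \<in> mpaths (x1, x2) (y1, y2)"
  by (auto simp: mpaths_def)

lemma mpathsD:
  assumes "a \<in> mpaths (x1, x2) (y1, y2)"
  shows "mpath a" "a (x1 + x2) = x1" "a (y1 + y2) = y1"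
  using assms by (auto simp: mpaths_def)

lemma mpaths_nonempty: "x1 \<le> y1 \<Longrightarrow> x2 \<le> y2 \<Longrightarrow> mpaths (x1, x2) (y1, y2) \<noteq> {}"
proof -
  assume "x1 \<le> y1" "x2 \<le> y2"
  \<comment> \<open>This path goes up at \<open>x1\<close> to height \<open>y2\<close> and then
    right; later detours have the same form.\<close>
  then have "(\<lambda>s. max x1 (s - y2)) \<in> mpaths (x1, x2) (y1, y2)"
    by (intro mpathsI mpath_max) auto
  then show ?thesis by blast
qed

section \<open>Minimal path costs for a bounded Lipschitz height\<close>

locale height =
  fixes h :: "real \<Rightarrow> real \<Rightarrow> real" and M :: real
  assumes h_nonneg: "0 \<le> h x y"
    and h_le: "h x y \<le> M"
    and h_lip: "\<bar>h x y - h x' y'\<bar> \<le> \<bar>x - x'\<bar> + \<bar>y - y'\<bar>"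
begin

abbreviation D where "D \<equiv> mincost h"
abbreviation K where "K \<equiv> cost h"

lemma continuous_h: 
  assumes "continuous_on S f" "continuous_on S g"
  shows "continuous_on S (\<lambda>s. h (f s) (g s))"
proof (rule continuous_on_compose2[where f = "\<lambda>s. (f s, g s)" and g = "\<lambda>z. h (fst z) (snd z)" and t = UNIV, simplified])
  show "continuous_on S (\<lambda>s. (f s, g s))" using assms by (intro continuous_intros)
  have "2-lipschitz_on UNIV (\<lambda>z. h (fst z) (snd z))"
    unfolding lipschitz_on_def
  proof (intro conjI ballI)
    fix z z' :: "real \<times> real"
    show "dist (h (fst z) (snd z)) (h (fst z') (snd z')) \<le> 2 * dist z z'"
      using h_lip[of "fst z" "snd z" "fst z'" "snd z'"] dist_fst_le[of z z'] dist_snd_le[of z z']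
      by (simp add: dist_real_def)
  qed simp
  then show "continuous_on UNIV (\<lambda>z. h (fst z) (snd z))" by (rule lipschitz_on_continuous_on)
qed

lemma continuous_path: "mpath a \<Longrightarrow> continuous_on S (\<lambda>s. h (a s) (s - a s))"
  by (intro continuous_h continuous_intros mpath_continuous)

lemma integrable_path: "mpath a \<Longrightarrow> (\<lambda>s. h (a s) (s - a s)) integrable_on {l..r}"
  by (intro integrable_continuous_interval continuous_path)

lemma K_nonneg: "mpath a \<Longrightarrow> 0 \<le> K a l r"
  unfolding cost_def by (intro integral_nonneg integrable_path h_nonneg)

lemma K_combine: "mpath a \<Longrightarrow> l \<le> m \<Longrightarrow> m \<le> r \<Longrightarrow> K a l r = K a l m + K a m r"
  unfolding cost_def by (rule sym, rule Henstock_Kurzweil_Integration.integral_combine) (auto intro: integrable_path)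

lemma K_cong: "(\<And>s. l \<le> s \<Longrightarrow> s \<le> r \<Longrightarrow> a s = b s) \<Longrightarrow> K a l r = K b l r"
  unfolding cost_def by (rule integral_cong) auto

text \<open>The coordinates add up to \<open>s\<close>, so a deviation of \<open>e\<close> in the
  first is one of \<open>e\<close> in the second, and the height changes by at most
  \<open>2 * e\<close>.\<close>

lemma K_le_close:
  assumes "mpath a" "mpath b" "l \<le> r" "\<And>s. l \<le> s \<Longrightarrow> s \<le> r \<Longrightarrow> \<bar>a s - b s\<bar> \<le> e"
  shows "K a l r \<le> K b l r + 2 * e * (r - l)"
proof -
  have "K a l r \<le> integral {l..r} (\<lambda>s. h (b s) (s - b s) + 2 * e)"
    unfolding cost_def
  proof (rule integral_le)
    fix s assume "s \<in> {l..r}"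
    then show "h (a s) (s - a s) \<le> h (b s) (s - b s) + 2 * e"
      using assms(4)[of s] h_lip[of "a s" "s - a s" "b s" "s - b s"] by auto
  qed (auto intro!: integrable_path integrable_add assms)
  also have "\<dots> = K b l r + 2 * e * (r - l)"
    unfolding cost_def using assms by (subst Henstock_Kurzweil_Integration.integral_add) (auto intro!: integrable_path)
  finally show ?thesis .
qed

lemma K_le_length: 
  assumes "mpath a" "l \<le> r" shows "K a l r \<le> M * (r - l)"
proof -
  have "K a l r \<le> integral {l..r} (\<lambda>s. M)"
    unfolding cost_def by (rule integral_le) (auto intro!: integrable_path assms h_le)
  then show ?thesis using assms by (simp add: mult.commute)
qed

lemma bdd_K: "bdd_below ((\<lambda>a. K a l r) ` mpaths x y)"
  by (rule bdd_belowI[of _ 0]) (auto simp: mpaths_def intro: K_nonneg)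

lemma D_le: "mpath a \<Longrightarrow> a (x1 + x2) = x1 \<Longrightarrow> a (y1 + y2) = y1 \<Longrightarrow> D (x1, x2) (y1, y2) \<le> K a (x1 + x2) (y1 + y2)"
  unfolding mincost_def by (simp add: cINF_lower[OF bdd_K] mpathsI)

lemma D_ge:
  assumes "x1 \<le> y1" "x2 \<le> y2"
    and "\<And>a. mpath a \<Longrightarrow> a (x1 + x2) = x1 \<Longrightarrow> a (y1 + y2) = y1 \<Longrightarrow> c \<le> K a (x1 + x2) (y1 + y2)"
  shows "c \<le> D (x1, x2) (y1, y2)"
  unfolding mincost_def using mpaths_nonempty[OF assms(1,2)] assms(3)
  by (intro cINF_greatest) (auto dest: mpathsD)

lemma D_nonneg: "x1 \<le> y1 \<Longrightarrow> x2 \<le> y2 \<Longrightarrow> 0 \<le> D (x1, x2) (y1, y2)"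
  by (rule D_ge) (auto intro: K_nonneg)

lemma D_refl: "D (x1, x2) (x1, x2) = 0"
  using D_nonneg[of x1 x1 x2 x2] D_le[of "\<lambda>s. x1" x1 x2 x1 x2] by (auto simp: cost_def)

text \<open>Paths are concatenated. Since the infima need not be attained, the bound is shown for
  arbitrary pairs of paths and \<open>D_ge\<close> is then used once for each of the two.\<close>

lemma D_triangle:
  assumes "x1 \<le> y1" "x2 \<le> y2" "y1 \<le> z1" "y2 \<le> z2"
  shows "D (x1, x2) (z1, z2) \<le> D (x1, x2) (y1, y2) + D (y1, y2) (z1, z2)"
proof -
  have 1: "D (x1, x2) (z1, z2) \<le> K a (x1 + x2) (y1 + y2) + K b (y1 + y2) (z1 + z2)"
    if a: "mpath a" "a (x1 + x2) = x1" "a (y1 + y2) = y1" and b: "mpath b" "b (y1 + y2) = y1" "b (z1 + z2) = z1" for a b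
  proof -
    let ?c = "\<lambda>s. if s \<le> y1 + y2 then a s else b s"
    have c: "mpath ?c" using a b by (intro mpath_glue) auto
    have "D (x1, x2) (z1, z2) \<le> K ?c (x1 + x2) (z1 + z2)"
    proof (rule D_le[OF c])
      \<comment> \<open>If \<open>z\<close> equals \<open>y\<close>, the glued path still follows
        \<open>a\<close> at its end.\<close>
      show "?c (z1 + z2) = z1" using assms a b by (cases "z1 = y1 \<and> z2 = y2") auto
    qed (use assms a in auto)
    also have "\<dots> = K ?c (x1 + x2) (y1 + y2) + K ?c (y1 + y2) (z1 + z2)"
      using assms by (intro K_combine c) auto
    also have "K ?c (x1 + x2) (y1 + y2) = K a (x1 + x2) (y1 + y2)"
      by (rule K_cong) auto
    also have "K ?c (y1 + y2) (z1 + z2) = K b (y1 + y2) (z1 + z2)"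
      by (rule K_cong) (use a b in auto)
    finally show ?thesis .
  qed
  have "D (x1, x2) (z1, z2) - K a (x1 + x2) (y1 + y2) \<le> D (y1, y2) (z1, z2)"
    if "mpath a" "a (x1 + x2) = x1" "a (y1 + y2) = y1" for a
    using 1[OF that] assms by (intro D_ge) (auto simp: algebra_simps)
  then have "D (x1, x2) (z1, z2) - D (y1, y2) (z1, z2) \<le> D (x1, x2) (y1, y2)"
    using assms by (intro D_ge) (auto simp: algebra_simps)
  then show ?thesis by simp
qed

lemma D_split:
  assumes "mpath a" "a (x1 + x2) = x1" "a (z1 + z2) = z1" "a s = y1" "x1 + x2 \<le> s" "s \<le> z1 + z2"
  shows "D (x1, x2) (y1, s - y1) + D (y1, s - y1) (z1, z2) \<le> K a (x1 + x2) (z1 + z2)"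
  using D_le[of a x1 x2 y1 "s - y1"] D_le[of a y1 "s - y1" z1 z2] K_combine[of a "x1 + x2" s "z1 + z2"] assms
  by auto

text \<open>Two paths whose endpoints are interleaved cross; exchanging their tails at a crossing point
  gives paths for the other pairing of the endpoints.\<close>

lemma D_Monge:
  assumes "x1 \<le> y1" "x2 \<le> y2" "x1' \<le> y1'" "x2' \<le> y2'"
    and "x1' \<le> x1" "x2 \<le> x2'" "y1 \<le> y1'" "y2' \<le> y2"
  shows "D (x1', x2') (y1, y2) + D (x1, x2) (y1', y2') \<le> D (x1, x2) (y1, y2) + D (x1', x2') (y1', y2')"
proof -
  have 1: "D (x1', x2') (y1, y2) + D (x1, x2) (y1', y2') \<le> K a (x1 + x2) (y1 + y2) + K b (x1' + x2') (y1' + y2')"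
    if a: "mpath a" "a (x1 + x2) = x1" "a (y1 + y2) = y1"
      and b: "mpath b" "b (x1' + x2') = x1'" "b (y1' + y2') = y1'" for a b
  proof -
    \<comment> \<open>On the common time span from \<open>l\<close> to \<open>r\<close> the primed
      path starts to the upper left of the other one and ends to its lower right, so the first
      coordinates agree at some time.\<close>
    define l where "l = max (x1 + x2) (x1' + x2')"
    define r where "r = min (y1 + y2) (y1' + y2')"
    have lr: "l \<le> r" unfolding l_def r_def using assms by auto
    have "b l \<le> a l"
      using mpathD[OF a(1), of "x1+x2" l] mpathD[OF b(1), of "x1'+x2'" l] a b assms
      unfolding l_def by (auto simp: max_def split: if_splits)
    moreover have "a r \<le> b r"
      using mpathD[OF a(1), of r "y1+y2"] mpathD[OF b(1), of r "y1'+y2'"] a b assms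
      unfolding r_def by (auto simp: min_def split: if_splits)
    ultimately have "\<exists>s\<ge>l. s \<le> r \<and> b s - a s = 0"
      using lr continuous_on_diff[OF mpath_continuous[OF b(1)] mpath_continuous[OF a(1)], of "{l..r}"]
      by (intro IVT') auto
    then obtain s where s: "l \<le> s" "s \<le> r" "a s = b s" by auto
    have sl: "x1 + x2 \<le> s" "x1' + x2' \<le> s" "s \<le> y1 + y2" "s \<le> y1' + y2'"
      using s unfolding l_def r_def by auto
    let ?z = "(a s, s - a s)"
    have z: "x1 \<le> a s" "x1' \<le> a s" "a s \<le> y1" "a s \<le> y1'" "x2 \<le> s - a s" "x2' \<le> s - a s" "s - a s \<le> y2" "s - a s \<le> y2'"
      using mpathD[OF a(1) sl(1)] mpathD[OF b(1) sl(2)] mpathD[OF a(1) sl(3)] mpathD[OF b(1) sl(4)] a b s(3)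
      by auto
    have "D (x1', x2') (y1, y2) \<le> D (x1', x2') ?z + D ?z (y1, y2)"
      "D (x1, x2) (y1', y2') \<le> D (x1, x2) ?z + D ?z (y1', y2')"
      using z by (auto intro: D_triangle)
    moreover have "D (x1, x2) ?z + D ?z (y1, y2) \<le> K a (x1 + x2) (y1 + y2)"
      using a sl by (intro D_split) auto
    moreover have "D (x1', x2') ?z + D ?z (y1', y2') \<le> K b (x1' + x2') (y1' + y2')"
      using D_split[OF b(1-3) refl sl(2,4)] s by simp
    ultimately show ?thesis by linarith
  qed
  have "D (x1', x2') (y1, y2) + D (x1, x2) (y1', y2') - K a (x1 + x2) (y1 + y2) \<le> D (x1', x2') (y1', y2')"
    if "mpath a" "a (x1 + x2) = x1" "a (y1 + y2) = y1" for a
    using 1[OF that] assms by (intro D_ge) (auto simp: algebra_simps)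
  then have "D (x1', x2') (y1, y2) + D (x1, x2) (y1', y2') - D (x1', x2') (y1', y2') \<le> D (x1, x2) (y1, y2)"
    using assms by (intro D_ge) (auto simp: algebra_simps)
  then show ?thesis by simp
qed

lemma D_le_length:
  assumes "x1 \<le> y1" "x2 \<le> y2"
  shows "D (x1, x2) (y1, y2) \<le> M * ((y1 + y2) - (x1 + x2))"
proof -
  obtain a where "a \<in> mpaths (x1, x2) (y1, y2)" using mpaths_nonempty[OF assms] by blast
  note a = mpathsD[OF this]
  show ?thesis using D_le[OF a] K_le_length[OF a(1), of "x1 + x2" "y1 + y2"] assms by simp
qed

lemma M_nonneg: "0 \<le> M" using h_nonneg[of 0 0] h_le[of 0 0] by simp

text \<open>In one direction a horizontal piece of height at most \<open>M\<close> is prepended. In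
  the other, a path is pushed to the right of \<open>x1'\<close> by a maximum, which shifts it by at
  most \<open>x1' - x1\<close>.\<close>

lemma D_move_start:
  assumes "x1 \<le> x1'" "x1' \<le> y1" "x2 \<le> y2"
  shows "\<bar>D (x1, x2) (y1, y2) - D (x1', x2) (y1, y2)\<bar> \<le> (M + 2 * (y1 + y2 - x1 - x2)) * (x1' - x1)"
proof -
  have "D (x1, x2) (y1, y2) \<le> D (x1, x2) (x1', x2) + D (x1', x2) (y1, y2)"
    using assms by (intro D_triangle) auto
  moreover have "D (x1, x2) (x1', x2) \<le> M * (x1' - x1)" using D_le_length[of x1 x1' x2 x2] assms by simp
  moreover have "D (x1', x2) (y1, y2) - 2 * (y1 + y2 - x1 - x2) * (x1' - x1) \<le> D (x1, x2) (y1, y2)"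
  proof (rule D_ge)
    fix a assume a: "mpath a" "a (x1 + x2) = x1" "a (y1 + y2) = y1"
    let ?b = "\<lambda>s. max (a s) x1'"
    have b: "mpath ?b" using a by (intro mpath_max) auto
    have "D (x1', x2) (y1, y2) \<le> K ?b (x1' + x2) (y1 + y2)"
      using mpathD[OF a(1), of "x1 + x2" "x1' + x2"] a assms by (intro D_le b) auto
    also have "\<dots> \<le> K a (x1' + x2) (y1 + y2) + 2 * (x1' - x1) * (y1 + y2 - (x1' + x2))"
    proof (rule K_le_close[OF b a(1)])
      fix s assume s: "x1' + x2 \<le> s" "s \<le> y1 + y2"
      then show "\<bar>?b s - a s\<bar> \<le> x1' - x1"
        using mpathD[OF a(1), of "x1 + x2" s] a assms by auto
    qed (use assms in auto)
    also have "2 * (x1' - x1) * (y1 + y2 - (x1' + x2)) \<le> 2 * (x1' - x1) * (y1 + y2 - x1 - x2)"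
      using assms by (intro mult_left_mono) auto
    also have "K a (x1' + x2) (y1 + y2) \<le> K a (x1 + x2) (y1 + y2)"
      using K_combine[of a "x1 + x2" "x1' + x2" "y1 + y2"] K_nonneg[of a "x1+x2" "x1' + x2"] a assms by auto
    finally show "D (x1', x2) (y1, y2) - 2 * (y1 + y2 - x1 - x2) * (x1' - x1) \<le> K a (x1 + x2) (y1 + y2)"
      by (simp add: algebra_simps)
  qed (use assms in auto)
  moreover have "0 \<le> M * (x1' - x1)" "0 \<le> 2 * (y1 + y2 - x1 - x2) * (x1' - x1)" using M_nonneg assms by auto
  ultimately show ?thesis by (auto simp: algebra_simps)
qed

text \<open>Dual to \<open>D_move_start\<close>: a horizontal piece is appended, or a path is cut
  off at \<open>y1\<close> by a minimum.\<close>

lemma D_move_end: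
  assumes "x1 \<le> y1" "y1 \<le> y1'" "x2 \<le> y2"
  shows "\<bar>D (x1, x2) (y1, y2) - D (x1, x2) (y1', y2)\<bar> \<le> (M + 2 * (y1' + y2 - x1 - x2)) * (y1' - y1)"
proof -
  have "D (x1, x2) (y1', y2) \<le> D (x1, x2) (y1, y2) + D (y1, y2) (y1', y2)"
    using assms by (intro D_triangle) auto
  moreover have "D (y1, y2) (y1', y2) \<le> M * (y1' - y1)" using D_le_length[of y1 y1' y2 y2] assms by simp
  moreover have "D (x1, x2) (y1, y2) - 2 * (y1' + y2 - x1 - x2) * (y1' - y1) \<le> D (x1, x2) (y1', y2)"
  proof (rule D_ge)
    fix a assume a: "mpath a" "a (x1 + x2) = x1" "a (y1' + y2) = y1'"
    let ?b = "\<lambda>s. min (a s) y1"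
    have b: "mpath ?b" using a by (intro mpath_min) auto
    have "D (x1, x2) (y1, y2) \<le> K ?b (x1 + x2) (y1 + y2)"
      using mpathD[OF a(1), of "y1 + y2" "y1' + y2"] a assms by (intro D_le b) auto
    also have "\<dots> \<le> K a (x1 + x2) (y1 + y2) + 2 * (y1' - y1) * (y1 + y2 - (x1 + x2))"
    proof (rule K_le_close[OF b a(1)])
      fix s assume s: "x1 + x2 \<le> s" "s \<le> y1 + y2"
      then show "\<bar>?b s - a s\<bar> \<le> y1' - y1"
        using mpathD[OF a(1), of s "y1' + y2"] a assms by auto
    qed (use assms in auto)
    also have "2 * (y1' - y1) * (y1 + y2 - (x1 + x2)) \<le> 2 * (y1' - y1) * (y1' + y2 - x1 - x2)"
      using assms by (intro mult_left_mono) auto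
    also have "K a (x1 + x2) (y1 + y2) \<le> K a (x1 + x2) (y1' + y2)"
      using K_combine[of a "x1 + x2" "y1 + y2" "y1' + y2"] K_nonneg[of a "y1+y2" "y1' + y2"] a assms by auto
    finally show "D (x1, x2) (y1, y2) - 2 * (y1' + y2 - x1 - x2) * (y1' - y1) \<le> K a (x1 + x2) (y1' + y2)"
      by (simp add: algebra_simps)
  qed (use assms in auto)
  moreover have "0 \<le> M * (y1' - y1)" "0 \<le> 2 * (y1' + y2 - x1 - x2) * (y1' - y1)" using M_nonneg assms by auto
  ultimately show ?thesis by (auto simp: algebra_simps)
qed

lemma height_flip: "height (\<lambda>x y. h y x) M"
proof
  show "\<bar>h y x - h y' x'\<bar> \<le> \<bar>x - x'\<bar> + \<bar>y - y'\<bar>" for x y x' y'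
    using h_lip[of y x y' x'] by simp
qed (auto intro: h_nonneg h_le)

end

text \<open>Reflection in the diagonal replaces \<open>a s\<close> by \<open>s - a s\<close> and is
  its own inverse.\<close>

lemma mincost_flip: "mincost (\<lambda>x y. h y x) (x2, x1) (y2, y1) = mincost h (x1, x2) (y1, y2)"
proof -
  have *: "mpaths (x2, x1) (y2, y1) = (\<lambda>a s. s - a s) ` mpaths (x1, x2) (y1, y2)"
  proof safe
    fix a assume "a \<in> mpaths (x2, x1) (y2, y1)"
    then have "(\<lambda>s. s - a s) \<in> mpaths (x1, x2) (y1, y2)"
      by (auto simp: mpaths_def add.commute intro: mpath_flip)
    then show "a \<in> (\<lambda>a s. s - a s) ` mpaths (x1, x2) (y1, y2)"
      by (rule rev_image_eqI) simp
  next
    fix a assume "a \<in> mpaths (x1, x2) (y1, y2)"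
    then show "(\<lambda>s. s - a s) \<in> mpaths (x2, x1) (y2, y1)"
      by (auto simp: mpaths_def add.commute intro: mpath_flip)
  qed
  show ?thesis unfolding mincost_def * by (simp add: image_image cost_def add.commute)
qed

section \<open>Heights inside a cell\<close>

lemma is_normD:
  assumes "is_norm N"
  shows is_norm_zero_iff: "N x = 0 \<longleftrightarrow> x = 0"
    and is_norm_scale: "N (c *\<^sub>R x) = \<bar>c\<bar> * N x"
    and is_norm_triangle: "N (x + y) \<le> N x + N y"
    and is_norm_minus: "N (- x) = N x"
    and is_norm_minus_commute: "N (x - y) = N (y - x)"
    and is_norm_nonneg: "0 \<le> N x"
    and is_norm_diff: "\<bar>N x - N y\<bar> \<le> N (x - y)"
    and is_norm_triangle_minus: "N (x - y) \<le> N x + N y"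
proof -
  show z: "N x = 0 \<longleftrightarrow> x = 0" for x using assms by (auto simp: is_norm_def)
  show s: "N (c *\<^sub>R x) = \<bar>c\<bar> * N x" for c x using assms by (auto simp: is_norm_def)
  show t: "N (x + y) \<le> N x + N y" for x y using assms by (auto simp: is_norm_def)
  show m: "N (- x) = N x" for x using s[of "-1" x] by simp
  show mc: "N (x - y) = N (y - x)" for x y using m[of "x - y"] by simp
  show "0 \<le> N x" using t[of x "-x"] m[of x] z[of "0"] by simp
  show "\<bar>N x - N y\<bar> \<le> N (x - y)" using t[of "x - y" y] t[of "y - x" x] mc[of x y] by simp
  show "N (x - y) \<le> N x + N y" using t[of x "- y"] m[of y] by simp
qed

section \<open>The height of two straight segments and its valley\<close>

locale affine_height =
  fixes N :: "real^2 \<Rightarrow> real" and u v w :: "real^2"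
  assumes N: "is_norm N" and u: "N u = 1" and v: "N v = 1"
begin

text \<open>The height of a cell whose segments have unit directions \<open>u\<close> and
  \<open>v\<close>, extended to the whole plane: the valley may leave the cell.\<close>

definition G :: "real \<Rightarrow> real \<Rightarrow> real" where
  "G x y = N (w + x *\<^sub>R u - y *\<^sub>R v)"

lemma G_convex:
  assumes "0 \<le> b" "b \<le> 1"
  shows "G ((1 - b) * x + b * x') ((1 - b) * y + b * y') \<le> (1 - b) * G x y + b * G x' y'"
proof -
  have "w + ((1 - b) * x + b * x') *\<^sub>R u - ((1 - b) * y + b * y') *\<^sub>R v
      = (1 - b) *\<^sub>R (w + x *\<^sub>R u - y *\<^sub>R v) + b *\<^sub>R (w + x' *\<^sub>R u - y' *\<^sub>R v)"
    by (simp add: algebra_simps)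
  then show ?thesis unfolding G_def
    using is_norm_triangle[OF N, of "(1 - b) *\<^sub>R (w + x *\<^sub>R u - y *\<^sub>R v)" "b *\<^sub>R (w + x' *\<^sub>R u - y' *\<^sub>R v)"]
    by (simp only: is_norm_scale[OF N]) (use assms in auto)
qed

text \<open>The vector in the middle is the change of the difference vector between the two points.
  \<open>G_sum\<close> prevents both heights from being small when this change is large.\<close>

lemma G_diff: "\<bar>G x y - G x' y'\<bar> \<le> N ((x - x') *\<^sub>R u - (y - y') *\<^sub>R v)"
  and G_sum: "N ((x - x') *\<^sub>R u - (y - y') *\<^sub>R v) \<le> G x y + G x' y'"
proof -
  have *: "(w + x *\<^sub>R u - y *\<^sub>R v) - (w + x' *\<^sub>R u - y' *\<^sub>R v) = (x - x') *\<^sub>R u - (y - y') *\<^sub>R v"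
    by (simp add: algebra_simps)
  show "\<bar>G x y - G x' y'\<bar> \<le> N ((x - x') *\<^sub>R u - (y - y') *\<^sub>R v)"
    using is_norm_diff[OF N, of "w + x *\<^sub>R u - y *\<^sub>R v" "w + x' *\<^sub>R u - y' *\<^sub>R v"] unfolding * G_def .
  show "N ((x - x') *\<^sub>R u - (y - y') *\<^sub>R v) \<le> G x y + G x' y'"
    using is_norm_triangle_minus[OF N, of "w + x *\<^sub>R u - y *\<^sub>R v" "w + x' *\<^sub>R u - y' *\<^sub>R v"] unfolding * G_def .
qed

text \<open>A convex function increases away from its minimiser; \<open>x\<close> is written as a
  convex combination of \<open>\<xi>\<close> and \<open>x'\<close>.\<close>

lemma G_antidiagonal_mono:
  assumes min: "\<And>x. G \<xi> (\<tau> - \<xi>) \<le> G x (\<tau> - x)" and "\<xi> \<le> x" "x \<le> x'"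
  shows "G x (\<tau> - x) \<le> G x' (\<tau> - x')"
proof (cases "x' = \<xi>")
  case False
  define b where "b = (x - \<xi>) / (x' - \<xi>)"
  have b: "0 \<le> b" "b \<le> 1" "b * (x' - \<xi>) = x - \<xi>" using False assms by (auto simp: b_def)
  have x: "x = (1 - b) * \<xi> + b * x'" using b(3) by (simp add: algebra_simps)
  have "\<tau> - x = (1 - b) * (\<tau> - \<xi>) + b * (\<tau> - x')" using b(3) by (simp add: algebra_simps)
  then have "G x (\<tau> - x) \<le> (1 - b) * G \<xi> (\<tau> - \<xi>) + b * G x' (\<tau> - x')"
    using G_convex[OF b(1,2), of \<xi> x' "\<tau> - \<xi>" "\<tau> - x'"] x by simp
  also have "\<dots> \<le> (1 - b) * G x' (\<tau> - x') + b * G x' (\<tau> - x')"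
    using b min[of x'] by (intro add_right_mono mult_left_mono) auto
  finally show ?thesis by (simp add: algebra_simps)
qed (use assms in auto)

text \<open>The valley is the line of the points with coordinate sum \<open>\<tau>\<close> and first coordinate \<open>c + \<tau> * d\<close>.\<close>

definition valley :: "real \<Rightarrow> real \<Rightarrow> bool" where
  "valley c d \<longleftrightarrow> 0 < d \<and> d < 1 \<and>
     (\<forall>\<tau> x. G (c + \<tau> * d) (\<tau> - (c + \<tau> * d)) \<le> G x (\<tau> - x)) \<and>
     (\<forall>\<tau> \<tau>'. \<bar>G (c + \<tau> * d) (\<tau> - (c + \<tau> * d)) - G (c + \<tau>' * d) (\<tau>' - (c + \<tau>' * d))\<bar> \<le> \<bar>\<tau> - \<tau>'\<bar> / 2)"

text \<open>\<open>f \<theta>\<close> is the movement of the difference vector per unit of progress,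
  of which a share \<open>\<theta>\<close> is spent on the first curve. If its minimum is at least
  1/2, movement is steep. Otherwise the minimiser \<open>d\<close> is interior, since
  \<open>f\<close> is 1 at both ends, and it gives the direction of the valley. The line is placed
  through a zero of the height; if there is none, the directions coincide and the height depends on
  \<open>x - y\<close> only.\<close>

lemma steep_or_valley:
  "(\<forall>x y. 0 \<le> x \<longrightarrow> 0 \<le> y \<longrightarrow> (x + y) / 2 \<le> N (x *\<^sub>R u - y *\<^sub>R v)) \<or> (\<exists>c d. valley c d)"
proof -
  define f where "f \<theta> = N (\<theta> *\<^sub>R u - (1 - \<theta>) *\<^sub>R v)" for \<theta>
  have scale: "N (x *\<^sub>R u - y *\<^sub>R v) = \<bar>x + y\<bar> * f (x / (x + y))" if "x + y \<noteq> 0" for x y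
  proof -
    have "x *\<^sub>R u - y *\<^sub>R v = (x + y) *\<^sub>R ((x / (x + y)) *\<^sub>R u - (1 - x / (x + y)) *\<^sub>R v)"
      using that by (simp add: scaleR_diff_right right_diff_distrib)
    then show ?thesis using is_norm_scale[OF N] by (simp add: f_def)
  qed
  have "\<bar>f \<theta> - f \<theta>'\<bar> \<le> N (u + v) * \<bar>\<theta> - \<theta>'\<bar>" for \<theta> \<theta>'
  proof -
    have *: "(\<theta> *\<^sub>R u - (1 - \<theta>) *\<^sub>R v) - (\<theta>' *\<^sub>R u - (1 - \<theta>') *\<^sub>R v) = (\<theta> - \<theta>') *\<^sub>R (u + v)"
      by (simp add: algebra_simps)
    show ?thesis
      using is_norm_diff[OF N, of "\<theta> *\<^sub>R u - (1 - \<theta>) *\<^sub>R v" "\<theta>' *\<^sub>R u - (1 - \<theta>') *\<^sub>R v"]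
      unfolding * f_def by (simp only: is_norm_scale[OF N] mult.commute)
  qed
  then have "(N (u + v))-lipschitz_on {0..1} f"
    using is_norm_nonneg[OF N] by (auto simp: lipschitz_on_def dist_real_def)
  then have "continuous_on {0..1} f" by (rule lipschitz_on_continuous_on)
  then obtain d where d: "d \<in> {0..1}" "\<And>\<theta>. \<theta> \<in> {0..1} \<Longrightarrow> f d \<le> f \<theta>"
    using continuous_attains_inf[of "{0..1::real}" f] by auto
  have f01: "f 0 = 1" "f 1 = 1" by (simp_all add: f_def u v is_norm_minus[OF N])
  show ?thesis
  proof (cases "f d \<ge> 1/2")
    case True
    have "(x + y) / 2 \<le> N (x *\<^sub>R u - y *\<^sub>R v)" if "0 \<le> x" "0 \<le> y" for x y
    proof (cases "x + y = 0")
      case False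
      then have "f d \<le> f (x / (x + y))" using that by (intro d) (auto simp: divide_simps)
      then have "1/2 \<le> f (x / (x + y))" using True by simp
      from mult_left_mono[OF this, of "x + y"] that scale[OF False] show ?thesis by simp
    qed (use that is_norm_nonneg[OF N] in auto)
    then show ?thesis by blast
  next
    case False
    then have mu: "f d < 1/2" by simp
    have d01: "0 < d" "d < 1" using mu f01 d(1) by (auto simp: less_le)
    have f_convex: "f ((1 - b) * x + b * y) \<le> (1 - b) * f x + b * f y" if "0 \<le> b" "b \<le> 1" for b x y
    proof -
      have "((1 - b) * x + b * y) *\<^sub>R u - (1 - ((1 - b) * x + b * y)) *\<^sub>R v
          = (1 - b) *\<^sub>R (x *\<^sub>R u - (1 - x) *\<^sub>R v) + b *\<^sub>R (y *\<^sub>R u - (1 - y) *\<^sub>R v)"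
        by (simp add: algebra_simps)
      then show ?thesis unfolding f_def
        using is_norm_triangle[OF N, of "(1 - b) *\<^sub>R (x *\<^sub>R u - (1 - x) *\<^sub>R v)" "b *\<^sub>R (y *\<^sub>R u - (1 - y) *\<^sub>R v)"]
        by (simp only: is_norm_scale[OF N]) (use that in auto)
    qed
    \<comment> \<open>A smaller value outside the unit interval would, by convexity, force a value
      below 1/2 at the endpoint 0 or 1 lying between, where \<open>f\<close> is 1.\<close>
    have min: "f d \<le> f \<theta>" for \<theta>
    proof (rule ccontr)
      assume less: "\<not> f d \<le> f \<theta>"
      then have "\<theta> < 0 \<or> \<theta> > 1" using d(2)[of \<theta>] by (meson atLeastAtMost_iff not_le)
      then obtain b e where b: "0 \<le> b" "b \<le> 1" "f e = 1" "(1 - b) * d + b * \<theta> = e"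
      proof
        assume t: "\<theta> < 0"
        have "(1 - d / (d - \<theta>)) * d + d / (d - \<theta>) * \<theta> = 0" using t d01 by (simp add: field_simps)
        then show thesis using that[of "d / (d - \<theta>)" 0] t d01 f01 by auto
      next
        assume t: "\<theta> > 1"
        define b where "b = (1 - d) / (\<theta> - d)"
        have "b * (\<theta> - d) = 1 - d" using t d01 by (simp add: b_def)
        then have "(1 - b) * d + b * \<theta> = 1" by (simp add: algebra_simps)
        then show thesis using that[of b 1] t d01 f01 by (auto simp: b_def)
      qed
      have "1 \<le> (1 - b) * f d + b * f \<theta>" using f_convex[OF b(1,2), of d \<theta>] b(3,4) by simp
      also have "\<dots> \<le> (1 - b) * f d + b * f d" using b less by (intro add_left_mono mult_left_mono) auto
      finally show False using mu by (simp add: algebra_simps)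
    qed
    have dir: "N ((t * d) *\<^sub>R u - (t * (1 - d)) *\<^sub>R v) = \<bar>t\<bar> * f d" for t
    proof -
      have "(t * d) *\<^sub>R u - (t * (1 - d)) *\<^sub>R v = t *\<^sub>R (d *\<^sub>R u - (1 - d) *\<^sub>R v)"
        by (simp add: algebra_simps)
      then show ?thesis by (simp add: is_norm_scale[OF N] f_def)
    qed
    have lip: "\<bar>G (c + \<tau> * d) (\<tau> - (c + \<tau> * d)) - G (c + \<tau>' * d) (\<tau>' - (c + \<tau>' * d))\<bar> \<le> \<bar>\<tau> - \<tau>'\<bar> / 2" for c \<tau> \<tau>'
    proof -
      have "\<bar>G (c + \<tau> * d) (\<tau> - (c + \<tau> * d)) - G (c + \<tau>' * d) (\<tau>' - (c + \<tau>' * d))\<bar> \<le> \<bar>\<tau> - \<tau>'\<bar> * f d"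
        using G_diff[of "c + \<tau> * d" "\<tau> - (c + \<tau> * d)" "c + \<tau>' * d" "\<tau>' - (c + \<tau>' * d)"] dir[of "\<tau> - \<tau>'"]
        by (simp add: algebra_simps)
      also have "\<dots> \<le> \<bar>\<tau> - \<tau>'\<bar> * (1/2)" using mu by (intro mult_left_mono) auto
      finally show ?thesis by simp
    qed
    have "\<exists>c. \<forall>\<tau> x. G (c + \<tau> * d) (\<tau> - (c + \<tau> * d)) \<le> G x (\<tau> - x)"
    proof (cases "\<exists>x0 y0. w + x0 *\<^sub>R u - y0 *\<^sub>R v = 0")
      case True
      then obtain x0 y0 where "w + x0 *\<^sub>R u - y0 *\<^sub>R v = 0" by blast
      then have w: "w = y0 *\<^sub>R v - x0 *\<^sub>R u" by (simp add: algebra_simps eq_neg_iff_add_eq_0)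
      have "w + x *\<^sub>R u - y *\<^sub>R v = (x - x0) *\<^sub>R u - (y - y0) *\<^sub>R v" for x y
        by (subst w) (simp add: algebra_simps)
      then have G: "G x y = N ((x - x0) *\<^sub>R u - (y - y0) *\<^sub>R v)" for x y
        by (simp add: G_def)
      show ?thesis
      proof (intro exI allI)
        fix \<tau> x
        \<comment> \<open>With this offset the line passes through the zero \<open>(x0, y0)\<close>
          at coordinate sum \<open>x0 + y0\<close>.\<close>
        let ?c = "x0 - (x0 + y0) * d" and ?t = "\<tau> - (x0 + y0)"
        have "G (?c + \<tau> * d) (\<tau> - (?c + \<tau> * d)) = N ((?t * d) *\<^sub>R u - (?t * (1 - d)) *\<^sub>R v)"
          unfolding G by (rule arg_cong[of _ _ N]) (simp add: algebra_simps)
        also have "\<dots> = \<bar>?t\<bar> * f d" by (rule dir)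
        also have "\<dots> \<le> G x (\<tau> - x)"
        proof (cases "?t = 0")
          case False
          have "\<bar>?t\<bar> * f d \<le> \<bar>?t\<bar> * f ((x - x0) / ?t)" by (intro mult_left_mono min) auto
          also have "\<dots> = N ((x - x0) *\<^sub>R u - (\<tau> - x - y0) *\<^sub>R v)"
            using scale[of "x - x0" "\<tau> - x - y0"] False by (simp add: algebra_simps)
          finally show ?thesis by (simp add: G)
        qed (use is_norm_nonneg[OF N] in \<open>auto simp: G\<close>)
        finally show "G (?c + \<tau> * d) (\<tau> - (?c + \<tau> * d)) \<le> G x (\<tau> - x)" .
      qed
    next
      case False
      \<comment> \<open>If the directions were linearly independent, Cramer's rule would give a zero
        of the height.\<close>
      have det: "u $ 1 * v $ 2 = u $ 2 * v $ 1"
      proof (rule ccontr)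
        assume "u $ 1 * v $ 2 \<noteq> u $ 2 * v $ 1"
        then have D: "u $ 1 * v $ 2 - u $ 2 * v $ 1 \<noteq> 0" (is "?D \<noteq> 0") by simp
        define x0 where "x0 = (w $ 2 * v $ 1 - w $ 1 * v $ 2) / ?D"
        define y0 where "y0 = (u $ 1 * w $ 2 - u $ 2 * w $ 1) / ?D"
        have "(w $ i + x0 * u $ i - y0 * v $ i) * ?D = 0" if "i = 1 \<or> i = 2" for i
        proof -
          have "x0 * ?D = w $ 2 * v $ 1 - w $ 1 * v $ 2" "y0 * ?D = u $ 1 * w $ 2 - u $ 2 * w $ 1"
            using D by (simp_all add: x0_def y0_def)
          moreover have "(w $ i + x0 * u $ i - y0 * v $ i) * ?D = w $ i * ?D + (x0 * ?D) * u $ i - (y0 * ?D) * v $ i"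
            by (simp add: algebra_simps)
          ultimately have "(w $ i + x0 * u $ i - y0 * v $ i) * ?D
              = w $ i * ?D + (w $ 2 * v $ 1 - w $ 1 * v $ 2) * u $ i - (u $ 1 * w $ 2 - u $ 2 * w $ 1) * v $ i"
            by simp
          then show ?thesis using that by (auto simp: algebra_simps)
        qed
        then have "w + x0 *\<^sub>R u - y0 *\<^sub>R v = 0"
          using D unfolding vec_eq_iff forall_2 by auto
        then show False using False by blast
      qed
      have "u \<noteq> 0" using u is_norm_zero_iff[OF N, of u] by auto
      then obtain k where k: "v = k *\<^sub>R u"
      proof (cases "u $ 1 = 0")
        case True
        then have "u $ 2 \<noteq> 0" using \<open>u \<noteq> 0\<close> by (simp add: vec_eq_iff forall_2)
        then have "v = (v $ 2 / u $ 2) *\<^sub>R u" using True det by (simp add: vec_eq_iff forall_2)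
        then show ?thesis using that by blast
      next
        case False
        then have "v = (v $ 1 / u $ 1) *\<^sub>R u" using det by (simp add: vec_eq_iff forall_2 field_simps)
        then show ?thesis using that by blast
      qed
      have "\<bar>k\<bar> = 1" using v u is_norm_scale[OF N, of k u] k by simp
      \<comment> \<open>For opposite directions \<open>f\<close> is constantly 1, which the present
        case excludes.\<close>
      moreover have "k \<noteq> -1"
      proof
        assume "k = -1"
        then have "f d = N ((d + (1 - d)) *\<^sub>R u)" unfolding f_def k by (simp add: algebra_simps)
        then show False using u mu by simp
      qed
      ultimately have "v = u" using k by (auto simp: abs_if split: if_splits)
      have f_eq: "f \<theta> = \<bar>2 * \<theta> - 1\<bar>" for \<theta>
      proof -
        have "\<theta> *\<^sub>R u - (1 - \<theta>) *\<^sub>R v = (2 * \<theta> - 1) *\<^sub>R u"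
          unfolding \<open>v = u\<close> by (simp add: algebra_simps flip: scaleR_add_left)
        then show ?thesis using is_norm_scale[OF N, of "2 * \<theta> - 1" u] by (simp add: f_def u)
      qed
      have d: "d = 1/2" using min[of "1/2"] by (simp add: f_eq)
      define g where "g \<delta> = N (w + \<delta> *\<^sub>R u)" for \<delta>
      have g_lip: "\<bar>g \<delta> - g \<delta>'\<bar> \<le> \<bar>\<delta> - \<delta>'\<bar>" for \<delta> \<delta>'
        using is_norm_diff[OF N, of "w + \<delta> *\<^sub>R u" "w + \<delta>' *\<^sub>R u"] is_norm_scale[OF N, of "\<delta> - \<delta>'" u] u
        by (simp add: g_def scaleR_diff_left)
      then have "1-lipschitz_on {- 2 * g 0..2 * g 0} g" by (auto simp: lipschitz_on_def dist_real_def)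
      then have "continuous_on {- 2 * g 0..2 * g 0} g" by (rule lipschitz_on_continuous_on)
      moreover have g0: "0 \<le> g 0" using is_norm_nonneg[OF N] by (simp add: g_def)
      ultimately obtain \<delta>0 where \<delta>0: "\<And>\<delta>. \<delta> \<in> {- 2 * g 0..2 * g 0} \<Longrightarrow> g \<delta>0 \<le> g \<delta>"
        using continuous_attains_inf[of "{- 2 * g 0..2 * g 0}" g] by fastforce
      \<comment> \<open>Outside the compact interval the triangle inequality gives a value above
        \<open>g 0\<close>, so its minimum is a global one.\<close>
      have g_min: "g \<delta>0 \<le> g \<delta>" for \<delta>
      proof (cases "\<delta> \<in> {- 2 * g 0..2 * g 0}")
        case False
        have "\<bar>\<delta>\<bar> \<le> g \<delta> + g 0"
          using is_norm_triangle_minus[OF N, of "w + \<delta> *\<^sub>R u" w] is_norm_scale[OF N, of \<delta> u] u by (simp add: g_def)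
        moreover have "\<bar>\<delta>\<bar> > 2 * g 0" using False by auto
        ultimately have "g 0 \<le> g \<delta>" by simp
        then show ?thesis using \<delta>0[of 0] g0 by auto
      qed (rule \<delta>0)
      have "w + x *\<^sub>R u - y *\<^sub>R v = w + (x - y) *\<^sub>R u" for x y
        by (subst \<open>v = u\<close>) (simp add: algebra_simps)
      then have "G x y = g (x - y)" for x y by (simp only: G_def g_def)
      \<comment> \<open>With offset \<open>\<delta>0 / 2\<close> and slope 1/2 the two coordinates
        differ by \<open>\<delta>0\<close> all along the line.\<close>
      then show ?thesis using g_min d by (intro exI[of _ "\<delta>0 / 2"]) (simp add: field_simps)
    qed
    then show ?thesis unfolding valley_def using d01 lip by blast
  qed
qed

end

text \<open>\<open>k\<close> is the height along one leg of a detour and \<open>p\<close> the height along the path it replaces. At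
  distance \<open>a\<close> from the corner of the detour, where the height is \<open>H\<close>, the leg crosses the valley.\<close>

lemma leg_excess:
  fixes k p :: "real \<Rightarrow> real"
  assumes "l \<le> r" "continuous_on {l..r} k" "continuous_on {l..r} p" "0 < a"
    and near: "\<And>s. l \<le> s \<Longrightarrow> s \<le> r \<Longrightarrow> s \<le> l + a \<Longrightarrow> k s - p s \<le> q * (l + a - s)"
    and far: "\<And>s. l \<le> s \<Longrightarrow> s \<le> r \<Longrightarrow> l + a \<le> s \<Longrightarrow> k s \<le> p s"
    and q: "q * a \<le> 2 * H - a / 2"
  shows "integral {l..r} k \<le> integral {l..r} p + H\<^sup>2"
proof -
  \<comment> \<open>The leg may end before it reaches the valley; only the part up to
    \<open>m\<close> can be more expensive than the path.\<close>
  define m where "m = min r (l + a)"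
  have m: "l \<le> m" "m \<le> r" "m \<le> l + a" using assms by (auto simp: m_def)
  have I: "k integrable_on {l'..r'}" "p integrable_on {l'..r'}" if "l \<le> l'" "r' \<le> r" for l' r'
    using that assms by (auto intro!: integrable_continuous_interval elim: continuous_on_subset)
  have J: "((\<lambda>s. q * (l + a - s)) has_integral (q * ((l + a) * m - m\<^sup>2/2) - q * ((l + a) * l - l\<^sup>2/2))) {l..m}"
    by (rule fundamental_theorem_of_calculus[OF m(1)])
      (auto intro!: derivative_eq_intros simp: has_real_derivative_iff_has_vector_derivative[symmetric])
  have "integral {l..m} k - integral {l..m} p = integral {l..m} (\<lambda>s. k s - p s)"
    by (rule sym, rule Henstock_Kurzweil_Integration.integral_diff) (use m I in auto)
  also have "\<dots> \<le> integral {l..m} (\<lambda>s. q * (l + a - s))"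
    by (rule integral_le) (use m J near in \<open>auto intro!: Henstock_Kurzweil_Integration.integrable_diff I\<close>)
  also have "\<dots> = q * (a * (m - l) - (m - l)\<^sup>2 / 2)"
    unfolding integral_unique[OF J] by (simp add: power2_eq_square field_simps)
  also have "\<dots> \<le> H\<^sup>2"
  proof (cases "q \<le> 0")
    case True
    have "0 \<le> a * (m - l) - (m - l)\<^sup>2 / 2"
      using m mult_right_mono[of "m - l" a "m - l"] mult_nonneg_nonneg[of a "m - l"] \<open>0 < a\<close>
      unfolding power2_eq_square by linarith
    then have "q * (a * (m - l) - (m - l)\<^sup>2 / 2) \<le> 0" using True by (simp add: mult_nonpos_nonneg)
    then show ?thesis using zero_le_power2[of H] by linarith
  next
    case False
    \<comment> \<open>The whole triangle \<open>q * a^2 / 2\<close> bounds the excess. By the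
      hypothesis on \<open>q * a\<close> it is at most \<open>H * a - a^2 / 4\<close>, and
      completing the square bounds this by \<open>H^2\<close>.\<close>
    have "a * e - e\<^sup>2 / 2 \<le> a\<^sup>2 / 2" for e
      using zero_le_power2[of "a - e"] by (simp add: power2_diff)
    then have "q * (a * (m - l) - (m - l)\<^sup>2 / 2) \<le> q * (a\<^sup>2 / 2)"
      using False by (intro mult_left_mono) auto
    also have "\<dots> = (q * a) * (a / 2)" by (simp add: power2_eq_square)
    also have "\<dots> \<le> (2 * H - a / 2) * (a / 2)" using q assms by (intro mult_right_mono) auto
    also have "\<dots> \<le> H\<^sup>2" using zero_le_power2[of "H - a / 2"] by (simp add: power2_eq_square algebra_simps)
    finally show ?thesis .
  qed
  finally have "integral {l..m} k \<le> integral {l..m} p + H\<^sup>2" by simp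
  moreover have "integral {m..r} k \<le> integral {m..r} p"
  proof (cases "m = r")
    case False
    then have "m = l + a" by (auto simp: m_def min_def split: if_splits)
    then show ?thesis using m by (intro integral_le I far) auto
  qed auto
  moreover have "integral {l..r} k = integral {l..m} k + integral {m..r} k"
    "integral {l..r} p = integral {l..m} p + integral {m..r} p"
    using m I by (auto intro!: Henstock_Kurzweil_Integration.integral_combine[symmetric])
  ultimately show ?thesis by linarith
qed

text \<open>Time reversal, for a leg that ends at the corner of the detour instead of starting
  there.\<close>

lemma leg_excess_mirror:
  fixes k p :: "real \<Rightarrow> real"
  assumes "l \<le> r" "continuous_on {l..r} k" "continuous_on {l..r} p" "0 < a"
    and near: "\<And>s. l \<le> s \<Longrightarrow> s \<le> r \<Longrightarrow> r - a \<le> s \<Longrightarrow> k s - p s \<le> q * (s - (r - a))"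
    and far: "\<And>s. l \<le> s \<Longrightarrow> s \<le> r \<Longrightarrow> s \<le> r - a \<Longrightarrow> k s \<le> p s"
    and q: "q * a \<le> 2 * H - a / 2"
  shows "integral {l..r} k \<le> integral {l..r} p + H\<^sup>2"
proof -
  have cont: "continuous_on {- r..- l} (\<lambda>s. f (- s))" if "continuous_on {l..r} f" for f :: "real \<Rightarrow> real"
    by (rule continuous_on_compose2[OF that]) (auto intro!: continuous_intros)
  have "integral {- r..- l} (\<lambda>s. k (- s)) \<le> integral {- r..- l} (\<lambda>s. p (- s)) + H\<^sup>2"
  proof (rule leg_excess[where a = a and q = q])
    fix s assume "- r \<le> s" "s \<le> - l" "s \<le> - r + a"
    then show "k (- s) - p (- s) \<le> q * (- r + a - s)" using near[of "- s"] by (simp add: algebra_simps)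
  qed (use assms in \<open>auto intro: cont\<close>)
  then show ?thesis by (simp add: Henstock_Kurzweil_Integration.integral_reflect_real)
qed

section \<open>Detours and lower bounds for path costs inside one cell\<close>

locale cell = height h M + affine_height N u v w
  for h M N u v w +
  fixes x0 x1 y0 y1 :: real
  assumes x01: "x0 \<le> x1" and y01: "y0 \<le> y1"
    and h_cell: "x0 \<le> x \<Longrightarrow> x \<le> x1 \<Longrightarrow> y0 \<le> y \<Longrightarrow> y \<le> y1 \<Longrightarrow> h x y = G x y"
begin

text \<open>On each antidiagonal the path \<open>a\<close> lies to the lower right of the leg on the
  north border. Once the valley is to the left of the leg, the height increases from the leg to the
  path. Before that, convexity bounds the leg by interpolating between \<open>H\<close> and the
  height \<open>\<kappa>\<close> at the crossing, and the path is no lower than the valley.\<close>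

lemma right_leg_excess:
  assumes V: "valley c d" and t: "x0 \<le> t" "t \<le> x1"
    and a: "mpath a" "t \<le> a (t + y1)" "y0 \<le> (t + y1) - a (t + y1)" "a (x1 + y1) = x1"
  shows "integral {t + y1..x1 + y1} (\<lambda>s. h (s - y1) y1)
    \<le> integral {t + y1..x1 + y1} (\<lambda>s. h (a s) (s - a s)) + (h t y1)\<^sup>2"
    (is "integral ?I ?k \<le> integral ?I ?p + _")
proof -
  define \<xi> where "\<xi> \<tau> = c + \<tau> * d" for \<tau>
  have d: "0 < d" "d < 1" using V by (auto simp: valley_def)
  have min: "G (\<xi> \<tau>) (\<tau> - \<xi> \<tau>) \<le> G x (\<tau> - x)" for \<tau> x using V by (auto simp: valley_def \<xi>_def)
  have lip: "\<bar>G (\<xi> \<tau>) (\<tau> - \<xi> \<tau>) - G (\<xi> \<tau>') (\<tau>' - \<xi> \<tau>')\<bar> \<le> \<bar>\<tau> - \<tau>'\<bar> / 2" for \<tau> \<tau>'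
    using V by (auto simp: valley_def \<xi>_def)
  have path: "s - y1 \<le> a s" "?k s = G (s - y1) y1" "?p s = G (a s) (s - a s)"
    if "t + y1 \<le> s" "s \<le> x1 + y1" for s
  proof -
    have b: "a (t + y1) \<le> a s" "a s \<le> x1" "x1 - a s \<le> x1 + y1 - s" "a s - a (t + y1) \<le> s - (t + y1)"
      using mpathD[OF a(1) that(1)] mpathD[OF a(1) that(2)] a by auto
    then show "s - y1 \<le> a s" by simp
    show "?k s = G (s - y1) y1" using that t y01 by (intro h_cell) auto
    show "?p s = G (a s) (s - a s)" using that b t a(2,3) by (intro h_cell) auto
  qed
  have beyond: "?k s \<le> ?p s" if "t + y1 \<le> s" "s \<le> x1 + y1" "\<xi> s \<le> s - y1" for s
    using G_antidiagonal_mono[OF min that(3) path(1)[OF that(1,2)]] path[OF that(1,2)] by simp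
  have cont: "continuous_on ?I ?k" "continuous_on ?I ?p"
    by (intro continuous_h continuous_intros mpath_continuous a)+
  show ?thesis
  proof (cases "\<xi> (t + y1) \<le> t")
    case True
    have "?k s \<le> ?p s" if "s \<in> ?I" for s
    proof (rule beyond)
      \<comment> \<open>The leg moves right at rate 1 and the valley only at rate
        \<open>d < 1\<close>, so the valley stays behind.\<close>
      have "(s - (t + y1)) * d \<le> (s - (t + y1)) * 1" using that d by (intro mult_left_mono) auto
      then show "\<xi> s \<le> s - y1" using True by (simp add: \<xi>_def algebra_simps)
    qed (use that in auto)
    then have "integral ?I ?k \<le> integral ?I ?p"
      by (intro integral_le integrable_continuous_interval cont)
    then show ?thesis by (simp add: add_increasing2)
  next
    case False
    \<comment> \<open>The valley is ahead of the leg by \<open>\<rho>\<close>, and the leg gains on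
      it at rate \<open>1 - d\<close>; they meet after time \<open>e\<close>, possibly outside the
      cell, where \<open>G\<close> is still defined.\<close>
    define \<rho> where "\<rho> = \<xi> (t + y1) - t"
    define e where "e = \<rho> / (1 - d)"
    have "\<rho> > 0" using False by (simp add: \<rho>_def)
    then have e: "0 < e" "\<rho> + e * d = e" using d by (auto simp: e_def field_simps)
    have \<xi>: "\<xi> (t + y1 + r) = t + e + (r - e) * d" for r
      using e(2) by (simp add: \<rho>_def \<xi>_def algebra_simps)
    define H \<kappa> where "H = G t y1" and "\<kappa> = G (t + e) y1"
    have \<kappa>: "\<kappa> = G (\<xi> (t + y1 + e)) (t + y1 + e - \<xi> (t + y1 + e))" unfolding \<xi> \<kappa>_def by simp
    \<comment> \<open>The corner and the crossing are \<open>e\<close> apart along the unit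
      direction \<open>u\<close>.\<close>
    have "e \<le> \<kappa> + H"
      using G_sum[of "t + e" t y1 y1] is_norm_scale[OF N, of e u] u e by (simp add: H_def \<kappa>_def)
    have "integral ?I ?k \<le> integral ?I ?p + H\<^sup>2"
    \<comment> \<open>The slope \<open>(H - \<kappa>) / e\<close> comes from interpolating the
      height along the leg, and 1/2 from the Lipschitz bound along the valley. Since
      \<open>e\<close> is at most \<open>\<kappa> + H\<close>, the condition of
      \<open>leg_excess\<close> holds.\<close>
    proof (rule leg_excess[where a = e and q = "(H - \<kappa>) / e + 1 / 2"])
      fix s assume s: "t + y1 \<le> s" "s \<le> x1 + y1" "s \<le> t + y1 + e"
      define b where "b = (s - (t + y1)) / e"
      have b: "0 \<le> b" "b \<le> 1" "b * e = s - (t + y1)" using s e by (auto simp: b_def)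
      have "?k s = G ((1 - b) * t + b * (t + e)) ((1 - b) * y1 + b * y1)"
      proof -
        have "(1 - b) * t + b * (t + e) = s - y1" using b(3) by (simp add: algebra_simps)
        moreover have "(1 - b) * y1 + b * y1 = y1" by (simp add: algebra_simps)
        ultimately show ?thesis using path(2)[OF s(1,2)] by simp
      qed
      also have "\<dots> \<le> (1 - b) * H + b * \<kappa>" unfolding H_def \<kappa>_def by (rule G_convex[OF b(1,2)])
      finally have "?k s \<le> (1 - b) * H + b * \<kappa>" .
      moreover have "\<kappa> - (t + y1 + e - s) / 2 \<le> ?p s"
      proof -
        have "\<bar>s - (t + y1 + e)\<bar> = t + y1 + e - s" using s by simp
        then have "\<kappa> - G (\<xi> s) (s - \<xi> s) \<le> (t + y1 + e - s) / 2"
          using lip[of s "t + y1 + e"] unfolding \<kappa> by (simp only: abs_le_iff) simp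
        then show ?thesis using min[of s "a s"] path(3)[OF s(1,2)] by (simp add: field_simps)
      qed
      moreover have "(1 - b) * H + b * \<kappa> - \<kappa> + (t + y1 + e - s) / 2 = ((H - \<kappa>) / e + 1 / 2) * (t + y1 + e - s)"
      proof -
        have *: "t + y1 + e - s = (1 - b) * e" using b(3) by (simp add: algebra_simps)
        show ?thesis unfolding * using e(1) by (simp add: field_simps)
      qed
      ultimately show "?k s - ?p s \<le> ((H - \<kappa>) / e + 1 / 2) * (t + y1 + e - s)" by linarith
    next
      fix s assume s: "t + y1 \<le> s" "s \<le> x1 + y1" "t + y1 + e \<le> s"
      show "?k s \<le> ?p s"
      proof (rule beyond)
        have "(s - (t + y1) - e) * d \<le> (s - (t + y1) - e) * 1" using s d by (intro mult_left_mono) auto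
        then show "\<xi> s \<le> s - y1" using \<xi>[of "s - (t + y1)"] by simp
      qed (use s in auto)
    next
      have "((H - \<kappa>) / e + 1 / 2) * e = H - \<kappa> + e / 2" using e by (simp add: field_simps)
      then show "((H - \<kappa>) / e + 1 / 2) * e \<le> 2 * H - e / 2" using \<open>e \<le> \<kappa> + H\<close> by simp
    qed (use t e cont in auto)
    then show ?thesis using h_cell[OF t y01] by (simp add: H_def)
  qed
qed

text \<open>The argument of \<open>right_leg_excess\<close> for the vertical leg up to
  \<open>(t, y1)\<close>. The leg ends at the corner of the detour, so time is measured backwards
  from there.\<close>

lemma down_leg_excess:
  assumes V: "valley c d" and t: "x0 \<le> t" "t \<le> x1" and y': "y0 \<le> y'" "y' \<le> y1"
    and a: "mpath a" "a (t + y') = t" "a (t + y1) \<le> x1"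
  shows "integral {t + y'..t + y1} (\<lambda>s. h t (s - t))
    \<le> integral {t + y'..t + y1} (\<lambda>s. h (a s) (s - a s)) + (h t y1)\<^sup>2"
    (is "integral ?I ?k \<le> integral ?I ?p + _")
proof -
  define \<xi> where "\<xi> \<tau> = c + \<tau> * d" for \<tau>
  have d: "0 < d" "d < 1" using V by (auto simp: valley_def)
  have min: "G (\<xi> \<tau>) (\<tau> - \<xi> \<tau>) \<le> G x (\<tau> - x)" for \<tau> x using V by (auto simp: valley_def \<xi>_def)
  have lip: "\<bar>G (\<xi> \<tau>) (\<tau> - \<xi> \<tau>) - G (\<xi> \<tau>') (\<tau>' - \<xi> \<tau>')\<bar> \<le> \<bar>\<tau> - \<tau>'\<bar> / 2" for \<tau> \<tau>'
    using V by (auto simp: valley_def \<xi>_def)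
  have path: "t \<le> a s" "?k s = G t (s - t)" "?p s = G (a s) (s - a s)"
    if "t + y' \<le> s" "s \<le> t + y1" for s
  proof -
    have b: "t \<le> a s" "a s \<le> x1" "a s - t \<le> s - (t + y')"
      using mpathD[OF a(1) that(1)] mpathD[OF a(1) that(2)] a by auto
    then show "t \<le> a s" by simp
    show "?k s = G t (s - t)" using that t y' y01 by (intro h_cell) auto
    show "?p s = G (a s) (s - a s)" using that b t y' by (intro h_cell) auto
  qed
  have beyond: "?k s \<le> ?p s" if "t + y' \<le> s" "s \<le> t + y1" "\<xi> s \<le> t" for s
    using G_antidiagonal_mono[OF min that(3) path(1)[OF that(1,2)]] path[OF that(1,2)] by simp
  have cont: "continuous_on ?I ?k" "continuous_on ?I ?p"
    by (intro continuous_h continuous_intros mpath_continuous a)+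
  show ?thesis
  proof (cases "\<xi> (t + y1) \<le> t")
    case True
    have "?k s \<le> ?p s" if "s \<in> ?I" for s
    proof (rule beyond)
      have "s * d \<le> (t + y1) * d" using that d by (intro mult_right_mono) auto
      then show "\<xi> s \<le> t" using True by (simp add: \<xi>_def)
    qed (use that in auto)
    then have "integral ?I ?k \<le> integral ?I ?p"
      by (intro integral_le integrable_continuous_interval cont)
    then show ?thesis by (simp add: add_increasing2)
  next
    case False
    define \<rho> where "\<rho> = \<xi> (t + y1) - t"
    \<comment> \<open>The first coordinate is fixed on this leg and the valley moves at rate
      \<open>d\<close>, so they meet at time \<open>e\<close> before the corner.\<close>
    define e where "e = \<rho> / d"
    have "\<rho> > 0" using False by (simp add: \<rho>_def)
    then have e: "0 < e" "e * d = \<rho>" using d by (auto simp: e_def)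
    have \<xi>: "\<xi> (t + y1 - r) = t + (e - r) * d" for r
      using e(2) by (simp add: \<rho>_def \<xi>_def algebra_simps)
    define H \<kappa> where "H = G t y1" and "\<kappa> = G t (y1 - e)"
    have \<kappa>: "\<kappa> = G (\<xi> (t + y1 - e)) (t + y1 - e - \<xi> (t + y1 - e))" unfolding \<xi> \<kappa>_def by (simp add: algebra_simps)
    have "e \<le> \<kappa> + H"
      using G_sum[of t t "y1 - e" y1] is_norm_scale[OF N, of e v] v e by (simp add: H_def \<kappa>_def is_norm_minus[OF N])
    have "integral ?I ?k \<le> integral ?I ?p + H\<^sup>2"
    proof (rule leg_excess_mirror[where a = e and q = "(H - \<kappa>) / e + 1 / 2"])
      fix s assume s: "t + y' \<le> s" "s \<le> t + y1" "t + y1 - e \<le> s"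
      define b where "b = (t + y1 - s) / e"
      have b: "0 \<le> b" "b \<le> 1" "b * e = t + y1 - s" using s e by (auto simp: b_def)
      have "?k s = G ((1 - b) * t + b * t) ((1 - b) * y1 + b * (y1 - e))"
      proof -
        have "(1 - b) * y1 + b * (y1 - e) = s - t" using b(3) by (simp add: algebra_simps)
        moreover have "(1 - b) * t + b * t = t" by (simp add: algebra_simps)
        ultimately show ?thesis using path(2)[OF s(1,2)] by simp
      qed
      also have "\<dots> \<le> (1 - b) * H + b * \<kappa>" unfolding H_def \<kappa>_def by (rule G_convex[OF b(1,2)])
      finally have "?k s \<le> (1 - b) * H + b * \<kappa>" .
      moreover have "\<kappa> - (s - (t + y1 - e)) / 2 \<le> ?p s"
      proof -
        have "\<bar>s - (t + y1 - e)\<bar> = s - (t + y1 - e)" using s by simp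
        then have "\<kappa> - G (\<xi> s) (s - \<xi> s) \<le> (s - (t + y1 - e)) / 2"
          using lip[of s "t + y1 - e"] unfolding \<kappa> by (simp only: abs_le_iff) simp
        then show ?thesis using min[of s "a s"] path(3)[OF s(1,2)] by (simp add: field_simps)
      qed
      moreover have "(1 - b) * H + b * \<kappa> - \<kappa> + (s - (t + y1 - e)) / 2 = ((H - \<kappa>) / e + 1 / 2) * (s - (t + y1 - e))"
      proof -
        have *: "s - (t + y1 - e) = (1 - b) * e" using b(3) by (simp add: algebra_simps)
        show ?thesis unfolding * using e(1) by (simp add: field_simps)
      qed
      ultimately show "?k s - ?p s \<le> ((H - \<kappa>) / e + 1 / 2) * (s - (t + y1 - e))" by linarith
    next
      fix s assume s: "t + y' \<le> s" "s \<le> t + y1" "s \<le> t + y1 - e"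
      show "?k s \<le> ?p s"
      proof (rule beyond)
        have "(e - (t + y1 - s)) * d \<le> 0" using s d by (intro mult_nonpos_nonneg) auto
        then show "\<xi> s \<le> t" using \<xi>[of "t + y1 - s"] by simp
      qed (use s in auto)
    next
      have "((H - \<kappa>) / e + 1 / 2) * e = H - \<kappa> + e / 2" using e by (simp add: field_simps)
      then show "((H - \<kappa>) / e + 1 / 2) * e \<le> 2 * H - e / 2" using \<open>e \<le> \<kappa> + H\<close> by simp
    qed (use y' e cont in auto)
    then show ?thesis using h_cell[OF t y01] by (simp add: H_def)
  qed
qed

text \<open>The maximum describes going up to \<open>(t, y1)\<close> and then right along the north
  border; each of the two legs has excess at most the squared height at their common point.\<close>

lemma corner_detour:
  assumes V: "valley c d" and t: "x0 \<le> t" "t \<le> x1" and y': "y0 \<le> y'" "y' \<le> y1"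
    and a: "mpath a" "a (t + y') = t" "a (x1 + y1) = x1"
  shows "K (\<lambda>s. max t (s - y1)) (t + y') (x1 + y1) \<le> K a (t + y') (x1 + y1) + 2 * (h t y1)\<^sup>2"
proof -
  let ?b = "\<lambda>s. max t (s - y1)"
  have b: "mpath ?b" by (intro mpath_max) auto
  have T: "t + y' \<le> t + y1" "t + y1 \<le> x1 + y1" using t y' by auto
  have aT: "t \<le> a (t + y1)" "a (t + y1) \<le> x1" "a (t + y1) - t \<le> y1 - y'"
    using mpathD[OF a(1) T(1)] mpathD[OF a(1) T(2)] a by auto
  have "K ?b (t + y') (t + y1) = integral {t + y'..t + y1} (\<lambda>s. h t (s - t))"
    unfolding cost_def
  proof (rule integral_cong)
    fix s assume "s \<in> {t + y'..t + y1}"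
    then have "max t (s - y1) = t" by auto
    then show "h (max t (s - y1)) (s - max t (s - y1)) = h t (s - t)" by simp
  qed
  also have "\<dots> \<le> K a (t + y') (t + y1) + (h t y1)\<^sup>2"
    unfolding cost_def by (rule down_leg_excess[OF V t y' a(1,2) aT(2)])
  finally have 1: "K ?b (t + y') (t + y1) \<le> K a (t + y') (t + y1) + (h t y1)\<^sup>2" .
  have "K ?b (t + y1) (x1 + y1) = integral {t + y1..x1 + y1} (\<lambda>s. h (s - y1) y1)"
    unfolding cost_def by (rule integral_cong) (auto simp: max_def)
  also have "\<dots> \<le> K a (t + y1) (x1 + y1) + (h t y1)\<^sup>2"
    unfolding cost_def by (rule right_leg_excess[OF V t a(1) aT(1) _ a(3)]) (use aT y' in auto)
  finally show ?thesis using 1 K_combine[OF a(1) T] K_combine[OF b T] by simp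
qed

text \<open>The height drops at rate at most 1 when going back from the endpoint, so the cost is at
  least the area of a triangle with both legs of length \<open>h t y1\<close>.\<close>

lemma K_ge_end_square:
  assumes a: "mpath a" "a (t + y1) = t" and l: "l \<le> t + y1 - h t y1"
  shows "(h t y1)\<^sup>2 / 2 \<le> K a l (t + y1)"
proof -
  let ?H = "h t y1" and ?r = "t + y1"
  have H: "0 \<le> ?H" by (rule h_nonneg)
  have J: "((\<lambda>s. s - (?r - ?H)) has_integral ((?r - (?r - ?H))\<^sup>2 / 2 - ((?r - ?H) - (?r - ?H))\<^sup>2 / 2)) {?r - ?H..?r}"
    using H by (intro fundamental_theorem_of_calculus)
      (auto intro!: derivative_eq_intros simp: has_real_derivative_iff_has_vector_derivative[symmetric])
  have "?H\<^sup>2 / 2 = integral {?r - ?H..?r} (\<lambda>s. s - (?r - ?H))" using integral_unique[OF J] by simp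
  also have "\<dots> \<le> K a (?r - ?H) ?r"
    unfolding cost_def
  proof (rule integral_le)
    fix s assume s: "s \<in> {?r - ?H..?r}"
    show "s - (?r - ?H) \<le> h (a s) (s - a s)"
      using h_lip[of t y1 "a s" "s - a s"] mpath_abs[OF a(1), of ?r s] a(2) s by auto
  qed (use J a in \<open>auto intro: integrable_path\<close>)
  also have "\<dots> \<le> K a l ?r" using K_combine[OF a(1) l, of ?r] K_nonneg[OF a(1), of l "?r - ?H"] H by auto
  finally show ?thesis .
qed


text \<open>The counterpart for a path no longer than its end height: the height at time
  \<open>s\<close> is at least \<open>s - l\<close>.\<close>

lemma K_ge_short:
  assumes a: "mpath a" "a (t + y1) = t" and l: "l \<le> t + y1" "t + y1 - l \<le> h t y1"
  shows "(t + y1 - l)\<^sup>2 / 2 \<le> K a l (t + y1)"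
proof -
  let ?r = "t + y1"
  have J: "((\<lambda>s. s - l) has_integral ((?r - l)\<^sup>2 / 2 - (l - l)\<^sup>2 / 2)) {l..?r}"
    using l by (intro fundamental_theorem_of_calculus)
      (auto intro!: derivative_eq_intros simp: has_real_derivative_iff_has_vector_derivative[symmetric])
  have "(?r - l)\<^sup>2 / 2 = integral {l..?r} (\<lambda>s. s - l)" using integral_unique[OF J] by simp
  also have "\<dots> \<le> K a l ?r"
    unfolding cost_def
  proof (rule integral_le)
    fix s assume s: "s \<in> {l..?r}"
    show "s - l \<le> h (a s) (s - a s)"
      using h_lip[of t y1 "a s" "s - a s"] mpath_abs[OF a(1), of ?r s] a(2) s l by auto
  qed (use J a in \<open>auto intro: integrable_path\<close>)
  finally show ?thesis .
qed

text \<open>Times are paired symmetrically about the midpoint \<open>m\<close>. Between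
  \<open>l + r - s\<close> and \<open>s\<close> the difference vector moves by at least half the
  elapsed time, so by \<open>G_sum\<close> the two heights add up to at least \<open>s - m\<close>;
  integrating over the second half gives the constant 1/8.\<close>

lemma K_ge_steep:
  assumes steep: "\<And>x y. 0 \<le> x \<Longrightarrow> 0 \<le> y \<Longrightarrow> (x + y) / 2 \<le> N (x *\<^sub>R u - y *\<^sub>R v)"
    and a: "mpath a" and l: "l \<le> r" "x0 \<le> a l" "y0 \<le> l - a l" "a r \<le> x1" "r - a r \<le> y1"
  shows "(r - l)\<^sup>2 / 8 \<le> K a l r"
proof -
  define f where "f s = h (a s) (s - a s)" for s
  have f: "f integrable_on {l'..r'}" for l' r' unfolding f_def by (rule integrable_path[OF a])
  have fG: "f s = G (a s) (s - a s)" if "l \<le> s" "s \<le> r" for s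
    unfolding f_def using mpathD[OF a that(1)] mpathD[OF a that(2)] l by (intro h_cell) auto
  have pair: "(s' - s) / 2 \<le> f s + f s'" if "l \<le> s" "s \<le> s'" "s' \<le> r" for s s'
  proof -
    have "(s' - s) / 2 \<le> N ((a s' - a s) *\<^sub>R u - ((s' - a s') - (s - a s)) *\<^sub>R v)"
      using steep[of "a s' - a s" "(s' - a s') - (s - a s)"] mpathD[OF a that(2)] by simp
    also have "\<dots> \<le> G (a s') (s' - a s') + G (a s) (s - a s)" by (rule G_sum)
    finally show ?thesis using that by (simp add: fG)
  qed
  define m where "m = (l + r) / 2"
  have m: "l \<le> m" "m \<le> r" "m - l = r - m" using l by (auto simp: m_def field_simps)
  have refl: "((\<lambda>s. f (l + r - s)) has_integral integral {l..m} f) {m..r}"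
  proof -
    have lr: "l + r = 2 * m" "2 * m - l = r" by (simp_all add: m_def field_simps)
    have "((\<lambda>s. f (-1 *\<^sub>R s + 2 * m)) has_integral (1 / \<bar>-1\<bar> ^ DIM(real)) *\<^sub>R integral {l..m} f)
        ((\<lambda>s. (1 / -1) *\<^sub>R s + - ((1 / -1) *\<^sub>R (2 * m))) ` cbox l m)"
      by (rule has_integral_affinity) (use f[of l m] in auto)
    moreover have "(\<lambda>s. (1 / -1) *\<^sub>R s + - ((1 / -1) *\<^sub>R (2 * m))) ` cbox l m = {m..r}"
      using image_affinity_atLeastAtMost[of "-1" "2 * m" l m] m lr by simp
    ultimately show ?thesis unfolding lr(1) using lr(2) m by auto
  qed
  have J: "((\<lambda>s. s - m) has_integral ((r - m)\<^sup>2 / 2 - (m - m)\<^sup>2 / 2)) {m..r}"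
    using m by (intro fundamental_theorem_of_calculus)
      (auto intro!: derivative_eq_intros simp: has_real_derivative_iff_has_vector_derivative[symmetric])
  have "(r - l)\<^sup>2 / 8 = integral {m..r} (\<lambda>s. s - m)"
    using integral_unique[OF J] m by (simp add: m_def power2_eq_square field_simps)
  also have "\<dots> \<le> integral {m..r} (\<lambda>s. f (l + r - s) + f s)"
  proof (rule integral_le)
    fix s assume s: "s \<in> {m..r}"
    then show "s - m \<le> f (l + r - s) + f s"
      using pair[of "l + r - s" s] by (auto simp: m_def field_simps)
  qed (use J refl in \<open>auto intro!: integrable_add f\<close>)
  also have "\<dots> = integral {l..m} f + integral {m..r} f"
    using refl f[of m r] by (subst Henstock_Kurzweil_Integration.integral_add) (auto dest: integral_unique)
  also have "\<dots> = K a l r" using K_combine[OF a m(1,2)] by (simp add: cost_def f_def[abs_def])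
  finally show ?thesis .
qed

text \<open>The deviation enters the height once per coordinate, hence twice; each half of the time
  interval then contributes at most the square of half its length.\<close>

lemma K_around_corner:
  assumes a: "mpath a" "a (x0 + s) = x0" "a (t + y1) = t" and s: "s \<le> y1" and t: "x0 \<le> t"
  shows "K (\<lambda>\<tau>. max x0 (\<tau> - y1)) (x0 + s) (t + y1) \<le> K a (x0 + s) (t + y1) + (t + y1 - (x0 + s))\<^sup>2 / 2"
proof -
  let ?b = "\<lambda>\<tau>. max x0 (\<tau> - y1)" and ?l = "x0 + s" and ?r = "t + y1"
  have b: "mpath ?b" by (intro mpath_max) auto
  define m where "m = (?l + ?r) / 2"
  have m: "?l \<le> m" "m \<le> ?r" using s t by (auto simp: m_def)
  have diff: "\<bar>?b \<tau> - a \<tau>\<bar> \<le> \<tau> - ?l" "\<bar>?b \<tau> - a \<tau>\<bar> \<le> ?r - \<tau>" if "?l \<le> \<tau>" "\<tau> \<le> ?r" for \<tau>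
    using mpathD[OF a(1) that(1)] mpathD[OF a(1) that(2)] a by auto
  have int: "(\<lambda>\<tau>. h (c \<tau>) (\<tau> - c \<tau>)) integrable_on {l'..r'}" if "mpath c" for c l' r'
    using that by (rule integrable_path)
  have hb: "h (?b \<tau>) (\<tau> - ?b \<tau>) - h (a \<tau>) (\<tau> - a \<tau>) \<le> 2 * \<bar>?b \<tau> - a \<tau>\<bar>" for \<tau>
  proof (rule order_trans[OF abs_ge_self])
    show "\<bar>h (?b \<tau>) (\<tau> - ?b \<tau>) - h (a \<tau>) (\<tau> - a \<tau>)\<bar> \<le> 2 * \<bar>?b \<tau> - a \<tau>\<bar>"
      using h_lip[of "?b \<tau>" "\<tau> - ?b \<tau>" "a \<tau>" "\<tau> - a \<tau>"] abs_minus_commute[of "a \<tau>" "?b \<tau>"] by simp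
  qed
  have J1: "((\<lambda>\<tau>. 2 * (\<tau> - ?l)) has_integral ((m - ?l)\<^sup>2 - (?l - ?l)\<^sup>2)) {?l..m}"
    using m by (intro fundamental_theorem_of_calculus)
      (auto intro!: derivative_eq_intros simp: has_real_derivative_iff_has_vector_derivative[symmetric])
  have J2: "((\<lambda>\<tau>. 2 * (?r - \<tau>)) has_integral (- (?r - ?r)\<^sup>2 - - (?r - m)\<^sup>2)) {m..?r}"
    using m by (intro fundamental_theorem_of_calculus)
      (auto intro!: derivative_eq_intros simp: has_real_derivative_iff_has_vector_derivative[symmetric])
  have "K ?b ?l m - K a ?l m = integral {?l..m} (\<lambda>\<tau>. h (?b \<tau>) (\<tau> - ?b \<tau>) - h (a \<tau>) (\<tau> - a \<tau>))"
    unfolding cost_def using a b int by (subst Henstock_Kurzweil_Integration.integral_diff) auto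
  also have "\<dots> \<le> integral {?l..m} (\<lambda>\<tau>. 2 * (\<tau> - ?l))"
  proof (rule integral_le)
    show "h (?b \<tau>) (\<tau> - ?b \<tau>) - h (a \<tau>) (\<tau> - a \<tau>) \<le> 2 * (\<tau> - ?l)" if "\<tau> \<in> {?l..m}" for \<tau>
      using hb[of \<tau>] diff[of \<tau>] that m by auto
    show "(\<lambda>\<tau>. h (?b \<tau>) (\<tau> - ?b \<tau>) - h (a \<tau>) (\<tau> - a \<tau>)) integrable_on {?l..m}"
      using a b int by (intro Henstock_Kurzweil_Integration.integrable_diff) auto
  qed (use J1 in blast)
  also have "\<dots> = (m - ?l)\<^sup>2" using integral_unique[OF J1] by simp
  finally have 1: "K ?b ?l m - K a ?l m \<le> (m - ?l)\<^sup>2" .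
  have "K ?b m ?r - K a m ?r = integral {m..?r} (\<lambda>\<tau>. h (?b \<tau>) (\<tau> - ?b \<tau>) - h (a \<tau>) (\<tau> - a \<tau>))"
    unfolding cost_def using a b int by (subst Henstock_Kurzweil_Integration.integral_diff) auto
  also have "\<dots> \<le> integral {m..?r} (\<lambda>\<tau>. 2 * (?r - \<tau>))"
  proof (rule integral_le)
    show "h (?b \<tau>) (\<tau> - ?b \<tau>) - h (a \<tau>) (\<tau> - a \<tau>) \<le> 2 * (?r - \<tau>)" if "\<tau> \<in> {m..?r}" for \<tau>
      using hb[of \<tau>] diff[of \<tau>] that m by auto
    show "(\<lambda>\<tau>. h (?b \<tau>) (\<tau> - ?b \<tau>) - h (a \<tau>) (\<tau> - a \<tau>)) integrable_on {m..?r}"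
      using a b int by (intro Henstock_Kurzweil_Integration.integrable_diff) auto
  qed (use J2 in blast)
  also have "\<dots> = (?r - m)\<^sup>2" using integral_unique[OF J2] by simp
  finally have 2: "K ?b m ?r - K a m ?r \<le> (?r - m)\<^sup>2" .
  have "(m - ?l)\<^sup>2 + (?r - m)\<^sup>2 = (?r - ?l)\<^sup>2 / 2"
    by (simp add: m_def power2_eq_square field_simps)
  then show ?thesis using 1 2 K_combine[OF a(1) m] K_combine[OF b m] by linarith
qed

text \<open>Either the path around the north-west corner is good enough, or the valley is shallow and the
  path is long compared to the height of its endpoint; then every path to the north-east corner can
  be rerouted through that endpoint.\<close>

lemma west_to_north_path:
  assumes a: "mpath a" "a (x0 + s) = x0" "a (t + y1) = t"
    and s: "y0 \<le> s" "s \<le> y1" and s': "y0 \<le> s'" "s' \<le> y1" and t: "x0 \<le> t" "t \<le> x1"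
  shows "D (x0, s) (x0, y1) + D (x0, y1) (t, y1) \<le> 5 * K a (x0 + s) (t + y1) \<or>
    D (x0, s') (t, y1) + D (x0, s) (x1, y1) \<le> D (x0, s') (x1, y1) + 5 * K a (x0 + s) (t + y1)"
proof -
  let ?K = "K a (x0 + s) (t + y1)" and ?H = "h t y1" and ?L = "t + y1 - (x0 + s)"
  have lr: "x0 + s \<le> t + y1" using s t by simp
  \<comment> \<open>This hypothesis makes the excess \<open>L^2 / 2\<close> of the path around the
    corner at most four times the cost.\<close>
  have corner: ?thesis if "?L\<^sup>2 / 8 \<le> ?K"
  proof -
    let ?b = "\<lambda>\<tau>. max x0 (\<tau> - y1)"
    have "mpath ?b" by (intro mpath_max) auto
    then have "D (x0, s) (x0, y1) + D (x0, y1) (t, y1) \<le> K ?b (x0 + s) (t + y1)"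
      using D_split[of ?b x0 s t y1 "x0 + y1" x0] s t by (simp add: max_def)
    also have "\<dots> \<le> ?K + ?L\<^sup>2 / 2" by (rule K_around_corner[OF a s(2) t(1)])
    finally show ?thesis using that by linarith
  qed
  \<comment> \<open>In the first two cases the end height alone forces the cost up to
    \<open>L^2 / 8\<close>; only paths long compared to it need the dichotomy.\<close>
  consider "?L \<le> ?H" | "?H \<le> ?L" "?L \<le> 2 * ?H" | "2 * ?H \<le> ?L" by linarith
  then show ?thesis
  proof cases
    case 1
    then have "?L\<^sup>2 / 2 \<le> ?K" using K_ge_short[OF a(1,3) lr] by simp
    then show ?thesis using zero_le_power2[of ?L] by (intro corner) linarith
  next
    case 2
    then have "?L\<^sup>2 \<le> (2 * ?H)\<^sup>2" using lr by (intro power_mono) auto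
    moreover have "?H\<^sup>2 / 2 \<le> ?K" using 2 by (intro K_ge_end_square[OF a(1,3)]) simp
    ultimately show ?thesis by (intro corner) (simp add: power_mult_distrib)
  next
    case 3
    have H: "?H\<^sup>2 / 2 \<le> ?K" using 3 h_nonneg[of t y1] by (intro K_ge_end_square[OF a(1,3)]) simp
    from steep_or_valley show ?thesis
    proof
      assume "\<forall>x y. 0 \<le> x \<longrightarrow> 0 \<le> y \<longrightarrow> (x + y) / 2 \<le> N (x *\<^sub>R u - y *\<^sub>R v)"
      then show ?thesis using a s t lr by (intro corner K_ge_steep) auto
    next
      assume "\<exists>c d. valley c d"
      then obtain c d where V: "valley c d" by blast
      have "D (x0, s') (t, y1) + D (x0, s) (x1, y1) - (?K + 2 * ?H\<^sup>2) \<le> D (x0, s') (x1, y1)"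
      proof (rule D_ge)
        fix b assume b: "mpath b" "b (x0 + s') = x0" "b (x1 + y1) = x1"
        \<comment> \<open>Every path from the west border to the north-east corner meets the
          vertical line through the endpoint \<open>(t, y1)\<close>, at or below that
          endpoint.\<close>
        have "\<exists>\<tau>\<ge>x0 + s'. \<tau> \<le> x1 + y1 \<and> b \<tau> = t"
          using b t s' x01 by (intro IVT') (auto intro: mpath_continuous)
        then obtain \<tau> where \<tau>: "x0 + s' \<le> \<tau>" "\<tau> \<le> x1 + y1" "b \<tau> = t" by blast
        have y': "s' \<le> \<tau> - t" "\<tau> - t \<le> y1"
          using mpathD[OF b(1) \<tau>(1)] mpathD[OF b(1) \<tau>(2)] b \<tau> by auto
        let ?c = "\<lambda>\<tau>. max t (\<tau> - y1)"
        have "mpath ?c" by (intro mpath_max) auto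
        then have "D (t, \<tau> - t) (t, y1) + D (t, y1) (x1, y1) \<le> K ?c \<tau> (x1 + y1)"
          using D_split[of ?c t "\<tau> - t" x1 y1 "t + y1" t] y' t by (simp add: max_def)
        also have "\<dots> \<le> K b \<tau> (x1 + y1) + 2 * ?H\<^sup>2"
          using corner_detour[OF V t _ y'(2) b(1) _ b(3)] y' s' \<tau>(3) by simp
        finally have 1: "D (t, \<tau> - t) (t, y1) + D (t, y1) (x1, y1) \<le> K b \<tau> (x1 + y1) + 2 * ?H\<^sup>2" .
        \<comment> \<open>The legs of the detour are shared out: the vertical one completes the path
          from \<open>s'\<close> to \<open>(t, y1)\<close>, the horizontal one continues
          \<open>a\<close> to the corner.\<close>
        have "D (x0, s') (t, y1) \<le> D (x0, s') (t, \<tau> - t) + D (t, \<tau> - t) (t, y1)"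
          using t y' by (intro D_triangle) auto
        moreover have "D (x0, s') (t, \<tau> - t) \<le> K b (x0 + s') \<tau>"
          using D_le[of b x0 s' t "\<tau> - t"] b \<tau> by simp
        moreover have "D (x0, s) (x1, y1) \<le> D (x0, s) (t, y1) + D (t, y1) (x1, y1)"
          using t s by (intro D_triangle) auto
        moreover have "D (x0, s) (t, y1) \<le> ?K" by (rule D_le[OF a])
        ultimately show "D (x0, s') (t, y1) + D (x0, s) (x1, y1) - (?K + 2 * ?H\<^sup>2) \<le> K b (x0 + s') (x1 + y1)"
          using 1 K_combine[OF b(1) \<tau>(1,2)] by linarith
      qed (use x01 s' in auto)
      then show ?thesis using H by auto
    qed
  qed
qed

end

section \<open>Processing a cell\<close>

text \<open>\<open>e\<close> is the border as a curve in the parameter space and \<open>f\<close> its computed function, whose value at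
  \<open>hi\<close> is the value \<open>h\<close> of the corresponding corner. Lipschitz continuity makes the minimisers of the
  algorithm exist.\<close>

definition border_inv ::
    "(real \<times> real \<Rightarrow> real \<times> real \<Rightarrow> real) \<Rightarrow> (real \<Rightarrow> real \<times> real) \<Rightarrow> real \<Rightarrow> real \<Rightarrow> (real \<Rightarrow> real) \<Rightarrow> bool" where
  "border_inv D e lo hi f \<longleftrightarrow>
     (\<forall>t\<in>{lo..hi}. D (0, 0) (e t) \<le> f t \<and> f t \<le> 5 * D (0, 0) (e t) \<and> f hi \<le> f t + D (e t) (e hi)) \<and>
     (\<exists>C\<ge>0. \<forall>t t'. lo \<le> t \<longrightarrow> t \<le> t' \<longrightarrow> t' \<le> hi \<longrightarrow> \<bar>f t - f t'\<bar> \<le> C * (t' - t))"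

lemma border_invD:
  assumes "border_inv D e lo hi f" "lo \<le> t" "t \<le> hi"
  shows "D (0, 0) (e t) \<le> f t" "f t \<le> 5 * D (0, 0) (e t)" "f hi \<le> f t + D (e t) (e hi)"
  using assms by (auto simp: border_inv_def)

lemma border_inv_cong:
  assumes "border_inv D e lo hi f" "\<And>t. lo \<le> t \<Longrightarrow> t \<le> hi \<Longrightarrow> f t = g t"
  shows "border_inv D e lo hi g"
proof (cases "lo \<le> hi")
  case True
  then have "f t = g t" if "t \<in> {lo..hi}" for t using assms(2) that by simp
  moreover have "hi \<in> {lo..hi}" using True by simp
  ultimately show ?thesis using assms(1) unfolding border_inv_def by simp
next
  case False
  then show ?thesis by (auto simp: border_inv_def)
qed

lemma border_inv_flip:
  "border_inv (mincost (\<lambda>x y. h y x)) (\<lambda>t. (y, t)) lo hi f \<longleftrightarrow> border_inv (mincost h) (\<lambda>t. (t, y)) lo hi f"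
  "border_inv (mincost (\<lambda>x y. h y x)) (\<lambda>t. (t, x)) lo hi f \<longleftrightarrow> border_inv (mincost h) (\<lambda>t. (x, t)) lo hi f"
  by (simp_all add: border_inv_def mincost_flip[of h])

lemma border_inv_continuous:
  assumes "border_inv D e lo hi f" shows "continuous_on {lo..hi} f"
proof -
  obtain C where C: "C \<ge> 0" "\<And>t t'. lo \<le> t \<Longrightarrow> t \<le> t' \<Longrightarrow> t' \<le> hi \<Longrightarrow> \<bar>f t - f t'\<bar> \<le> C * (t' - t)"
    using assms unfolding border_inv_def by blast
  have "C-lipschitz_on {lo..hi} f"
    unfolding lipschitz_on_def
  proof (intro conjI ballI)
    fix t t' assume "t \<in> {lo..hi}" "t' \<in> {lo..hi}"
    then show "dist (f t) (f t') \<le> C * dist t t'"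
      using C(2)[of t t'] C(2)[of t' t] by (cases "t \<le> t'") (auto simp: dist_real_def abs_minus_commute)
  qed (rule C)
  then show ?thesis by (rule lipschitz_on_continuous_on)
qed

lemma min_lipschitz:
  assumes "\<bar>a - a'\<bar> \<le> (e::real)" "\<bar>b - b'\<bar> \<le> e"
  shows "\<bar>min a b - min a' b'\<bar> \<le> e"
  using assms by (auto simp: min_def)

context height
begin

lemma border_base:
  assumes "0 \<le> lo" "lo \<le> hi"
  shows "border_inv D (\<lambda>t. (t, 0)) lo hi (\<lambda>t. D (0, 0) (t, 0))"
proof -
  let ?C = "M + 2 * hi"
  have "\<bar>D (0, 0) (t, 0) - D (0, 0) (t', 0)\<bar> \<le> ?C * (t' - t)" if "lo \<le> t" "t \<le> t'" "t' \<le> hi" for t t'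
  proof -
    have "\<bar>D (0, 0) (t, 0) - D (0, 0) (t', 0)\<bar> \<le> (M + 2 * t') * (t' - t)"
      using D_move_end[of 0 t t' 0 0] that assms by simp
    also have "\<dots> \<le> ?C * (t' - t)" using that by (intro mult_right_mono) auto
    finally show ?thesis .
  qed
  moreover have "0 \<le> ?C" using M_nonneg assms by simp
  moreover have "D (0, 0) (hi, 0) \<le> D (0, 0) (t, 0) + D (t, 0) (hi, 0)" "0 \<le> D (0, 0) (t, 0)"
    if "lo \<le> t" "t \<le> hi" for t
    using that assms D_triangle[of 0 t 0 0 hi 0] D_nonneg[of 0 t 0 0] by simp_all
  ultimately show ?thesis unfolding border_inv_def by (intro conjI ballI exI[of _ ?C] allI impI) auto
qed

text \<open>A path from the origin meets the west or the south border: the minimum of the two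
  coordinate differences is nonpositive at the start, nonnegative at the end, and zero only on the
  L-shaped boundary. Both parts of the split path carry the factor 5, which is why it does not grow
  from cell to cell.\<close>

lemma enter_cell:
  assumes "0 \<le> x0" "0 \<le> y0" "x0 \<le> t" "y0 \<le> y1"
    and W: "\<And>s. y0 \<le> s \<Longrightarrow> s \<le> y1 \<Longrightarrow> B \<le> 5 * (D (0, 0) (x0, s) + D (x0, s) (t, y1))"
    and S: "\<And>s. x0 \<le> s \<Longrightarrow> s \<le> t \<Longrightarrow> B \<le> 5 * (D (0, 0) (s, y0) + D (s, y0) (t, y1))"
  shows "B \<le> 5 * D (0, 0) (t, y1)"
proof -
  have "B / 5 \<le> D (0, 0) (t, y1)"
  proof (rule D_ge)
    fix a assume a: "mpath a" "a (0 + 0) = 0" "a (t + y1) = t"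
    have "\<exists>s\<ge>0. s \<le> t + y1 \<and> min (a s - x0) (s - a s - y0) = 0"
      using a assms by (intro IVT') (auto intro!: continuous_on_min continuous_on_diff mpath_continuous[OF a(1)] continuous_intros)
    then obtain s where s: "0 \<le> s" "s \<le> t + y1" "min (a s - x0) (s - a s - y0) = 0" by blast
    have as: "a s \<le> t" "s - a s \<le> y1" using mpathD[OF a(1) s(2)] a by auto
    have split: "D (0, 0) (a s, s - a s) + D (a s, s - a s) (t, y1) \<le> K a (0 + 0) (t + y1)"
      using D_split[OF a refl] s by simp
    show "B / 5 \<le> K a (0 + 0) (t + y1)"
    proof (cases "a s = x0")
      case True
      then show ?thesis using W[of "s - x0"] s as split by (auto simp: min_def split: if_splits)
    next
      case False
      then have "s - a s = y0" "x0 \<le> a s" using s by (auto simp: min_def split: if_splits)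
      then show ?thesis using S[of "a s"] as split by auto
    qed
  qed (use assms in auto)
  then show ?thesis by simp
qed

end

section \<open>Propagation through one cell\<close>

context cell
begin

text \<open>Exchanging the curves negates the difference vector, so \<open>u\<close> and
  \<open>v\<close> change places and \<open>w\<close> changes its sign.\<close>

lemma cell_flip: "cell (\<lambda>x y. h y x) M N v u (- w) y0 y1 x0 x1"
proof (intro cell.intro height_flip cell_axioms.intro)
  interpret A: affine_height N v u "- w" by unfold_locales (rule N v u)+
  show "affine_height N v u" by unfold_locales
  show "h y x = A.G x y" if "y0 \<le> x" "x \<le> y1" "x0 \<le> y" "y \<le> x1" for x y
  proof -
    have "- w + x *\<^sub>R v - y *\<^sub>R u = - (w + y *\<^sub>R u - x *\<^sub>R v)" by simp
    then have "A.G x y = G y x" unfolding A.G_def G_def using is_norm_minus[OF N] by metis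
    then show ?thesis using h_cell that by simp
  qed
qed (rule x01 y01)+

text \<open>Here \<open>b\<close> and \<open>b'\<close> are the values at \<open>s\<close> and
  \<open>s'\<close>, and \<open>g\<close> is the value at the north-west corner. The first
  alternative of \<open>west_to_north_path\<close> is combined with the bound on \<open>g\<close>,
  the second with the optimality of \<open>s'\<close> towards the north-east corner.\<close>

lemma west_to_north:
  assumes s: "y0 \<le> s" "s \<le> y1" and s': "y0 \<le> s'" "s' \<le> y1" and t: "x0 \<le> t" "t \<le> x1"
    and "g \<le> b + D (x0, s) (x0, y1)" "b' + D (x0, s') (x1, y1) \<le> b + D (x0, s) (x1, y1)"
  shows "min (g + D (x0, y1) (t, y1)) (b' + D (x0, s') (t, y1)) \<le> b + 5 * D (x0, s) (t, y1)"
proof -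
  let ?m = "min (g + D (x0, y1) (t, y1)) (b' + D (x0, s') (t, y1))"
  have "(?m - b) / 5 \<le> D (x0, s) (t, y1)"
  proof (rule D_ge)
    fix a assume a: "mpath a" "a (x0 + s) = x0" "a (t + y1) = t"
    from west_to_north_path[OF a s s' t] have "?m - b \<le> 5 * K a (x0 + s) (t + y1)"
      using assms(7,8) by linarith
    then show "(?m - b) / 5 \<le> K a (x0 + s) (t + y1)" by simp
  qed (use s t in auto)
  then show ?thesis by (simp add: field_simps)
qed

text \<open>A Lipschitz constant for \<open>D\<close> under horizontal moves of an endpoint; the sum
  of the side lengths bounds the length of every path in the cell.\<close>

definition C0 where "C0 = M + 2 * (x1 - x0 + (y1 - y0))"

lemma C0_nonneg: "0 \<le> C0" using M_nonneg x01 y01 by (simp add: C0_def)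

lemma move_end:
  assumes "x0 \<le> a" "y0 \<le> b" "b \<le> y1" "a \<le> t" "t \<le> t'" "t' \<le> x1"
  shows "\<bar>D (a, b) (t, y1) - D (a, b) (t', y1)\<bar> \<le> C0 * (t' - t)"
proof -
  have "\<bar>D (a, b) (t, y1) - D (a, b) (t', y1)\<bar> \<le> (M + 2 * (t' + y1 - a - b)) * (t' - t)"
    using assms by (intro D_move_end) auto
  also have "\<dots> \<le> C0 * (t' - t)" unfolding C0_def using assms by (intro mult_right_mono) auto
  finally show ?thesis .
qed

lemma move_start:
  assumes "x0 \<le> s" "s \<le> s'" "s' \<le> t" "t \<le> x1"
  shows "\<bar>D (s, y0) (t, y1) - D (s', y0) (t, y1)\<bar> \<le> C0 * (s' - s)"
proof -
  have "\<bar>D (s, y0) (t, y1) - D (s', y0) (t, y1)\<bar> \<le> (M + 2 * (t + y1 - s - y0)) * (s' - s)"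
    using assms y01 by (intro D_move_start) auto
  also have "\<dots> \<le> C0 * (s' - s)" unfolding C0_def using assms by (intro mult_right_mono) auto
  finally show ?thesis .
qed

text \<open>\<open>minimiser_rule\<close> says something about the selected point only if a
  minimiser exists.\<close>

lemma south_attains:
  assumes "border_inv D e x0 x1 F"
  shows "\<exists>s. is_arg_min (\<lambda>s. F s + D (s, y0) (x1, y1)) (\<lambda>s. s \<in> {x0..x1}) s"
proof -
  have "C0-lipschitz_on {x0..x1} (\<lambda>s. D (s, y0) (x1, y1))"
    unfolding lipschitz_on_def
  proof (intro conjI ballI C0_nonneg)
    fix s s' assume "s \<in> {x0..x1}" "s' \<in> {x0..x1}"
    then show "dist (D (s, y0) (x1, y1)) (D (s', y0) (x1, y1)) \<le> C0 * dist s s'"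
      using move_start[of s s' x1] move_start[of s' s x1]
      by (cases "s \<le> s'") (auto simp: dist_real_def abs_minus_commute)
  qed
  then have "continuous_on {x0..x1} (\<lambda>s. F s + D (s, y0) (x1, y1))"
    by (intro continuous_on_add border_inv_continuous[OF assms] lipschitz_on_continuous_on)
  then obtain s where "s \<in> {x0..x1}" "\<forall>s'\<in>{x0..x1}. F s + D (s, y0) (x1, y1) \<le> F s' + D (s', y0) (x1, y1)"
    using continuous_attains_inf[of "{x0..x1}"] x01 by fastforce
  then show ?thesis by (auto simp: is_arg_min_linorder)
qed

text \<open>The factor 5 is needed only for entries from the west; the fact \<open>south\<close>
  below shows that entries from the south are propagated without loss, although the algorithm tries
  only some of them.\<close>

lemma north_step:
  assumes x0: "0 \<le> x0" and y0: "0 \<le> y0"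
    and S: "border_inv D (\<lambda>t. (t, y0)) x0 x1 FS" and W: "border_inv D (\<lambda>t. (x0, t)) y0 y1 FW"
    and sS': "x0 \<le> sS" "sS \<le> x1" "\<forall>s\<in>{x0..x1}. hS \<le> FS s + D (s, y0) (x1, y1)"
      "hS = FS sS + D (sS, y0) (x1, y1)"
    and sW': "y0 \<le> sW" "sW \<le> y1" "\<forall>s\<in>{y0..y1}. hW \<le> FW s + D (x0, s) (x1, y1)"
      "hW = FW sW + D (x0, sW) (x1, y1)"
  defines "n2 \<equiv> \<lambda>t. min (FW y1 + D (x0, y1) (t, y1)) (FW sW + D (x0, sW) (t, y1))"
    and "J \<equiv> \<lambda>t. INF s\<in>{s\<in>{x0..x1}. s \<le> sS \<and> s \<le> t}. FS s + D (s, y0) (t, y1)"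
  defines "F \<equiv> \<lambda>t. if hS < hW then min (n2 t) (J t) else n2 t"
  shows "border_inv D (\<lambda>t. (t, y1)) x0 x1 F" "F x1 = min hS hW"
proof -
  have sS: "x0 \<le> sS" "sS \<le> x1" "\<And>s. x0 \<le> s \<Longrightarrow> s \<le> x1 \<Longrightarrow> hS \<le> FS s + D (s, y0) (x1, y1)"
    "hS = FS sS + D (sS, y0) (x1, y1)"
    using sS' by auto
  have sW: "y0 \<le> sW" "sW \<le> y1" "\<And>s. y0 \<le> s \<Longrightarrow> s \<le> y1 \<Longrightarrow> hW \<le> FW s + D (x0, s) (x1, y1)"
    "hW = FW sW + D (x0, sW) (x1, y1)"
    using sW' by auto
  have FS: "D (0, 0) (s, y0) \<le> FS s" "FS s \<le> 5 * D (0, 0) (s, y0)" if "x0 \<le> s" "s \<le> x1" for s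
    using border_invD[OF S that] by auto
  have FW: "D (0, 0) (x0, s) \<le> FW s" "FW s \<le> 5 * D (0, 0) (x0, s)" "FW y1 \<le> FW s + D (x0, s) (x0, y1)"
    if "y0 \<le> s" "s \<le> y1" for s
    using border_invD[OF W that] by auto
  have bdd: "bdd_below ((\<lambda>s. FS s + D (s, y0) (t, y1)) ` {s\<in>{x0..x1}. s \<le> sS \<and> s \<le> t})" for t
  proof (rule bdd_belowI[of _ 0], safe)
    fix s assume s: "s \<in> {x0..x1}" "s \<le> sS" "s \<le> t"
    show "0 \<le> FS s + D (s, y0) (t, y1)"
      using FS(1)[of s] D_nonneg[of 0 s 0 y0] D_nonneg[of s t y0 y1] s x0 y0 y01 by auto
  qed
  have J_le: "J t \<le> FS s + D (s, y0) (t, y1)" if "x0 \<le> s" "s \<le> x1" "s \<le> sS" "s \<le> t" for s t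
    unfolding J_def using that by (intro cINF_lower[OF bdd]) auto
  have J_ge: "b \<le> J t" if "x0 \<le> t" "\<And>s. x0 \<le> s \<Longrightarrow> s \<le> x1 \<Longrightarrow> s \<le> sS \<Longrightarrow> s \<le> t \<Longrightarrow> b \<le> FS s + D (s, y0) (t, y1)" for b t
    unfolding J_def using that x01 sS by (intro cINF_greatest) auto
  have lower: "D (0, 0) (t, y1) \<le> F t" if t: "x0 \<le> t" "t \<le> x1" for t
  proof -
    have W: "D (0, 0) (t, y1) \<le> FW s + D (x0, s) (t, y1)" if "y0 \<le> s" "s \<le> y1" for s
      using D_triangle[of 0 x0 0 s t y1] FW(1)[OF that] that x0 y0 t by simp
    have "D (0, 0) (t, y1) \<le> n2 t" unfolding n2_def using W[of y1] W[of sW] sW y01 by simp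
    moreover have "D (0, 0) (t, y1) \<le> J t"
    proof (rule J_ge)
      fix s assume "x0 \<le> s" "s \<le> x1" "s \<le> sS" "s \<le> t"
      then show "D (0, 0) (t, y1) \<le> FS s + D (s, y0) (t, y1)"
        using D_triangle[of 0 s 0 y0 t y1] FS(1)[of s] x0 y0 y01 by simp
    qed (rule t)
    ultimately show ?thesis by (auto simp: F_def)
  qed
  have F_n2: "F t \<le> n2 t" for t by (auto simp: F_def)
  have south: "F t \<le> FS s + D (s, y0) (t, y1)" if s: "x0 \<le> s" "s \<le> t" "t \<le> x1" for s t
  proof (cases "hS < hW")
    case True
    then have "F t \<le> J t" by (auto simp: F_def)
    show ?thesis
    proof (cases "s \<le> sS")
      case True
      then show ?thesis using J_le[of s t] \<open>F t \<le> J t\<close> s by simp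
    next
      case False
      \<comment> \<open>A path from a point right of \<open>sS\<close> to the north border crosses
        every path from \<open>sS\<close> to the corner; optimality of \<open>sS\<close> makes it at
        least as good a start.\<close>
      have "D (sS, y0) (t, y1) + D (s, y0) (x1, y1) \<le> D (s, y0) (t, y1) + D (sS, y0) (x1, y1)"
        using False s sS y01 by (intro D_Monge) auto
      then show ?thesis using sS(3)[of s] sS(4) J_le[of sS t] \<open>F t \<le> J t\<close> s sS(1,2) False by auto
    qed
  next
    case False
    \<comment> \<open>If the west minimum is no larger, the path from \<open>sW\<close> to the
      corner takes this part, since it too crosses every path from south to north.\<close>
    have "D (x0, sW) (t, y1) + D (s, y0) (x1, y1) \<le> D (s, y0) (t, y1) + D (x0, sW) (x1, y1)"
      using s sW y01 x01 by (intro D_Monge) auto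
    moreover have "hW \<le> FS s + D (s, y0) (x1, y1)" using False sS(3)[of s] s by simp
    moreover have "F t \<le> FW sW + D (x0, sW) (t, y1)" using F_n2[of t] by (simp add: n2_def)
    ultimately show ?thesis using sW(4) by simp
  qed
  have upper: "F t \<le> 5 * D (0, 0) (t, y1)" if t: "x0 \<le> t" "t \<le> x1" for t
  proof (rule enter_cell[OF x0 y0 t(1) y01])
    fix s assume s: "y0 \<le> s" "s \<le> y1"
    have "F t \<le> FW s + 5 * D (x0, s) (t, y1)"
    proof (rule order_trans[OF F_n2])
      have "FW sW + D (x0, sW) (x1, y1) \<le> FW s + D (x0, s) (x1, y1)" using sW(3)[OF s] sW(4) by simp
      then show "n2 t \<le> FW s + 5 * D (x0, s) (t, y1)"
        unfolding n2_def by (rule west_to_north[OF s sW(1,2) t FW(3)[OF s]])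
    qed
    then show "F t \<le> 5 * (D (0, 0) (x0, s) + D (x0, s) (t, y1))" using FW(2)[OF s] by simp
  next
    fix s assume s: "x0 \<le> s" "s \<le> t"
    show "F t \<le> 5 * (D (0, 0) (s, y0) + D (s, y0) (t, y1))"
      using south[OF s t(2)] FS(2)[of s] D_nonneg[of s t y0 y1] s t y01 by simp
  qed
  \<comment> \<open>The third clause of the invariant: the corner minima range over all entry
    points, so continuing from \<open>t\<close> to the corner cannot beat them.\<close>
  have end_le: "min hS hW \<le> F t + D (t, y1) (x1, y1)" if t: "x0 \<le> t" "t \<le> x1" for t
  proof -
    have tri: "D (a, b) (x1, y1) \<le> D (a, b) (t, y1) + D (t, y1) (x1, y1)" if "a \<le> t" "b \<le> y1" for a b
      using that t by (intro D_triangle) auto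
    have "hW \<le> FW s + D (x0, s) (t, y1) + D (t, y1) (x1, y1)" if "y0 \<le> s" "s \<le> y1" for s
      using tri[of x0 s] sW(3)[OF that] that t by simp
    from this[of y1] this[of sW] sW(1,2) y01 have "hW \<le> n2 t + D (t, y1) (x1, y1)"
      unfolding n2_def by linarith
    moreover have "hS - D (t, y1) (x1, y1) \<le> J t"
    proof (rule J_ge)
      fix s assume "x0 \<le> s" "s \<le> x1" "s \<le> sS" "s \<le> t"
      then show "hS - D (t, y1) (x1, y1) \<le> FS s + D (s, y0) (t, y1)"
        using tri[of s y0] sS(3)[of s] y01 by simp
    qed (rule t)
    ultimately show ?thesis unfolding F_def by (smt (verit))
  qed
  show F_end: "F x1 = min hS hW"
  proof (rule antisym)
    show "min hS hW \<le> F x1" using end_le[of x1] x01 by (simp add: D_refl)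
    show "F x1 \<le> min hS hW"
    proof (cases "hS < hW")
      case True
      have "F x1 \<le> J x1" using True by (auto simp: F_def)
      also have "\<dots> \<le> hS" using J_le[of sS x1] sS by simp
      finally show ?thesis using True by simp
    next
      case False
      have "F x1 \<le> n2 x1" by (rule F_n2)
      also have "\<dots> \<le> hW" using sW by (simp add: n2_def)
      finally show ?thesis using False by simp
    qed
  qed
  obtain CS where CS: "CS \<ge> 0" "\<And>t t'. x0 \<le> t \<Longrightarrow> t \<le> t' \<Longrightarrow> t' \<le> x1 \<Longrightarrow> \<bar>FS t - FS t'\<bar> \<le> CS * (t' - t)"
    using S unfolding border_inv_def by blast
  \<comment> \<open>One summand pays for the change of \<open>FS\<close>, the other two for moving
    the start and the end of the path.\<close>
  let ?C = "CS + 2 * C0"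
  have lip: "\<bar>F t - F t'\<bar> \<le> ?C * (t' - t)" if t: "x0 \<le> t" "t \<le> t'" "t' \<le> x1" for t t'
  proof -
    have 0: "0 \<le> CS * (t' - t)" "0 \<le> C0 * (t' - t)" using CS(1) C0_nonneg t by auto
    have n2: "\<bar>n2 t - n2 t'\<bar> \<le> ?C * (t' - t)"
      unfolding n2_def
    proof (rule min_lipschitz)
      show "\<bar>FW y1 + D (x0, y1) (t, y1) - (FW y1 + D (x0, y1) (t', y1))\<bar> \<le> ?C * (t' - t)"
        using move_end[of x0 y1 t t'] t y01 0 by (simp add: distrib_right)
      show "\<bar>FW sW + D (x0, sW) (t, y1) - (FW sW + D (x0, sW) (t', y1))\<bar> \<le> ?C * (t' - t)"
        using move_end[of x0 sW t t'] t sW(1,2) 0 by (simp add: distrib_right)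
    qed
    have "J t' - C0 * (t' - t) \<le> J t"
    proof (rule J_ge)
      fix s assume s: "x0 \<le> s" "s \<le> x1" "s \<le> sS" "s \<le> t"
      then show "J t' - C0 * (t' - t) \<le> FS s + D (s, y0) (t, y1)"
        using J_le[of s t'] move_end[of s y0 t t'] t y01 by (simp add: abs_le_iff)
    qed (use t in auto)
    moreover have "J t - ?C * (t' - t) \<le> J t'"
    proof (rule J_ge)
      fix s assume s: "x0 \<le> s" "s \<le> x1" "s \<le> sS" "s \<le> t'"
      \<comment> \<open>A start admissible for \<open>t'\<close> may lie beyond \<open>t\<close>; it
        is moved back to \<open>t\<close>, by at most \<open>t' - t\<close>.\<close>
      define s' where "s' = min s t"
      have s': "x0 \<le> s'" "s' \<le> x1" "s' \<le> sS" "s' \<le> t" "s' \<le> s" "s - s' \<le> t' - t"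
        using s t by (auto simp: s'_def)
      have "J t \<le> FS s' + D (s', y0) (t, y1)" using s' by (intro J_le) auto
      moreover have "FS s' \<le> FS s + CS * (s - s')" using CS(2)[of s' s] s s' by (simp add: abs_le_iff)
      moreover have "CS * (s - s') \<le> CS * (t' - t)" using s' CS(1) by (intro mult_left_mono) auto
      moreover have "D (s', y0) (t, y1) \<le> D (s', y0) (t', y1) + C0 * (t' - t)"
        using move_end[of s' y0 t t'] s' t y01 by (simp add: abs_le_iff)
      moreover have "D (s', y0) (t', y1) \<le> D (s, y0) (t', y1) + C0 * (s - s')"
        using move_start[of s' s t'] s s' t by (simp add: abs_le_iff)
      moreover have "C0 * (s - s') \<le> C0 * (t' - t)" using s' C0_nonneg by (intro mult_left_mono) auto
      moreover have "?C * (t' - t) = CS * (t' - t) + C0 * (t' - t) + C0 * (t' - t)" by (simp add: algebra_simps)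
      ultimately show "J t - ?C * (t' - t) \<le> FS s + D (s, y0) (t', y1)" by linarith
    qed (use t in auto)
    moreover have "C0 * (t' - t) \<le> ?C * (t' - t)" using 0 unfolding distrib_right mult.assoc by linarith
    ultimately have "\<bar>J t - J t'\<bar> \<le> ?C * (t' - t)" by linarith
    then show ?thesis using n2 by (auto simp: F_def intro: min_lipschitz)
  qed
  have "0 \<le> ?C" using CS(1) C0_nonneg by simp
  then show "border_inv D (\<lambda>t. (t, y1)) x0 x1 F"
    unfolding border_inv_def F_end
    by (intro conjI ballI exI[of _ ?C] allI impI) ((rule lower upper end_le lip; simp) | assumption)+
qed

end

section \<open>Polygonal curves and their parametrisations\<close>

lemma piecewise_C1_cong:
  assumes f: "f piecewise_C1_differentiable_on {a..b}" and eq: "\<And>t. a \<le> t \<Longrightarrow> t \<le> b \<Longrightarrow> f t = g t"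
  shows "g piecewise_C1_differentiable_on {a..b}"
proof -
  obtain S D where S: "finite S" "\<And>x. x \<in> {a..b} - S \<Longrightarrow> (f has_vector_derivative D x) (at x)"
    "continuous_on ({a..b} - S) D" and c: "continuous_on {a..b} f"
    using f unfolding piecewise_C1_differentiable_on_def C1_differentiable_on_def by blast
  \<comment> \<open>The derivatives are two-sided but the functions agree only on the interval, so
    its endpoints join the exceptional set.\<close>
  have "g C1_differentiable_on {a..b} - (S \<union> {a, b})"
    unfolding C1_differentiable_on_def
  proof (intro exI conjI ballI)
    fix x assume x: "x \<in> {a..b} - (S \<union> {a, b})"
    show "(g has_vector_derivative D x) (at x)"
      by (rule has_vector_derivative_transform_within_open[of f _ _ "{a<..<b}"]) (use S(2)[of x] x eq in auto)
  next
    show "continuous_on ({a..b} - (S \<union> {a, b})) D" by (rule continuous_on_subset[OF S(3)]) auto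
  qed
  moreover have "continuous_on {a..b} g" using c eq by (subst continuous_on_cong[of _ _ _ f]) auto
  moreover have "finite (S \<union> {a, b})" using S(1) by simp
  ultimately show ?thesis unfolding piecewise_C1_differentiable_on_def by blast
qed

text \<open>A monotone function onto an interval has no jumps. Extending it with slope 1 on both
  sides gives a monotone surjection of the line, to which the continuity criterion for open images
  applies.\<close>

lemma mono_on_image_continuous:
  fixes \<phi> :: "real \<Rightarrow> real"
  assumes "a \<le> b" and mono: "mono_on {a..b} \<phi>" and im: "\<phi> ` {a..b} = {0..L}"
  shows "\<phi> a = 0" "\<phi> b = L" "0 \<le> L" "continuous_on {a..b} \<phi>"
proof -
  have mem: "\<phi> t \<in> {0..L}" if "t \<in> {a..b}" for t using im that by blast
  have "0 \<le> L" using mem[of a] assms(1) by auto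
  then obtain t0 t1 where t: "t0 \<in> {a..b}" "\<phi> t0 = 0" "t1 \<in> {a..b}" "\<phi> t1 = L"
    using im by (metis atLeastAtMost_iff imageE order_refl)
  show 0: "\<phi> a = 0" using mono_onD[OF mono, of a t0] t mem[of a] by auto
  show L: "\<phi> b = L" using mono_onD[OF mono, of t1 b] t mem[of b] by auto
  show "0 \<le> L" by fact
  define c where "c t = max a (min b t)" for t
  define \<psi> where "\<psi> t = \<phi> (c t) + (t - c t)" for t
  have c: "c t \<in> {a..b}" "t \<le> t' \<Longrightarrow> c t \<le> c t'" "t \<le> t' \<Longrightarrow> t - c t \<le> t' - c t'" for t t'
    using assms(1) by (auto simp: c_def)
  have "range \<psi> = UNIV"
  proof -
    have "\<exists>t. y = \<psi> t" for y
    proof -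
      consider "y < 0" | "y > L" | "y \<in> {0..L}" by fastforce
      then show ?thesis
      proof cases
        case 1
        then have "\<psi> (a + y) = y" using 0 assms(1) by (simp add: \<psi>_def c_def)
        then show ?thesis by metis
      next
        case 2
        then have "\<psi> (b + (y - L)) = y" using L assms(1) by (simp add: \<psi>_def c_def)
        then show ?thesis by metis
      next
        case 3
        then obtain t where "t \<in> {a..b}" "y = \<phi> t" using im by blast
        then have "\<psi> t = y" by (simp add: \<psi>_def c_def)
        then show ?thesis by metis
      qed
    qed
    then show ?thesis by blast
  qed
  moreover have "\<psi> t \<le> \<psi> t'" if "t \<le> t'" for t t'
    unfolding \<psi>_def using mono_onD[OF mono c(1) c(1) c(2)[OF that]] c(3)[OF that] by linarith
  ultimately have "continuous_on UNIV \<psi>" by (intro continuous_onI_mono) auto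
  then have "continuous_on {a..b} \<psi>" by (rule continuous_on_subset) simp
  then show "continuous_on {a..b} \<phi>"
    by (rule continuous_on_eq) (auto simp: \<psi>_def c_def)
qed

text \<open>Limits are Euclidean while \<open>N\<close> is an arbitrary norm; it is dominated by a
  weighted sum of the absolute coordinates.\<close>

lemma norm_tendsto:
  fixes N :: "real^2 \<Rightarrow> real"
  assumes N: "is_norm N" and f: "(f \<longlongrightarrow> l) F"
  shows "((\<lambda>x. N (f x)) \<longlongrightarrow> N l) F"
proof -
  have le: "N x \<le> \<bar>x $ 1\<bar> * N (axis 1 1) + \<bar>x $ 2\<bar> * N (axis 2 1)" for x
  proof -
    have "x = x $ 1 *\<^sub>R axis 1 1 + x $ 2 *\<^sub>R axis 2 1"
      by (simp add: vec_eq_iff forall_2 axis_def)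
    then show ?thesis
      using is_norm_triangle[OF N, of "x $ 1 *\<^sub>R axis 1 1" "x $ 2 *\<^sub>R axis 2 1"] by (simp add: is_norm_scale[OF N])
  qed
  have "((\<lambda>x. \<bar>(f x - l) $ 1\<bar> * N (axis 1 1) + \<bar>(f x - l) $ 2\<bar> * N (axis 2 1)) \<longlongrightarrow>
      \<bar>(l - l) $ 1\<bar> * N (axis 1 1) + \<bar>(l - l) $ 2\<bar> * N (axis 2 1)) F"
    by (intro tendsto_intros f)
  then have "((\<lambda>x. \<bar>(f x - l) $ 1\<bar> * N (axis 1 1) + \<bar>(f x - l) $ 2\<bar> * N (axis 2 1)) \<longlongrightarrow> 0) F" by simp
  then have "((\<lambda>x. N (f x) - N l) \<longlongrightarrow> 0) F"
    by (rule Lim_null_comparison[rotated])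
      (use order_trans[OF is_norm_diff[OF N] le] in \<open>auto intro!: always_eventually\<close>)
  then show ?thesis by (simp add: LIM_zero_iff)
qed

section \<open>Arc length parametrisation of one curve\<close>

locale curve =
  fixes N :: "real^2 \<Rightarrow> real" and p :: "nat \<Rightarrow> real^2" and n :: nat
  assumes N: "is_norm N" and poly: "polygonal_curve p n"
begin

abbreviation l where "l \<equiv> arc_len N p"
abbreviation L where "L \<equiv> arc_len N p n"
abbreviation A where "A \<equiv> arc_param N p"

definition dir :: "nat \<Rightarrow> real^2" where
  "dir i = (1 / N (p i - p (i - 1))) *\<^sub>R (p i - p (i - 1))"

lemma seg_pos: "1 \<le> i \<Longrightarrow> i \<le> n \<Longrightarrow> 0 < N (p i - p (i - 1))"
  using poly is_norm_zero_iff[OF N, of "p i - p (i - 1)"] is_norm_nonneg[OF N, of "p i - p (i - 1)"]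
  by (auto simp: polygonal_curve_def less_le)

lemma N_dir: "1 \<le> i \<Longrightarrow> i \<le> n \<Longrightarrow> N (dir i) = 1"
  using seg_pos[of i] by (simp add: dir_def is_norm_scale[OF N])

lemma l_0 [simp]: "l 0 = 0" by (simp add: arc_len_def)

lemma l_Suc: "l (Suc i) = l i + N (p (Suc i) - p i)" by (simp add: arc_len_def)

lemma l_step: "1 \<le> i \<Longrightarrow> l i = l (i - 1) + N (p i - p (i - 1))"
  using l_Suc[of "i - 1"] by simp

lemma l_less: "1 \<le> i \<Longrightarrow> i \<le> n \<Longrightarrow> l (i - 1) < l i"
  using l_step[of i] seg_pos[of i] by simp

lemma l_mono: "i \<le> j \<Longrightarrow> l i \<le> l j"
  unfolding arc_len_def by (rule sum_mono2) (auto intro: is_norm_nonneg[OF N])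

lemma L_pos: "0 < L"
  using poly l_less[of n] l_mono[of 0 "n - 1"] by (auto simp: polygonal_curve_def)

text \<open>Valid at both ends of the segment: at a vertex \<open>arc_param\<close> uses the earlier
  segment, and the formulas of the two segments agree there.\<close>

lemma A_segment:
  assumes i: "1 \<le> i" "i \<le> n" and s: "l (i - 1) \<le> s" "s \<le> l i"
  shows "A s = p (i - 1) + (s - l (i - 1)) *\<^sub>R dir i"
proof -
  have *: "A s = p (j - 1) + (s - l (j - 1)) *\<^sub>R dir j"
    if "1 \<le> j" "s \<le> l j" "l (j - 1) < s \<or> j = 1" for j
  proof -
    have "(LEAST i. i \<ge> 1 \<and> s \<le> l i) = j"
    proof (rule Least_equality)
      fix k assume k: "1 \<le> k \<and> s \<le> l k"
      show "j \<le> k"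
      proof (rule ccontr)
        assume "\<not> j \<le> k"
        then have "k \<le> j - 1" by simp
        then have "l k \<le> l (j - 1)" by (rule l_mono)
        then show False using that(3) k \<open>k \<le> j - 1\<close> by linarith
      qed
    qed (use that in auto)
    then show ?thesis by (simp add: arc_param_def dir_def Let_def)
  qed
  show ?thesis
  proof (cases "l (i - 1) < s \<or> i = 1")
    case True
    then show ?thesis using *[of i] i s by blast
  next
    case False
    then have s': "s = l (i - 1)" "2 \<le> i" using i s by auto
    have i': "1 \<le> i - 1" "i - 1 \<le> n" using s'(2) i by auto
    have "A s = p (i - 1 - 1) + (s - l (i - 1 - 1)) *\<^sub>R dir (i - 1)"
      using *[of "i - 1"] s' l_less[OF i'] i' by simp
    also have "s - l (i - 1 - 1) = N (p (i - 1) - p (i - 1 - 1))"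
      using l_step[OF i'(1)] s' by simp
    also have "\<dots> *\<^sub>R dir (i - 1) = p (i - 1) - p (i - 1 - 1)"
      unfolding dir_def using seg_pos[OF i'] by simp
    finally show ?thesis using s' by simp
  qed
qed

lemma A_isometry:
  assumes i: "1 \<le> i" "i \<le> n" and s: "l (i - 1) \<le> s" "s \<le> l i" and s': "l (i - 1) \<le> s'" "s' \<le> l i"
  shows "N (A s - A s') = \<bar>s - s'\<bar>"
proof -
  have "A s - A s' = (s - s') *\<^sub>R dir i"
    unfolding A_segment[OF i s] A_segment[OF i s'] by (simp add: algebra_simps)
  then show ?thesis using N_dir[OF i] by (simp add: is_norm_scale[OF N])
qed

lemma segment_right:
  assumes "0 \<le> s" "s < l k" "k \<le> n"
  shows "\<exists>i. 1 \<le> i \<and> i \<le> n \<and> l (i - 1) \<le> s \<and> s < l i"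
  using assms(2,3)
proof (induction k)
  case (Suc k)
  show ?case
  proof (cases "s < l k")
    case False
    then show ?thesis using Suc by (intro exI[of _ "Suc k"]) auto
  qed (use Suc in auto)
qed (use assms in auto)

lemma segment_left:
  assumes "0 < s" "s \<le> l k" "k \<le> n"
  shows "\<exists>i. 1 \<le> i \<and> i \<le> n \<and> l (i - 1) < s \<and> s \<le> l i"
  using assms(2,3)
proof (induction k)
  case (Suc k)
  show ?case
  proof (cases "s \<le> l k")
    case False
    then show ?thesis using Suc by (intro exI[of _ "Suc k"]) auto
  qed (use Suc in auto)
qed (use assms in auto)

text \<open>Distances are taken from the fixed point \<open>s\<close> only, so a vertex at
  \<open>s\<close> does no harm: each side of it lies on a single segment.\<close>

lemma A_local_isometry:
  assumes "0 \<le> s" "s \<le> L"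
  shows "\<exists>e>0. \<forall>s'. 0 \<le> s' \<longrightarrow> s' \<le> L \<longrightarrow> \<bar>s' - s\<bar> < e \<longrightarrow> N (A s' - A s) = \<bar>s' - s\<bar>"
proof -
  have "\<exists>e>0. \<forall>s'. s \<le> s' \<longrightarrow> s' \<le> L \<longrightarrow> s' - s < e \<longrightarrow> N (A s' - A s) = \<bar>s' - s\<bar>"
  proof (cases "s < L")
    case True
    obtain i where i: "1 \<le> i" "i \<le> n" "l (i - 1) \<le> s" "s < l i"
      using segment_right[OF assms(1) True] by blast
    then show ?thesis by (intro exI[of _ "l i - s"] conjI allI impI A_isometry[OF i(1,2)]) (use i in linarith)+
  next
    case False
    then show ?thesis using assms is_norm_zero_iff[OF N] by (intro exI[of _ 1]) auto
  qed
  then obtain e1 where e1: "e1 > 0" "\<And>s'. s \<le> s' \<Longrightarrow> s' \<le> L \<Longrightarrow> s' - s < e1 \<Longrightarrow> N (A s' - A s) = \<bar>s' - s\<bar>"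
    by blast
  have "\<exists>e>0. \<forall>s'. 0 \<le> s' \<longrightarrow> s' \<le> s \<longrightarrow> s - s' < e \<longrightarrow> N (A s' - A s) = \<bar>s' - s\<bar>"
  proof (cases "0 < s")
    case True
    obtain i where i: "1 \<le> i" "i \<le> n" "l (i - 1) < s" "s \<le> l i"
      using segment_left[OF True assms(2)] by blast
    then show ?thesis by (intro exI[of _ "s - l (i - 1)"] conjI allI impI A_isometry[OF i(1,2)]) (use i in linarith)+
  next
    case False
    then show ?thesis using assms is_norm_zero_iff[OF N] by (intro exI[of _ 1]) auto
  qed
  then obtain e2 where e2: "e2 > 0" "\<And>s'. 0 \<le> s' \<Longrightarrow> s' \<le> s \<Longrightarrow> s - s' < e2 \<Longrightarrow> N (A s' - A s) = \<bar>s' - s\<bar>"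
    by blast
  show ?thesis
  proof (intro exI[of _ "min e1 e2"] conjI allI impI)
    fix s' assume s': "0 \<le> s'" "s' \<le> L" "\<bar>s' - s\<bar> < min e1 e2"
    then show "N (A s' - A s) = \<bar>s' - s\<bar>" using e1(2)[of s'] e2(2)[of s'] by (cases "s \<le> s'") auto
  qed (use e1 e2 in auto)
qed

lemma A_lipschitz:
  assumes "0 \<le> s" "s \<le> L" "0 \<le> s'" "s' \<le> L"
  shows "N (A s - A s') \<le> \<bar>s - s'\<bar>"
proof -
  have *: "N (A s' - A s) \<le> s' - s" if "k \<le> n" "0 \<le> s" "s \<le> s'" "s' \<le> l k" for k s s'
    using that
  proof (induction k arbitrary: s s')
    case 0
    then have "s' = s" by simp
    then show ?case using is_norm_zero_iff[OF N, of 0] by simp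
  next
    case (Suc k)
    consider "s' \<le> l k" | "s \<le> l k" "l k \<le> s'" | "l k \<le> s" by linarith
    then show ?case
    proof cases
      case 1
      then show ?thesis using Suc by auto
    next
      case 2
      have "N (A s' - A (l k)) = \<bar>s' - l k\<bar>"
        using A_isometry[of "Suc k" s' "l k"] Suc.prems 2 l_mono[of k "Suc k"] by simp
      moreover have "N (A (l k) - A s) \<le> l k - s" using Suc 2 by auto
      ultimately show ?thesis using is_norm_triangle[OF N, of "A s' - A (l k)" "A (l k) - A s"] 2 by simp
    next
      case 3
      then show ?thesis using A_isometry[of "Suc k" s' s] Suc.prems by simp
    qed
  qed
  show ?thesis using *[of n s s'] *[of n s' s] assms is_norm_minus_commute[OF N, of "A s"]
    by (cases "s \<le> s'") auto
qed

text \<open>Clamping the argument extends the height function to a bounded Lipschitz function on the plane;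
  \<^term>\<open>arc_param N p s\<close> has no meaning for \<open>s\<close> beyond the length of the curve.\<close>

definition Ac :: "real \<Rightarrow> real^2" where "Ac s = A (max 0 (min L s))"

lemma Ac_eq: "0 \<le> s \<Longrightarrow> s \<le> L \<Longrightarrow> Ac s = A s" by (simp add: Ac_def)

lemma Ac_lipschitz: "N (Ac s - Ac s') \<le> \<bar>s - s'\<bar>"
proof -
  have "N (Ac s - Ac s') \<le> \<bar>max 0 (min L s) - max 0 (min L s')\<bar>"
    unfolding Ac_def using L_pos by (intro A_lipschitz) auto
  also have "\<dots> \<le> \<bar>s - s'\<bar>" by (auto simp: max_def min_def)
  finally show ?thesis .
qed

lemma Ac_bounded: "N (Ac s - Ac 0) \<le> L"
proof -
  have "Ac 0 = A 0" using L_pos by (simp add: Ac_def)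
  then have "N (Ac s - Ac 0) \<le> \<bar>max 0 (min L s) - 0\<bar>"
    using A_lipschitz[of "max 0 (min L s)" 0] L_pos by (simp add: Ac_def)
  also have "\<dots> \<le> L" using L_pos by auto
  finally show ?thesis .
qed

lemma A_piecewise_C1: "k \<le> n \<Longrightarrow> A piecewise_C1_differentiable_on {0..l k}"
proof (induction k)
  case 0
  show ?case by (rule piecewise_C1_cong[of "\<lambda>_. A 0"]) (auto intro: piecewise_C1_differentiable_const)
next
  case (Suc k)
  let ?g = "\<lambda>s. p k + (s - l k) *\<^sub>R dir (Suc k)"
  have "?g C1_differentiable_on {l k..l (Suc k)}"
    by (intro C1_differentiable_on_add C1_differentiable_on_scaleR C1_differentiable_on_diff) auto
  then have g: "?g piecewise_C1_differentiable_on {l k..l (Suc k)}" by (rule C1_differentiable_imp_piecewise)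
  have eq: "A s = ?g s" if "l k \<le> s" "s \<le> l (Suc k)" for s
    using A_segment[of "Suc k" s] Suc.prems that by simp
  have lk: "0 \<le> l k" "l k \<le> l (Suc k)" using l_mono[of 0 k] l_mono[of k "Suc k"] by auto
  have "(\<lambda>s. if s \<le> l k then A s else ?g s) piecewise_C1_differentiable_on {0..l (Suc k)}"
    using Suc g lk eq[of "l k"] by (intro piecewise_C1_differentiable_cases) auto
  then show ?case by (rule piecewise_C1_cong) (use eq in auto)
qed

lemma Ac_piecewise_C1: "Ac piecewise_C1_differentiable_on {c..d}"
proof -
  define R where "R = max \<bar>c\<bar> \<bar>d\<bar> + L"
  have R: "L \<le> R" "-R \<le> 0" "-R \<le> c" "d \<le> R" using L_pos by (auto simp: R_def)
  have "(\<lambda>s. if s \<le> L then A s else A L) piecewise_C1_differentiable_on {0..R}"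
    by (rule piecewise_C1_differentiable_cases[OF A_piecewise_C1 piecewise_C1_differentiable_const]) (use R L_pos in auto)
  then have "(\<lambda>s. if s \<le> 0 then A 0 else if s \<le> L then A s else A L) piecewise_C1_differentiable_on {-R..R}"
    by (rule piecewise_C1_differentiable_cases[OF piecewise_C1_differentiable_const]) (use R L_pos in auto)
  then have "Ac piecewise_C1_differentiable_on {-R..R}"
    by (rule piecewise_C1_cong) (use L_pos in \<open>auto simp: Ac_def max_def min_def\<close>)
  then show ?thesis by (rule piecewise_C1_differentiable_on_subset) (use R in auto)
qed

text \<open>A monotone parametrisation moves along the curve exactly as fast as its arc length
  coordinate grows, because the arc length parametrisation is a local isometry.\<close>

lemma coordinate_derivative:
  assumes "a < b" and f: "f piecewise_C1_differentiable_on {a..b}"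
    and \<phi>: "mono_on {a..b} \<phi>" "\<phi> ` {a..b} = {0..L}" "\<And>t. t \<in> {a..b} \<Longrightarrow> f t = A (\<phi> t)"
  shows "\<exists>X. finite X \<and> a \<in> X \<and> b \<in> X \<and> (\<forall>t\<in>{a..b} - X. (\<phi> has_real_derivative speed N a b f t) (at t))"
proof -
  obtain S D where S: "finite S" "\<And>x. x \<in> {a..b} - S \<Longrightarrow> (f has_vector_derivative D x) (at x)"
    using f unfolding piecewise_C1_differentiable_on_def C1_differentiable_on_def by blast
  have cont: "continuous_on {a..b} \<phi>" using mono_on_image_continuous[OF _ \<phi>(1,2)] assms(1) by simp
  have mem: "0 \<le> \<phi> t" "\<phi> t \<le> L" if "t \<in> {a..b}" for t using \<phi>(2) that by (metis atLeastAtMost_iff imageI)+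
  have "(\<phi> has_real_derivative speed N a b f t) (at t)" if t: "t \<in> {a..b} - (S \<union> {a, b})" for t
  proof -
    have tab: "a < t" "t < b" "t \<in> {a..b}" using t by auto
    have fD: "(f has_vector_derivative D t) (at t)" using S(2)[of t] t by auto
    have speed: "speed N a b f t = N (D t)"
      unfolding speed_def using vector_derivative_at_within_ivl[OF fD] tab assms(1) by simp
    obtain e where e: "e > 0" "\<And>s'. 0 \<le> s' \<Longrightarrow> s' \<le> L \<Longrightarrow> \<bar>s' - \<phi> t\<bar> < e \<Longrightarrow> N (A s' - A (\<phi> t)) = \<bar>s' - \<phi> t\<bar>"
      using A_local_isometry[of "\<phi> t"] mem[OF tab(3)] by blast
    have quot: "((\<lambda>y. (1 / (y - t)) *\<^sub>R (f y - f t)) \<longlongrightarrow> D t) (at t)"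
    proof (rule vec_tendstoI)
      fix i
      have "((\<lambda>y. f y $ i) has_vector_derivative D t $ i) (at t)"
        using bounded_linear.has_vector_derivative[OF bounded_linear_vec_nth fD] .
      then have "((\<lambda>y. (f y $ i - f t $ i) / (y - t)) \<longlongrightarrow> D t $ i) (at t)"
        unfolding has_real_derivative_iff_has_vector_derivative[symmetric] has_field_derivative_iff .
      then show "((\<lambda>y. ((1 / (y - t)) *\<^sub>R (f y - f t)) $ i) \<longlongrightarrow> D t $ i) (at t)" by simp
    qed
    then have "((\<lambda>y. N ((1 / (y - t)) *\<^sub>R (f y - f t))) \<longlongrightarrow> N (D t)) (at t)" by (rule norm_tendsto[OF N])
    moreover have "\<forall>\<^sub>F y in at t. N ((1 / (y - t)) *\<^sub>R (f y - f t)) = (\<phi> y - \<phi> t) / (y - t)"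
    proof -
      have "isCont \<phi> t" using cont tab by (auto simp: continuous_on_interior interior_atLeastAtMost_real)
      then have "(\<phi> \<longlongrightarrow> \<phi> t) (at t)" by (simp add: isCont_def)
      then have "\<forall>\<^sub>F y in at t. dist (\<phi> y) (\<phi> t) < e" using e(1) by (rule tendstoD)
      moreover have "\<forall>\<^sub>F y in at t. y \<in> {a<..<b}"
        using tab by (intro eventually_at_in_open') auto
      moreover have "\<forall>\<^sub>F y in at t. y \<noteq> t" by (simp add: eventually_at_filter)
      ultimately show ?thesis
      proof eventually_elim
        case (elim y)
        then have y: "y \<in> {a..b}" by auto
        \<comment> \<open>The norms of the difference quotients of \<open>f\<close> are those of
          \<open>\<phi>\<close> in absolute value, and monotonicity removes the absolute value;
          differentiability of \<open>\<phi>\<close> is thus a result and not assumed.\<close>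
        have "N (f y - f t) = \<bar>\<phi> y - \<phi> t\<bar>"
          using e(2)[of "\<phi> y"] mem[OF y] elim \<phi>(3)[OF y] \<phi>(3)[OF tab(3)] by (simp add: dist_real_def)
        then have "N ((1 / (y - t)) *\<^sub>R (f y - f t)) = \<bar>(\<phi> y - \<phi> t) / (y - t)\<bar>"
          by (simp add: is_norm_scale[OF N] abs_divide)
        also have "0 \<le> (\<phi> y - \<phi> t) / (y - t)"
          using mono_onD[OF \<phi>(1) tab(3) y] mono_onD[OF \<phi>(1) y tab(3)]
          by (cases "t \<le> y") (auto simp: divide_nonpos_nonpos)
        then have "\<bar>(\<phi> y - \<phi> t) / (y - t)\<bar> = (\<phi> y - \<phi> t) / (y - t)" by (rule abs_of_nonneg)
        finally show ?case .
      qed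
    qed
    ultimately have "((\<lambda>y. (\<phi> y - \<phi> t) / (y - t)) \<longlongrightarrow> N (D t)) (at t)" by (rule Lim_transform_eventually)
    then show ?thesis unfolding speed has_field_derivative_iff .
  qed
  then show ?thesis using S(1) by (intro exI[of _ "S \<union> {a, b}"]) auto
qed

lemma speed_integral:
  assumes "a < b" and f: "f piecewise_C1_differentiable_on {a..b}"
    and \<phi>: "mono_on {a..b} \<phi>" "\<phi> ` {a..b} = {0..L}" "\<And>t. t \<in> {a..b} \<Longrightarrow> f t = A (\<phi> t)"
    and s: "a \<le> s" "s \<le> b"
  shows "(speed N a b f has_integral \<phi> s) {a..s}"
proof -
  obtain X where X: "finite X" "a \<in> X" "b \<in> X" "\<And>t. t \<in> {a..b} - X \<Longrightarrow> (\<phi> has_real_derivative speed N a b f t) (at t)"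
    using coordinate_derivative[OF assms(1-5)] by blast
  have c: "\<phi> a = 0" "continuous_on {a..b} \<phi>" using mono_on_image_continuous[OF _ \<phi>(1,2)] assms(1) by auto
  have "(speed N a b f has_integral \<phi> s - \<phi> a) {a..s}"
  proof (rule fundamental_theorem_of_calculus_interior_strong[OF X(1) s(1)])
    show "(\<phi> has_vector_derivative speed N a b f x) (at x)" if "x \<in> {a<..<s} - X" for x
      using X(4)[of x] that s by (auto simp: has_real_derivative_iff_has_vector_derivative)
    show "continuous_on {a..s} \<phi>" using c(2) by (rule continuous_on_subset) (use s in auto)
  qed
  then show ?thesis by (simp add: c)
qed

end

section \<open>The height function of a pair of curves\<close>

locale curves = P: curve N p n + Q: curve N q m for N p n q m
begin

definition hgt :: "real \<Rightarrow> real \<Rightarrow> real" where "hgt x y = N (P.Ac x - Q.Ac y)"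

abbreviation \<sigma> where "\<sigma> \<equiv> P.L + Q.L"

lemma \<sigma>_pos: "0 < \<sigma>" using P.L_pos Q.L_pos by simp

sublocale H: height hgt "hgt 0 0 + P.L + Q.L"
proof
  fix x y x' y'
  have *: "hgt x y \<le> hgt x' y' + N (P.Ac x - P.Ac x') + N (Q.Ac y - Q.Ac y')" for x y x' y'
    using is_norm_triangle[OF P.N, of "P.Ac x - P.Ac x'" "P.Ac x' - Q.Ac y"]
      is_norm_triangle[OF P.N, of "P.Ac x' - Q.Ac y'" "Q.Ac y' - Q.Ac y"] is_norm_minus_commute[OF P.N, of "Q.Ac y'"]
    by (simp add: hgt_def)
  show "0 \<le> hgt x y" by (simp add: hgt_def is_norm_nonneg[OF P.N])
  show "hgt x y \<le> hgt 0 0 + P.L + Q.L" using *[of x y 0 0] P.Ac_bounded[of x] Q.Ac_bounded[of y] by simp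
  show "\<bar>hgt x y - hgt x' y'\<bar> \<le> \<bar>x - x'\<bar> + \<bar>y - y'\<bar>"
    using *[of x y x' y'] *[of x' y' x y] P.Ac_lipschitz[of x x'] Q.Ac_lipschitz[of y y']
      P.Ac_lipschitz[of x' x] Q.Ac_lipschitz[of y' y] by linarith
qed

lemma mono_on_mem: "\<phi> ` {a..b} = {0..L'} \<Longrightarrow> t \<in> {a..b} \<Longrightarrow> 0 \<le> \<phi> t \<and> \<phi> t \<le> L'" for \<phi> :: "real \<Rightarrow> real"
  by (metis atLeastAtMost_iff imageI)

text \<open>Substitution of the coordinate sum \<open>\<phi> t + \<psi> t\<close>, whose derivative
  is the sum of the speeds off a finite set.\<close>

lemma param_pair_integral:
  assumes "a < b"
    and f: "f piecewise_C1_differentiable_on {a..b}" "mono_on {a..b} \<phi>" "\<phi> ` {a..b} = {0..P.L}"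
      "\<And>t. t \<in> {a..b} \<Longrightarrow> f t = P.A (\<phi> t)"
    and g: "g piecewise_C1_differentiable_on {a..b}" "mono_on {a..b} \<psi>" "\<psi> ` {a..b} = {0..Q.L}"
      "\<And>t. t \<in> {a..b} \<Longrightarrow> g t = Q.A (\<psi> t)"
    and c: "mpath c" "\<And>t. t \<in> {a..b} \<Longrightarrow> c (\<phi> t + \<psi> t) = \<phi> t"
  shows "integral {a..b} (\<lambda>t. N (f t - g t) * (speed N a b f t + speed N a b g t)) = H.K c 0 \<sigma>"
proof -
  obtain X where X: "finite X" "\<And>t. t \<in> {a..b} - X \<Longrightarrow> (\<phi> has_real_derivative speed N a b f t) (at t)"
    using P.coordinate_derivative[OF assms(1) f] by blast
  obtain Y where Y: "finite Y" "\<And>t. t \<in> {a..b} - Y \<Longrightarrow> (\<psi> has_real_derivative speed N a b g t) (at t)"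
    using Q.coordinate_derivative[OF assms(1) g] by blast
  have ab: "a \<le> b" using assms(1) by simp
  note \<phi> = mono_on_image_continuous[OF ab f(2,3)] and \<psi> = mono_on_image_continuous[OF ab g(2,3)]
  let ?S = "\<lambda>t. \<phi> t + \<psi> t" and ?F = "\<lambda>s. hgt (c s) (s - c s)"
  let ?v = "\<lambda>t. speed N a b f t + speed N a b g t"
  have "((\<lambda>t. ?v t *\<^sub>R ?F (?S t)) has_integral integral {?S a..?S b} ?F) {a..b}"
  proof (rule has_integral_substitution_strong)
    show "finite (X \<union> Y)" using X(1) Y(1) by simp
    show "?S ` {a..b} \<subseteq> {0..\<sigma>}"
      using mono_on_mem[OF f(3)] mono_on_mem[OF g(3)] by (fastforce intro: add_mono)
    show "continuous_on {0..\<sigma>} ?F" by (rule H.continuous_path[OF c(1)])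
    show "continuous_on {a..b} ?S" using \<phi>(4) \<psi>(4) by (rule continuous_on_add)
    show "(?S has_field_derivative ?v t) (at t within {a..b})" if "t \<in> {a..b} - (X \<union> Y)" for t
      using that by (intro DERIV_subset[OF DERIV_add[OF X(2) Y(2)]]) auto
  qed (use ab \<phi> \<psi> in auto)
  then have K: "integral {a..b} (\<lambda>t. ?v t *\<^sub>R ?F (?S t)) = H.K c 0 \<sigma>"
    unfolding cost_def using \<phi> \<psi> by (simp add: integral_unique)
  have "N (f t - g t) * ?v t = ?v t *\<^sub>R ?F (?S t)" if "t \<in> {a..b}" for t
    using that f(4) g(4) c(2) mono_on_mem[OF f(3) that] mono_on_mem[OF g(3) that]
    by (simp add: hgt_def P.Ac_eq Q.Ac_eq)
  then have "integral {a..b} (\<lambda>t. N (f t - g t) * ?v t) = integral {a..b} (\<lambda>t. ?v t *\<^sub>R ?F (?S t))"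
    by (rule integral_cong)
  then show ?thesis unfolding K .
qed

subsection \<open>Piecewise smooth approximation of monotone paths\<close>

text \<open>As in \<open>monotone_params\<close>, regularity is asked of the points on the curves
  and not of \<open>a\<close>; differentiability of the coordinates off a finite set follows by
  \<open>coordinate_derivative\<close>.\<close>

definition smooth :: "real \<Rightarrow> real \<Rightarrow> (real \<Rightarrow> real) \<Rightarrow> bool" where
  "smooth l r a \<longleftrightarrow> (\<lambda>s. P.Ac (a s)) piecewise_C1_differentiable_on {l..r} \<and>
     (\<lambda>s. Q.Ac (s - a s)) piecewise_C1_differentiable_on {l..r}"

lemma smooth_cong: "smooth l r a \<Longrightarrow> (\<And>s. l \<le> s \<Longrightarrow> s \<le> r \<Longrightarrow> a s = b s) \<Longrightarrow> smooth l r b"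
  unfolding smooth_def by (elim conjE, intro conjI; erule piecewise_C1_cong; simp)

lemma smooth_horizontal: "smooth l r (\<lambda>s. s - c)"
  using piecewise_C1_differentiable_affine[of P.Ac 1 "- c" "{l..r}"] P.Ac_piecewise_C1[of "l - c" "r - c"]
  by (simp add: smooth_def o_def piecewise_C1_differentiable_const add.commute)

lemma smooth_vertical: "smooth l r (\<lambda>s. c)"
  using piecewise_C1_differentiable_affine[of Q.Ac 1 "- c" "{l..r}"] Q.Ac_piecewise_C1[of "l - c" "r - c"]
  by (simp add: smooth_def o_def piecewise_C1_differentiable_const add.commute)

lemma smooth_glue:
  assumes "smooth l c a" "smooth c r b" "l \<le> c" "c \<le> r" "a c = b c"
  shows "smooth l r (\<lambda>s. if s \<le> c then a s else b s)"
proof -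
  have "(\<lambda>s. if s \<le> c then P.Ac (a s) else P.Ac (b s)) piecewise_C1_differentiable_on {l..r}"
    "(\<lambda>s. if s \<le> c then Q.Ac (s - a s) else Q.Ac (s - b s)) piecewise_C1_differentiable_on {l..r}"
    using assms by (auto simp: smooth_def intro!: piecewise_C1_differentiable_cases)
  then show ?thesis unfolding smooth_def by (simp add: if_distrib cong: if_cong)
qed

lemma smooth_bend: "smooth l r (\<lambda>s. min (s - c) d)"
proof -
  consider "r \<le> c + d" | "c + d \<le> l" | "l \<le> c + d" "c + d \<le> r" by linarith
  then show ?thesis
  proof cases
    case 1
    then show ?thesis by (intro smooth_cong[OF smooth_horizontal[of l r c]]) auto
  next
    case 2
    then show ?thesis by (intro smooth_cong[OF smooth_vertical[of l r d]]) auto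
  next
    case 3
    then have "smooth l r (\<lambda>s. if s \<le> c + d then s - c else d)"
      by (intro smooth_glue smooth_horizontal smooth_vertical) auto
    then show ?thesis by (rule smooth_cong) auto
  qed
qed

text \<open>A staircase that meets \<open>a\<close> at grid points at most \<open>e\<close> apart;
  between these both paths advance by at most \<open>e\<close>.\<close>

lemma smooth_approx:
  assumes a: "mpath a" and e: "0 < e" and "l \<le> r"
  shows "\<exists>b. mpath b \<and> smooth l r b \<and> b l = a l \<and> b r = a r \<and> (\<forall>s. l \<le> s \<longrightarrow> s \<le> r \<longrightarrow> \<bar>b s - a s\<bar> \<le> e)"
proof -
  have *: "\<exists>b. mpath b \<and> smooth l r b \<and> b l = a l \<and> b r = a r \<and> (\<forall>s. l \<le> s \<longrightarrow> s \<le> r \<longrightarrow> \<bar>b s - a s\<bar> \<le> e)"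
    if "l \<le> r" "r \<le> l + real k * e" for k r
    using that
  proof (induction k arbitrary: r)
    case 0
    then show ?case using e by (intro exI[of _ "\<lambda>s. a l"]) (auto intro: smooth_vertical)
  next
    case (Suc k)
    define c where "c = l + real k * e"
    show ?case
    proof (cases "r \<le> c")
      case True
      then show ?thesis using Suc by (simp add: c_def)
    next
      case False
      have c: "l \<le> c" "c \<le> r" "r - c \<le> e" using False Suc.prems e by (auto simp: c_def algebra_simps)
      obtain b where b: "mpath b" "smooth l c b" "b l = a l" "b c = a c"
        "\<And>s. l \<le> s \<Longrightarrow> s \<le> c \<Longrightarrow> \<bar>b s - a s\<bar> \<le> e"
        using Suc.IH[of c] c by (auto simp: c_def)
      \<comment> \<open>From the grid point at \<open>c\<close> this goes right to the first
        coordinate \<open>a r\<close> and then up.\<close>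
      let ?d = "\<lambda>s. min (s - (c - a c)) (a r)"
      have d: "mpath ?d" by (intro mpath_min) auto
      have ar: "a c \<le> a r" "a r - a c \<le> r - c" using mpathD[OF a c(2)] by auto
      have bd: "b c = ?d c" using b ar by simp
      let ?f = "\<lambda>s. if s \<le> c then b s else ?d s"
      have "\<bar>?f s - a s\<bar> \<le> e" if s: "l \<le> s" "s \<le> r" for s
      proof (cases "s \<le> c")
        case False
        then show ?thesis using mpathD[OF a, of c s] mpathD[OF a, of s r] c ar s by auto
      qed (use b s in auto)
      then show ?thesis using mpath_glue[OF b(1) d bd] smooth_glue[OF b(2) smooth_bend c(1,2) bd] b(3) c ar bd False
        by (intro exI[of _ ?f]) auto
    qed
  qed
  obtain k where "(r - l) / e \<le> real k" using real_arch_simple by blast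
  then have "r \<le> l + real k * e" using e by (simp add: field_simps)
  then show ?thesis using *[OF assms(3)] by blast
qed

text \<open>Time is rescaled linearly to the interval up to \<open>d\<close>:
  \<open>d = \<sigma>\<close> serves \<open>Gamma\<close>, and \<open>d = 1\<close> serves
  \<open>cdtw\<close>.\<close>

lemma smooth_params:
  assumes a: "mpath a" "a 0 = 0" "a \<sigma> = P.L" and s: "smooth 0 \<sigma> a" and d: "0 < d"
  shows "(\<lambda>t. P.Ac (a (\<sigma> / d * t))) piecewise_C1_differentiable_on {0..d}"
    "mono_on {0..d} (\<lambda>t. a (\<sigma> / d * t))" "(\<lambda>t. a (\<sigma> / d * t)) ` {0..d} = {0..P.L}"
    "\<And>t. t \<in> {0..d} \<Longrightarrow> P.Ac (a (\<sigma> / d * t)) = P.A (a (\<sigma> / d * t))"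
    "(\<lambda>t. Q.Ac (\<sigma> / d * t - a (\<sigma> / d * t))) piecewise_C1_differentiable_on {0..d}"
    "mono_on {0..d} (\<lambda>t. \<sigma> / d * t - a (\<sigma> / d * t))" "(\<lambda>t. \<sigma> / d * t - a (\<sigma> / d * t)) ` {0..d} = {0..Q.L}"
    "\<And>t. t \<in> {0..d} \<Longrightarrow> Q.Ac (\<sigma> / d * t - a (\<sigma> / d * t)) = Q.A (\<sigma> / d * t - a (\<sigma> / d * t))"
proof -
  have "times (\<sigma> / d) ` {0..d} = {\<sigma> / d * 0..\<sigma> / d * d}"
    using d \<sigma>_pos by (intro image_mult_atLeastAtMost) simp
  also have "\<dots> = {0..\<sigma>}" using d by simp
  finally have scale: "(\<lambda>t. \<sigma> / d * t) ` {0..d} = {0..\<sigma>}" .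
  have mem: "0 \<le> \<sigma> / d * t" "\<sigma> / d * t \<le> \<sigma>" if "t \<in> {0..d}" for t using scale that by (metis atLeastAtMost_iff imageI)+
  have le: "\<sigma> / d * t \<le> \<sigma> / d * t'" if "t \<le> t'" for t t' using that d \<sigma>_pos by (intro mult_left_mono) auto
  have r: "0 \<le> a s \<and> a s \<le> P.L \<and> 0 \<le> s - a s \<and> s - a s \<le> Q.L" if "0 \<le> s" "s \<le> \<sigma>" for s
    using mpathD[OF a(1) that(1)] mpathD[OF a(1) that(2)] a by auto
  show "(\<lambda>t. P.Ac (a (\<sigma> / d * t))) piecewise_C1_differentiable_on {0..d}"
    using piecewise_C1_differentiable_affine[of "\<lambda>s. P.Ac (a s)" "\<sigma> / d" 0 "{0..d}"] s scale
    by (simp add: smooth_def o_def)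
  show "(\<lambda>t. Q.Ac (\<sigma> / d * t - a (\<sigma> / d * t))) piecewise_C1_differentiable_on {0..d}"
    using piecewise_C1_differentiable_affine[of "\<lambda>s. Q.Ac (s - a s)" "\<sigma> / d" 0 "{0..d}"] s scale
    by (simp add: smooth_def o_def)
  show "mono_on {0..d} (\<lambda>t. a (\<sigma> / d * t))" by (intro mono_onI mpathD(1)[OF a(1)] le)
  show "mono_on {0..d} (\<lambda>t. \<sigma> / d * t - a (\<sigma> / d * t))"
    by (intro mono_onI mpathD(1)[OF mpath_flip[OF a(1)]] le)
  have im: "c ` {0..\<sigma>} = {0..C}" if "mpath c" "c 0 = 0" "c \<sigma> = C" for c C
  proof
    show "c ` {0..\<sigma>} \<subseteq> {0..C}"
      using mpathD(1)[OF that(1), of 0] mpathD(1)[OF that(1), of _ \<sigma>] that(2,3) by auto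
    show "{0..C} \<subseteq> c ` {0..\<sigma>}"
    proof
      fix y assume "y \<in> {0..C}"
      then have "\<exists>s\<ge>0. s \<le> \<sigma> \<and> c s = y"
        using that \<sigma>_pos by (intro IVT') (auto intro: mpath_continuous)
      then show "y \<in> c ` {0..\<sigma>}" by auto
    qed
  qed
  show "(\<lambda>t. a (\<sigma> / d * t)) ` {0..d} = {0..P.L}"
    using im[OF a] unfolding scale[symmetric] image_image .
  show "(\<lambda>t. \<sigma> / d * t - a (\<sigma> / d * t)) ` {0..d} = {0..Q.L}"
    using im[OF mpath_flip[OF a(1)], of Q.L] a unfolding scale[symmetric] image_image by simp
  show "P.Ac (a (\<sigma> / d * t)) = P.A (a (\<sigma> / d * t))" if "t \<in> {0..d}" for t
    using r[OF mem[OF that]] by (intro P.Ac_eq) auto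
  show "Q.Ac (\<sigma> / d * t - a (\<sigma> / d * t)) = Q.A (\<sigma> / d * t - a (\<sigma> / d * t))" if "t \<in> {0..d}" for t
    using r[OF mem[OF that]] by (intro Q.Ac_eq) auto
qed

subsection \<open>Optimal path costs and CDTW\<close>

text \<open>The integrals of the speeds give back the arc length coordinates, and unit total speed
  makes these add up to \<open>s\<close>.\<close>

lemma Gamma_mpath:
  assumes "\<gamma> \<in> Gamma N p n q m"
  obtains a where "mpath a" "\<And>s. 0 \<le> s \<Longrightarrow> s \<le> \<sigma> \<Longrightarrow> \<gamma> s = (a s, s - a s)"
proof -
  obtain f g X where f: "f \<in> monotone_params N p n 0 \<sigma>" and g: "g \<in> monotone_params N q m 0 \<sigma>"
    and \<gamma>: "\<And>s. s \<in> {0..\<sigma>} \<Longrightarrow> \<gamma> s = (integral {0..s} (speed N 0 \<sigma> f), integral {0..s} (speed N 0 \<sigma> g))"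
    and X: "finite X" "\<And>s. s \<in> {0..\<sigma>} - X \<Longrightarrow> speed N 0 \<sigma> f s + speed N 0 \<sigma> g s = 1"
    using assms unfolding Gamma_def Let_def by blast
  obtain \<phi> where \<phi>: "f piecewise_C1_differentiable_on {0..\<sigma>}" "mono_on {0..\<sigma>} \<phi>" "\<phi> ` {0..\<sigma>} = {0..P.L}"
    "\<And>t. t \<in> {0..\<sigma>} \<Longrightarrow> f t = P.A (\<phi> t)"
    using f unfolding monotone_params_def by blast
  obtain \<psi> where \<psi>: "g piecewise_C1_differentiable_on {0..\<sigma>}" "mono_on {0..\<sigma>} \<psi>" "\<psi> ` {0..\<sigma>} = {0..Q.L}"
    "\<And>t. t \<in> {0..\<sigma>} \<Longrightarrow> g t = Q.A (\<psi> t)"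
    using g unfolding monotone_params_def by blast
  have I: "(speed N 0 \<sigma> f has_integral \<phi> s) {0..s}" "(speed N 0 \<sigma> g has_integral \<psi> s) {0..s}"
    if "0 \<le> s" "s \<le> \<sigma>" for s
    using P.speed_integral[OF \<sigma>_pos \<phi> that] Q.speed_integral[OF \<sigma>_pos \<psi> that] by auto
  have sum: "\<phi> s + \<psi> s = s" if s: "0 \<le> s" "s \<le> \<sigma>" for s
  proof -
    have "((\<lambda>t. 1::real) has_integral \<phi> s + \<psi> s) {0..s}"
      by (rule has_integral_spike_finite[OF X(1) _ has_integral_add[OF I[OF s]]]) (use X(2) s in auto)
    moreover have "((\<lambda>t. 1::real) has_integral s) {0..s}"
      using has_integral_const_real[of "1::real" 0 s] s by simp
    ultimately show ?thesis by (rule has_integral_unique)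
  qed
  \<comment> \<open>Clamping time extends the first coordinate to a path on the whole line.\<close>
  define c where "c s = max 0 (min \<sigma> s)" for s
  define a where "a s = \<phi> (c s)" for s
  have c: "c s \<in> {0..\<sigma>}" "s \<le> s' \<Longrightarrow> c s \<le> c s'" "s \<le> s' \<Longrightarrow> c s' - c s \<le> s' - s" for s s'
    using \<sigma>_pos by (auto simp: c_def)
  show ?thesis
  proof
    show "mpath a"
    proof (rule mpathI)
      fix s s' :: real assume s: "s \<le> s'"
      show "a s \<le> a s'" unfolding a_def by (rule mono_onD[OF \<phi>(2) c(1) c(1) c(2)[OF s]])
      have "\<psi> (c s) \<le> \<psi> (c s')" by (rule mono_onD[OF \<psi>(2) c(1) c(1) c(2)[OF s]])
      then show "a s' - a s \<le> s' - s"
        using sum[of "c s"] sum[of "c s'"] c(1)[of s] c(1)[of s'] c(3)[OF s] by (simp add: a_def)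
    qed
    show "\<gamma> s = (a s, s - a s)" if s: "0 \<le> s" "s \<le> \<sigma>" for s
      using \<gamma>[of s] I[OF s, THEN integral_unique] sum[OF s] s by (auto simp: a_def c_def)
  qed
qed

lemma smooth_Gamma:
  assumes a: "mpath a" "a 0 = 0" "a \<sigma> = P.L" and s: "smooth 0 \<sigma> a"
  shows "(\<lambda>s. (a s, s - a s)) \<in> Gamma N p n q m"
proof -
  let ?f = "\<lambda>s. P.Ac (a s)" and ?g = "\<lambda>s. Q.Ac (s - a s)"
  note par = smooth_params[OF a s \<sigma>_pos]
  have one: "\<sigma> / \<sigma> * t = t" for t using \<sigma>_pos by simp
  note f = par(1-4)[unfolded one] and g = par(5-8)[unfolded one]
  have fm: "?f \<in> monotone_params N p n 0 \<sigma>"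
    unfolding monotone_params_def using f by blast
  have gm: "?g \<in> monotone_params N q m 0 \<sigma>"
    unfolding monotone_params_def using g by blast
  have int: "integral {0..s} (speed N 0 \<sigma> ?f) = a s" "integral {0..s} (speed N 0 \<sigma> ?g) = s - a s"
    if "s \<in> {0..\<sigma>}" for s
    using P.speed_integral[OF \<sigma>_pos f] Q.speed_integral[OF \<sigma>_pos g] that by (auto intro!: integral_unique)
  obtain X where X: "finite X" "0 \<in> X" "\<sigma> \<in> X" "\<And>t. t \<in> {0..\<sigma>} - X \<Longrightarrow> (a has_real_derivative speed N 0 \<sigma> ?f t) (at t)"
    using P.coordinate_derivative[OF \<sigma>_pos f] by blast
  obtain Y where Y: "finite Y" "\<And>t. t \<in> {0..\<sigma>} - Y \<Longrightarrow> ((\<lambda>s. s - a s) has_real_derivative speed N 0 \<sigma> ?g t) (at t)"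
    using Q.coordinate_derivative[OF \<sigma>_pos g] by blast
  have "norm1 (vector_derivative (\<lambda>s. (a s, s - a s)) (at s within {0..\<sigma>})) = speed N 0 \<sigma> ?f s + speed N 0 \<sigma> ?g s \<and>
      speed N 0 \<sigma> ?f s + speed N 0 \<sigma> ?g s = 1" if s: "s \<in> {0..\<sigma>} - (X \<union> Y)" for s
  proof
    have d: "(a has_real_derivative speed N 0 \<sigma> ?f s) (at s)" "((\<lambda>s. s - a s) has_real_derivative speed N 0 \<sigma> ?g s) (at s)"
      using X(4)[of s] Y(2)[of s] s by auto
    \<comment> \<open>The coordinates add up to \<open>s\<close>, so the speeds add up to 1.\<close>
    have "((\<lambda>s. a s + (s - a s)) has_real_derivative speed N 0 \<sigma> ?f s + speed N 0 \<sigma> ?g s) (at s)"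
      by (rule DERIV_add[OF d])
    then have "((\<lambda>s. s) has_real_derivative speed N 0 \<sigma> ?f s + speed N 0 \<sigma> ?g s) (at s)" by simp
    then show "speed N 0 \<sigma> ?f s + speed N 0 \<sigma> ?g s = 1" by (rule DERIV_unique) (rule DERIV_ident)
    have "((\<lambda>s. (a s, s - a s)) has_vector_derivative (speed N 0 \<sigma> ?f s, speed N 0 \<sigma> ?g s)) (at s)"
      using d unfolding has_real_derivative_iff_has_vector_derivative by (rule has_vector_derivative_Pair)
    then have "vector_derivative (\<lambda>s. (a s, s - a s)) (at s within {0..\<sigma>}) = (speed N 0 \<sigma> ?f s, speed N 0 \<sigma> ?g s)"
      using s \<sigma>_pos by (intro vector_derivative_at_within_ivl) auto
    then show "norm1 (vector_derivative (\<lambda>s. (a s, s - a s)) (at s within {0..\<sigma>})) = speed N 0 \<sigma> ?f s + speed N 0 \<sigma> ?g s"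
      by (simp add: norm1_def speed_def is_norm_nonneg[OF P.N])
  qed
  moreover have "(\<lambda>s. (a s, s - a s)) \<in> {0..\<sigma>} \<rightarrow> {0..P.L} \<times> {0..Q.L}"
    using f(3) g(3) by blast
  moreover have "finite (X \<union> Y)" using X(1) Y(1) by simp
  ultimately show ?thesis
    unfolding Gamma_def Let_def using int
    by (intro CollectI conjI bexI[OF _ fm] bexI[OF _ gm] exI[of _ "X \<union> Y"] ballI) simp_all
qed

text \<open>Members of \<open>Gamma\<close> cross the whole parameter space. The staircase from
  \<open>x\<close> to \<open>y\<close> is therefore preceded by a path from the origin and followed
  by one to the opposite corner, each going right and then up.\<close>

lemma path_extend:
  assumes x: "0 \<le> x1" "0 \<le> x2" "x1 \<le> y1" "x2 \<le> y2" "y1 \<le> P.L" "y2 \<le> Q.L"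
    and a: "mpath a" "a (x1 + x2) = x1" "a (y1 + y2) = y1" and e: "0 < e"
  obtains b where "mpath b" "smooth 0 \<sigma> b" "b 0 = 0" "b \<sigma> = P.L" "b (x1 + x2) = x1" "b (y1 + y2) = y1"
    "\<And>s. x1 + x2 \<le> s \<Longrightarrow> s \<le> y1 + y2 \<Longrightarrow> \<bar>b s - a s\<bar> \<le> e"
proof -
  obtain b where b: "mpath b" "smooth (x1 + x2) (y1 + y2) b" "b (x1 + x2) = x1" "b (y1 + y2) = y1"
    "\<And>s. x1 + x2 \<le> s \<Longrightarrow> s \<le> y1 + y2 \<Longrightarrow> \<bar>b s - a s\<bar> \<le> e"
    using smooth_approx[OF a(1) e, of "x1 + x2" "y1 + y2"] a x by auto
  let ?s = "\<lambda>s. min (s - 0) x1" and ?t = "\<lambda>s. min (s - y2) P.L"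
  let ?c = "\<lambda>s. if s \<le> y1 + y2 then b s else ?t s"
  let ?d = "\<lambda>s. if s \<le> x1 + x2 then ?s s else ?c s"
  have st: "mpath ?s" "mpath ?t" by (rule mpath_min[OF mpath_shift mpath_const])+
  have eq: "b (y1 + y2) = ?t (y1 + y2)" using b x by simp
  have eq': "?s (x1 + x2) = ?c (x1 + x2)" using b x by auto
  have c: "mpath ?c" "smooth (x1 + x2) \<sigma> ?c"
    using x by (intro mpath_glue[OF b(1) st(2) eq] smooth_glue[OF b(2) smooth_bend _ _ eq]; simp)+
  have d: "mpath ?d" "smooth 0 \<sigma> ?d"
    using x by (intro mpath_glue[OF st(1) c(1) eq'] smooth_glue[OF smooth_bend c(2) _ _ eq']; simp)+
  show ?thesis
  proof (rule that[of ?d])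
    show "?d 0 = 0" using x by auto
    show "?d \<sigma> = P.L"
    proof (cases "\<sigma> \<le> y1 + y2")
      case True
      then have "y1 = P.L" "y2 = Q.L" using x by auto
      then show ?thesis using eq eq' b x by auto
    qed (use x in auto)
    show "?d (x1 + x2) = x1" "?d (y1 + y2) = y1" using b x by auto
    show "\<bar>?d s - a s\<bar> \<le> e" if "x1 + x2 \<le> s" "s \<le> y1 + y2" for s
      using b(5)[OF that] b(3) that x by (cases "s = x1 + x2") auto
  qed (rule d)+
qed

text \<open>Members of \<open>Gamma\<close> are monotone paths, and every monotone path is
  approximated by members of \<open>Gamma\<close> at arbitrarily small extra cost; hence the infima
  agree.\<close>

lemma opt_eq:
  assumes x: "0 \<le> x1" "0 \<le> x2" "x1 \<le> y1" "x2 \<le> y2" "y1 \<le> P.L" "y2 \<le> Q.L"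
  shows "opt N p n q m (x1, x2) (y1, y2) = H.D (x1, x2) (y1, y2)"
proof -
  let ?l = "x1 + x2" and ?r = "y1 + y2"
  let ?paths = "paths N p n q m (x1, x2) (y1, y2)" and ?cost = "path_cost N p q (x1, x2) (y1, y2)"
  have n1: "norm1 (x1, x2) = ?l" "norm1 (y1, y2) = ?r" using x by (auto simp: norm1_def)
  have cost: "?cost (restrict \<gamma> {?l..?r}) = H.K a ?l ?r"
    if a: "mpath a" "a ?l = x1" "a ?r = y1" and \<gamma>: "\<And>s. ?l \<le> s \<Longrightarrow> s \<le> ?r \<Longrightarrow> \<gamma> s = (a s, s - a s)" for \<gamma> a
    unfolding path_cost_def n1 cost_def
  proof (rule integral_cong)
    fix s assume s: "s \<in> {?l..?r}"
    then have "0 \<le> a s" "a s \<le> P.L" "0 \<le> s - a s" "s - a s \<le> Q.L"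
      using mpathD[OF a(1), of ?l s] mpathD[OF a(1), of s ?r] a x by auto
    then show "N (P.A (fst (restrict \<gamma> {?l..?r} s)) - Q.A (snd (restrict \<gamma> {?l..?r} s))) = hgt (a s) (s - a s)"
      using s \<gamma>[of s] by (simp add: hgt_def P.Ac_eq Q.Ac_eq)
  qed
  have ge: "H.D (x1, x2) (y1, y2) \<le> ?cost \<eta>" if \<eta>: "\<eta> \<in> ?paths" for \<eta>
  proof -
    obtain \<gamma> where \<gamma>: "\<eta> = restrict \<gamma> {?l..?r}" "\<gamma> \<in> Gamma N p n q m" "\<gamma> ?l = (x1, x2)" "\<gamma> ?r = (y1, y2)"
      using \<eta> unfolding paths_def n1 by blast
    obtain a where a: "mpath a" "\<And>s. 0 \<le> s \<Longrightarrow> s \<le> \<sigma> \<Longrightarrow> \<gamma> s = (a s, s - a s)"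
      using Gamma_mpath[OF \<gamma>(2)] by blast
    have ends: "a ?l = x1" "a ?r = y1" using a(2)[of ?l] a(2)[of ?r] \<gamma>(3,4) x by auto
    have "?cost \<eta> = H.K a ?l ?r" unfolding \<gamma>(1) using a x by (intro cost ends) auto
    then show ?thesis using H.D_le[OF a(1) ends] by simp
  qed
  have bdd: "bdd_below (?cost ` ?paths)" using ge by (intro bdd_belowI[of _ "H.D (x1, x2) (y1, y2)"]) auto
  have smooth_path: "\<exists>\<eta>\<in>?paths. ?cost \<eta> \<le> H.K a ?l ?r + 2 * e * (?r - ?l)"
    if a: "mpath a" "a ?l = x1" "a ?r = y1" and e: "0 < e" for a e
  proof -
    obtain b where b: "mpath b" "smooth 0 \<sigma> b" "b 0 = 0" "b \<sigma> = P.L" "b ?l = x1" "b ?r = y1"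
      "\<And>s. ?l \<le> s \<Longrightarrow> s \<le> ?r \<Longrightarrow> \<bar>b s - a s\<bar> \<le> e"
      using path_extend[OF x a e] by blast
    let ?\<gamma> = "\<lambda>s. (b s, s - b s)"
    have "restrict ?\<gamma> {?l..?r} \<in> ?paths"
      unfolding paths_def n1 using smooth_Gamma[OF b(1,3,4,2)] b x by (intro CollectI exI[of _ ?\<gamma>]) auto
    moreover have "?cost (restrict ?\<gamma> {?l..?r}) \<le> H.K a ?l ?r + 2 * e * (?r - ?l)"
      using cost[OF b(1,5,6), of ?\<gamma>] H.K_le_close[OF b(1) a(1) _ b(7)] x by simp
    ultimately show ?thesis by blast
  qed
  obtain a where a: "a \<in> mpaths (x1, x2) (y1, y2)" using mpaths_nonempty[OF x(3,4)] by blast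
  have "?paths \<noteq> {}" using smooth_path[OF mpathsD[OF a] zero_less_one] by blast
  then have "H.D (x1, x2) (y1, y2) \<le> opt N p n q m (x1, x2) (y1, y2)"
    unfolding opt_def by (intro cINF_greatest ge)
  moreover have "opt N p n q m (x1, x2) (y1, y2) \<le> H.D (x1, x2) (y1, y2)"
  proof (rule H.D_ge[OF x(3,4)])
    fix a assume a: "mpath a" "a ?l = x1" "a ?r = y1"
    show "opt N p n q m (x1, x2) (y1, y2) \<le> H.K a ?l ?r"
    proof (rule field_le_epsilon)
      fix e :: real assume "0 < e"
      \<comment> \<open>The summand 1 avoids division by zero when the endpoints coincide.\<close>
      define e' where "e' = e / (2 * (?r - ?l + 1))"
      have e': "0 < e'" "2 * e' * (?r - ?l) \<le> e" using \<open>0 < e\<close> x by (auto simp: e'_def field_simps)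
      obtain \<eta> where "\<eta> \<in> ?paths" "?cost \<eta> \<le> H.K a ?l ?r + 2 * e' * (?r - ?l)"
        using smooth_path[OF a e'(1)] by blast
      then show "opt N p n q m (x1, x2) (y1, y2) \<le> H.K a ?l ?r + e"
        using cINF_lower[OF bdd, of \<eta>] e'(2) unfolding opt_def by simp
    qed
  qed
  ultimately show ?thesis by simp
qed

text \<open>For each coordinate sum some time \<open>T s\<close> is chosen; the path does not depend
  on the choice, because times with equal sums have equal coordinates. Both parametrisations may
  pause together.\<close>

lemma params_mpath:
  fixes \<phi> \<psi> :: "real \<Rightarrow> real"
  assumes "a < b" and f: "mono_on {a..b} \<phi>" "\<phi> ` {a..b} = {0..P.L}" and g: "mono_on {a..b} \<psi>" "\<psi> ` {a..b} = {0..Q.L}"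
  obtains c where "mpath c" "\<And>t. t \<in> {a..b} \<Longrightarrow> c (\<phi> t + \<psi> t) = \<phi> t" "c 0 = 0" "c \<sigma> = P.L"
proof -
  have ab: "a \<le> b" using assms(1) by simp
  note \<phi> = mono_on_image_continuous[OF ab f] and \<psi> = mono_on_image_continuous[OF ab g]
  define r where "r s = max 0 (min \<sigma> s)" for s
  have r: "r s \<in> {0..\<sigma>}" "s \<le> s' \<Longrightarrow> r s \<le> r s'" "s \<le> s' \<Longrightarrow> r s' - r s \<le> s' - s" for s s'
    using \<sigma>_pos by (auto simp: r_def)
  have "\<exists>t. t \<in> {a..b} \<and> \<phi> t + \<psi> t = r s" for s
    using IVT'[of "\<lambda>t. \<phi> t + \<psi> t" a "r s" b] \<phi> \<psi> r(1)[of s] ab by (auto intro: continuous_on_add)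
  then obtain T where T: "\<And>s. T s \<in> {a..b}" "\<And>s. \<phi> (T s) + \<psi> (T s) = r s" by metis
  have mono: "\<phi> t \<le> \<phi> t' \<and> \<psi> t \<le> \<psi> t'" if "t \<in> {a..b}" "t' \<in> {a..b}" "\<phi> t + \<psi> t \<le> \<phi> t' + \<psi> t'" for t t'
  proof (cases "t \<le> t'")
    case False
    then show ?thesis using mono_onD[OF f(1) that(2,1)] mono_onD[OF g(1) that(2,1)] that(3) by auto
  qed (use mono_onD[OF f(1) that(1,2)] mono_onD[OF g(1) that(1,2)] in auto)
  define c where "c s = \<phi> (T s)" for s
  have c: "c (\<phi> t + \<psi> t) = \<phi> t" if t: "t \<in> {a..b}" for t
  proof -
    have "r (\<phi> t + \<psi> t) = \<phi> t + \<psi> t"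
      using mono_on_mem[OF f(2) t] mono_on_mem[OF g(2) t] by (auto simp: r_def)
    then show ?thesis using mono[OF T(1) t, of "\<phi> t + \<psi> t"] mono[OF t T(1), of "\<phi> t + \<psi> t"] T(2)[of "\<phi> t + \<psi> t"]
      by (simp add: c_def)
  qed
  show ?thesis
  proof (rule that[OF _ c])
    show "mpath c"
    proof (rule mpathI)
      fix s s' :: real assume s: "s \<le> s'"
      have *: "\<phi> (T s) \<le> \<phi> (T s') \<and> \<psi> (T s) \<le> \<psi> (T s')"
        using r(2)[OF s] by (intro mono T(1)) (simp add: T(2))
      then show "c s \<le> c s'" by (simp add: c_def)
      show "c s' - c s \<le> s' - s" using * T(2)[of s] T(2)[of s'] r(3)[OF s] by (simp add: c_def)
    qed
    show "c 0 = 0" using c[of a] \<phi> \<psi> ab by simp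
    show "c \<sigma> = P.L" using c[of b] \<phi> \<psi> ab by simp
  qed
qed

text \<open>Pairs of parametrisations trace monotone paths of the same cost, and staircases give
  pairs arbitrarily close to any monotone path.\<close>

lemma cdtw_eq: "cdtw N p n q m = H.D (0, 0) (P.L, Q.L)"
proof -
  let ?c = "\<lambda>(f, g). integral {0..1} (\<lambda>t. N (f t - g t) * (speed N 0 1 f t + speed N 0 1 g t))"
  let ?S = "monotone_params N p n 0 1 \<times> monotone_params N q m 0 1"
  have ge: "H.D (0, 0) (P.L, Q.L) \<le> ?c z" if z: "z \<in> ?S" for z
  proof -
    obtain f g where fg: "z = (f, g)" "f \<in> monotone_params N p n 0 1" "g \<in> monotone_params N q m 0 1" using z by blast
    obtain \<phi> where \<phi>: "f piecewise_C1_differentiable_on {0..1}" "mono_on {0..1} \<phi>" "\<phi> ` {0..1} = {0..P.L}"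
      "\<And>t. t \<in> {0..1} \<Longrightarrow> f t = P.A (\<phi> t)"
      using fg(2) unfolding monotone_params_def by blast
    obtain \<psi> where \<psi>: "g piecewise_C1_differentiable_on {0..1}" "mono_on {0..1} \<psi>" "\<psi> ` {0..1} = {0..Q.L}"
      "\<And>t. t \<in> {0..1} \<Longrightarrow> g t = Q.A (\<psi> t)"
      using fg(3) unfolding monotone_params_def by blast
    obtain c where c: "mpath c" "\<And>t. t \<in> {0..1} \<Longrightarrow> c (\<phi> t + \<psi> t) = \<phi> t" "c 0 = 0" "c \<sigma> = P.L"
      using params_mpath[OF zero_less_one \<phi>(2,3) \<psi>(2,3)] by blast
    have "?c z = H.K c 0 \<sigma>"
      unfolding fg(1) prod.case by (rule param_pair_integral[OF zero_less_one \<phi> \<psi> c(1,2)])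
    then show ?thesis using H.D_le[of c 0 0 P.L Q.L] c by simp
  qed
  have bdd: "bdd_below (?c ` ?S)" using ge by (intro bdd_belowI[of _ "H.D (0, 0) (P.L, Q.L)"]) blast
  have smooth_pair: "\<exists>z\<in>?S. ?c z \<le> H.K a 0 \<sigma> + 2 * e * \<sigma>"
    if a: "mpath a" "a (0 + 0) = 0" "a \<sigma> = P.L" and e: "0 < e" for a e
  proof -
    obtain b where b: "mpath b" "smooth 0 \<sigma> b" "b 0 = 0" "b \<sigma> = P.L"
      "\<And>s. 0 + 0 \<le> s \<Longrightarrow> s \<le> \<sigma> \<Longrightarrow> \<bar>b s - a s\<bar> \<le> e"
      using path_extend[of 0 0 P.L Q.L a e] a e P.L_pos Q.L_pos by auto
    note par = smooth_params[OF b(1,3,4,2) zero_less_one]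
    let ?z = "(\<lambda>t. P.Ac (b (\<sigma> / 1 * t)), \<lambda>t. Q.Ac (\<sigma> / 1 * t - b (\<sigma> / 1 * t)))"
    have "?z \<in> ?S" unfolding monotone_params_def using par by blast
    moreover have "?c ?z = H.K b 0 \<sigma>"
      unfolding prod.case by (rule param_pair_integral[OF zero_less_one par b(1)]) auto
    moreover have "H.K b 0 \<sigma> \<le> H.K a 0 \<sigma> + 2 * e * (\<sigma> - 0)"
      by (rule H.K_le_close[OF b(1) a(1)]) (use b(5) \<sigma>_pos in auto)
    ultimately show ?thesis by (intro bexI[of _ ?z]) auto
  qed
  obtain a where a: "a \<in> mpaths (0, 0) (P.L, Q.L)"
    using mpaths_nonempty[of 0 P.L 0 Q.L] P.L_pos Q.L_pos by auto
  have "?S \<noteq> {}" using smooth_pair[OF mpathsD[OF a] zero_less_one] by blast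
  then have "H.D (0, 0) (P.L, Q.L) \<le> cdtw N p n q m"
    unfolding cdtw_def by (intro cINF_greatest ge)
  moreover have "cdtw N p n q m \<le> H.D (0, 0) (P.L, Q.L)"
  proof (rule H.D_ge)
    fix a assume a: "mpath a" "a (0 + 0) = 0" "a \<sigma> = P.L"
    show "cdtw N p n q m \<le> H.K a (0 + 0) \<sigma>"
    proof (rule field_le_epsilon)
      fix e :: real assume "0 < e"
      then obtain z where "z \<in> ?S" "?c z \<le> H.K a 0 \<sigma> + 2 * (e / (2 * \<sigma>)) * \<sigma>"
        using smooth_pair[OF a, of "e / (2 * \<sigma>)"] \<sigma>_pos by auto
      moreover have "2 * (e / (2 * x)) * x = e" if "0 < x" for x :: real using that by simp
      note this[OF \<sigma>_pos]
      ultimately show "cdtw N p n q m \<le> H.K a (0 + 0) \<sigma> + e"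
        using cINF_lower[OF bdd, of z] unfolding cdtw_def by simp
    qed
  qed (use P.L_pos Q.L_pos in auto)
  ultimately show ?thesis by simp
qed

end

section \<open>Correctness of the propagation algorithm\<close>

lemma arg_min_on_cong:
  assumes "is_arg_min f (\<lambda>s. s \<in> S) s" "\<And>s. s \<in> S \<Longrightarrow> f s = g s"
  shows "is_arg_min g (\<lambda>s. s \<in> S) s"
  using assms by (auto simp: is_arg_min_def)

lemma arg_min_INF:
  fixes f :: "real \<Rightarrow> real"
  assumes "is_arg_min f (\<lambda>s. s \<in> S) s"
  shows "(INF s\<in>S. f s) = f s"
  using assms by (intro cInf_eq_minimum) (auto simp: is_arg_min_linorder)

context curves
begin

text \<open>The offset is the difference of the two supporting lines at arc length 0, so
  \<open>G\<close> takes arc lengths measured from the start of the curves.\<close>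

lemma cell_hgt:
  assumes i: "1 \<le> i" "i \<le> n" and j: "1 \<le> j" "j \<le> m"
  shows "cell hgt (hgt 0 0 + P.L + Q.L) N (P.dir i) (Q.dir j)
    (p (i - 1) - P.l (i - 1) *\<^sub>R P.dir i - (q (j - 1) - Q.l (j - 1) *\<^sub>R Q.dir j))
    (P.l (i - 1)) (P.l i) (Q.l (j - 1)) (Q.l j)"
proof -
  interpret A: affine_height N "P.dir i" "Q.dir j"
    "p (i - 1) - P.l (i - 1) *\<^sub>R P.dir i - (q (j - 1) - Q.l (j - 1) *\<^sub>R Q.dir j)"
    by unfold_locales (rule P.N P.N_dir[OF i] Q.N_dir[OF j])+
  show ?thesis
  proof unfold_locales
    show "P.l (i - 1) \<le> P.l i" "Q.l (j - 1) \<le> Q.l j" by (auto intro: P.l_mono Q.l_mono)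
    fix x y assume x: "P.l (i - 1) \<le> x" "x \<le> P.l i" and y: "Q.l (j - 1) \<le> y" "y \<le> Q.l j"
    have "0 \<le> x" "x \<le> P.L" "0 \<le> y" "y \<le> Q.L"
      using x y P.l_mono[of 0 "i - 1"] P.l_mono[OF i(2)] Q.l_mono[of 0 "j - 1"] Q.l_mono[OF j(2)] by auto
    then have "hgt x y = N (P.A x - Q.A y)" by (simp add: hgt_def P.Ac_eq Q.Ac_eq)
    also have "\<dots> = A.G x y"
      unfolding A.G_def P.A_segment[OF i x] Q.A_segment[OF j y] by (rule arg_cong[of _ _ N]) (simp add: algebra_simps)
    finally show "hgt x y = A.G x y" .
  qed
qed

text \<open>All points involved lie in the parameter space, where \<open>opt\<close> is
  \<open>H.D\<close>. The corner value is identified with the end value of both new borders, because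
  the neighbouring cells use it as such.\<close>

lemma process_cell_inv:
  assumes i: "Suc i \<le> n" and j: "Suc j \<le> m" and sel: "minimiser_rule sel"
    and S: "border_inv H.D (\<lambda>t. (t, Q.l j)) (P.l i) (P.l (Suc i)) FS" and hSE: "hSE = FS (P.l (Suc i))"
    and W: "border_inv H.D (\<lambda>t. (P.l i, t)) (Q.l j) (Q.l (Suc j)) FW" and hNW: "hNW = FW (Q.l (Suc j))"
  defines "r \<equiv> process_cell N sel p n q m (Suc i) (Suc j) FS FW hNW hSE"
  shows "border_inv H.D (\<lambda>t. (t, Q.l (Suc j))) (P.l i) (P.l (Suc i)) (north_apx r)"
    "corner_val r = north_apx r (P.l (Suc i))"
    "border_inv H.D (\<lambda>t. (P.l (Suc i), t)) (Q.l j) (Q.l (Suc j)) (east_apx r)"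
    "corner_val r = east_apx r (Q.l (Suc j))"
proof -
  define x0 x1 y0 y1 where xy: "x0 = P.l i" "x1 = P.l (Suc i)" "y0 = Q.l j" "y1 = Q.l (Suc j)"
  have bnd: "0 \<le> x0" "x0 \<le> x1" "x1 \<le> P.L" "0 \<le> y0" "y0 \<le> y1" "y1 \<le> Q.L"
    unfolding xy using P.l_mono[of 0 i] P.l_mono[of i "Suc i"] P.l_mono[OF i]
      Q.l_mono[of 0 j] Q.l_mono[of j "Suc j"] Q.l_mono[OF j] by auto
  note S = S[folded xy] and W = W[folded xy] and hSE = hSE[folded xy] and hNW = hNW[folded xy]
  from cell_hgt[of "Suc i" "Suc j"] i j obtain u v w where C: "cell hgt (hgt 0 0 + P.L + Q.L) N u v w x0 x1 y0 y1"
    unfolding xy by auto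
  interpret C: cell hgt "hgt 0 0 + P.L + Q.L" N u v w x0 x1 y0 y1 by (rule C)
  interpret F: cell "\<lambda>x y. hgt y x" "hgt 0 0 + P.L + Q.L" N v u "- w" y0 y1 x0 x1 by (rule C.cell_flip)
  note W' = W[folded border_inv_flip(2)[of hgt]] and S' = S[folded border_inv_flip(1)[of hgt]]
  let ?o = "opt N p n q m"
  have opt: "?o (a, b) (c, d) = H.D (a, b) (c, d)" if "x0 \<le> a" "y0 \<le> b" "a \<le> c" "b \<le> d" "c \<le> x1" "d \<le> y1" for a b c d
    using that bnd by (intro opt_eq) auto
  define fS where "fS s = FS s + ?o (s, y0) (x1, y1)" for s
  define fW where "fW s = FW s + ?o (x0, s) (x1, y1)" for s
  define sS where "sS = sel South (Suc i) (Suc j) {x0..x1} fS"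
  define sW where "sW = sel West (Suc i) (Suc j) {y0..y1} fW"
  have fS: "fS s = FS s + H.D (s, y0) (x1, y1)" if "s \<in> {x0..x1}" for s
    using that bnd by (simp add: fS_def opt)
  have fW: "fW s = FW s + H.D (x0, s) (x1, y1)" if "s \<in> {y0..y1}" for s
    using that bnd by (simp add: fW_def opt)
  have minS: "is_arg_min fS (\<lambda>s. s \<in> {x0..x1}) sS"
  proof -
    obtain s where "is_arg_min (\<lambda>s. FS s + H.D (s, y0) (x1, y1)) (\<lambda>s. s \<in> {x0..x1}) s"
      using C.south_attains[OF S] by blast
    then have "is_arg_min fS (\<lambda>s. s \<in> {x0..x1}) s" by (rule arg_min_on_cong) (simp only: fS)
    then show ?thesis using sel unfolding minimiser_rule_def sS_def by blast
  qed
  have minW: "is_arg_min fW (\<lambda>s. s \<in> {y0..y1}) sW"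
  proof -
    obtain s where "is_arg_min (\<lambda>s. FW s + F.D (s, x0) (y1, x1)) (\<lambda>s. s \<in> {y0..y1}) s"
      using F.south_attains[OF W'] by blast
    then have "is_arg_min fW (\<lambda>s. s \<in> {y0..y1}) s"
      by (rule arg_min_on_cong) (simp only: fW mincost_flip[of hgt])
    then show ?thesis using sel unfolding minimiser_rule_def sW_def by blast
  qed
  have sS: "x0 \<le> sS" "sS \<le> x1" "\<forall>s\<in>{x0..x1}. fS sS \<le> FS s + H.D (s, y0) (x1, y1)"
    "fS sS = FS sS + H.D (sS, y0) (x1, y1)"
    using minS fS by (auto simp: is_arg_min_linorder)
  have sW: "y0 \<le> sW" "sW \<le> y1" "\<forall>s\<in>{y0..y1}. fW sW \<le> FW s + H.D (x0, s) (x1, y1)"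
    "fW sW = FW sW + H.D (x0, sW) (x1, y1)"
    using minW fW by (auto simp: is_arg_min_linorder)
  define Nf where "Nf t = (if fS sS < fW sW
      then min (min (FW y1 + H.D (x0, y1) (t, y1)) (FW sW + H.D (x0, sW) (t, y1)))
        (INF s\<in>{s\<in>{x0..x1}. s \<le> sS \<and> s \<le> t}. FS s + H.D (s, y0) (t, y1))
      else min (FW y1 + H.D (x0, y1) (t, y1)) (FW sW + H.D (x0, sW) (t, y1)))" for t
  define Ef where "Ef t = (if fW sW < fS sS
      then min (min (FS x1 + H.D (x1, y0) (x1, t)) (FS sS + H.D (sS, y0) (x1, t)))
        (INF s\<in>{s\<in>{y0..y1}. s \<le> sW \<and> s \<le> t}. FW s + H.D (x0, s) (x1, t))
      else min (FS x1 + H.D (x1, y0) (x1, t)) (FS sS + H.D (sS, y0) (x1, t)))" for t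
  note north_step = C.north_step[OF bnd(1,4) S W sS sW]
  have N: "border_inv H.D (\<lambda>t. (t, y1)) x0 x1 Nf" "Nf x1 = min (fS sS) (fW sW)"
    using north_step unfolding Nf_def[abs_def] .
  \<comment> \<open>In the reflected cell the west border plays the part of the south
    border.\<close>
  note east_step = F.north_step[OF bnd(4,1) W' S', unfolded mincost_flip[of hgt] border_inv_flip[of hgt], OF sW sS]
  have E: "border_inv H.D (\<lambda>t. (x1, t)) y0 y1 Ef" "Ef y1 = min (fW sW) (fS sS)"
    using east_step unfolding Ef_def[abs_def] .
  have INF: "(INF s\<in>{x0..x1}. FS s + ?o (s, y0) (x1, y1)) = fS sS" "(INF s\<in>{y0..y1}. FW s + ?o (x0, s) (x1, y1)) = fW sW"
    using arg_min_INF[OF minS] arg_min_INF[OF minW] by (simp_all only: fS_def fW_def)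
  have sel_eq: "sel South (Suc i) (Suc j) {x0..x1} (\<lambda>s. FS s + ?o (s, y0) (x1, y1)) = sS"
    "sel West (Suc i) (Suc j) {y0..y1} (\<lambda>s. FW s + ?o (x0, s) (x1, y1)) = sW"
    by (simp_all only: sS_def sW_def fS_def[abs_def] fW_def[abs_def])
  note r_eq = r_def[unfolded process_cell_def Let_def diff_Suc_1 xy[symmetric] INF sel_eq hSE hNW]
  have corner: "corner_val r = min (fS sS) (fW sW)" unfolding r_eq by (simp only: cell_data.select_convs)
  have north: "Nf t = north_apx r t" if t: "x0 \<le> t" "t \<le> x1" for t
  proof -
    have 1: "?o (x0, s) (t, y1) = H.D (x0, s) (t, y1)" if "y0 \<le> s" "s \<le> y1" for s using that t bnd by (intro opt) auto
    have 2: "(INF s\<in>{s\<in>{x0..x1}. s \<le> sS \<and> s \<le> t}. FS s + ?o (s, y0) (t, y1))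
        = (INF s\<in>{s\<in>{x0..x1}. s \<le> sS \<and> s \<le> t}. FS s + H.D (s, y0) (t, y1))"
      by (intro INF_cong refl) (use t bnd in \<open>simp add: opt\<close>)
    show ?thesis
      unfolding r_eq Nf_def using 1[OF bnd(5) order_refl] 1[OF sW(1,2)] 2
      by (cases "fS sS < fW sW") (simp_all only: cell_data.select_convs if_True if_False simp_thms)
  qed
  have east: "Ef t = east_apx r t" if t: "y0 \<le> t" "t \<le> y1" for t
  proof -
    have 1: "?o (s, y0) (x1, t) = H.D (s, y0) (x1, t)" if "x0 \<le> s" "s \<le> x1" for s using that t bnd by (intro opt) auto
    have 2: "(INF s\<in>{s\<in>{y0..y1}. s \<le> sW \<and> s \<le> t}. FW s + ?o (x0, s) (x1, t))
        = (INF s\<in>{s\<in>{y0..y1}. s \<le> sW \<and> s \<le> t}. FW s + H.D (x0, s) (x1, t))"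
      by (intro INF_cong refl) (use t bnd in \<open>simp add: opt\<close>)
    show ?thesis
      unfolding r_eq Ef_def using 1[OF bnd(2) order_refl] 1[OF sS(1,2)] 2
      by (cases "fW sW < fS sS") (simp_all only: cell_data.select_convs if_True if_False simp_thms)
  qed
  note r = corner north east
  show "border_inv H.D (\<lambda>t. (t, Q.l (Suc j))) (P.l i) (P.l (Suc i)) (north_apx r)"
    using border_inv_cong[OF N(1) r(2)] by (simp add: xy)
  show "border_inv H.D (\<lambda>t. (P.l (Suc i), t)) (Q.l j) (Q.l (Suc j)) (east_apx r)"
    using border_inv_cong[OF E(1) r(3)] by (simp add: xy)
  show "corner_val r = north_apx r (P.l (Suc i))" "corner_val r = east_apx r (Q.l (Suc j))"
    using r(1) r(2)[of x1] r(3)[of y1] N(2) E(2) bnd by (simp_all add: xy min.commute)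
qed

text \<open>The guards leave out the borders that do not exist for index 0. The west neighbour comes
  from the outer induction and the south neighbour from the inner one.\<close>

lemma propagate_inv:
  assumes sel: "minimiser_rule sel" and "i \<le> n" "j \<le> m"
  defines "r \<equiv> propagate N sel p n q m"
  shows "(1 \<le> i \<longrightarrow> border_inv H.D (\<lambda>t. (t, Q.l j)) (P.l (i - 1)) (P.l i) (north_apx (r i j)) \<and>
      corner_val (r i j) = north_apx (r i j) (P.l i)) \<and>
    (1 \<le> j \<longrightarrow> border_inv H.D (\<lambda>t. (P.l i, t)) (Q.l (j - 1)) (Q.l j) (east_apx (r i j)) \<and>
      corner_val (r i j) = east_apx (r i j) (Q.l j))"
    (is "?N i j \<and> ?E i j")
  using assms(2,3)
proof (induction i arbitrary: j)
  case 0
  show ?case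
  proof (cases j)
    case (Suc k)
    interpret F: height "\<lambda>x y. hgt y x" "hgt 0 0 + P.L + Q.L" by (rule H.height_flip)
    have k: "0 \<le> Q.l k" "Q.l k \<le> Q.l (Suc k)" "Q.l (Suc k) \<le> Q.L"
      using Q.l_mono[of 0 k] Q.l_mono[of k "Suc k"] Q.l_mono[of "Suc k" m] 0 Suc by auto
    have "border_inv H.D (\<lambda>t. (0, t)) (Q.l k) (Q.l (Suc k)) (\<lambda>t. H.D (0, 0) (0, t))"
      using F.border_base[OF k(1,2)] unfolding mincost_flip[of hgt] border_inv_flip[of hgt] .
    then have "border_inv H.D (\<lambda>t. (0, t)) (Q.l k) (Q.l (Suc k)) (\<lambda>t. opt N p n q m (0, 0) (0, t))"
      by (rule border_inv_cong) (use k P.L_pos in \<open>simp add: opt_eq\<close>)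
    then show ?thesis using Suc by (simp add: r_def)
  qed simp
next
  case (Suc i)
  have IH: "?N i j \<and> ?E i j" if "j \<le> m" for j using Suc.IH[of j] Suc.prems(1) that by simp
  show ?case
    using Suc.prems(2)
  proof (induction j)
    case 0
    have i: "0 \<le> P.l i" "P.l i \<le> P.l (Suc i)" "P.l (Suc i) \<le> P.L"
      using P.l_mono[of 0 i] P.l_mono[of i "Suc i"] P.l_mono[OF Suc.prems(1)] by auto
    have "border_inv H.D (\<lambda>t. (t, 0)) (P.l i) (P.l (Suc i)) (\<lambda>t. opt N p n q m (0, 0) (t, 0))"
      by (rule border_inv_cong[OF H.border_base[OF i(1,2)]]) (use i Q.L_pos in \<open>simp add: opt_eq\<close>)
    then show ?case by (simp add: r_def)
  next
    case (Suc j)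
    have S: "?N (Suc i) j" using Suc.IH Suc.prems by simp
    have W: "?E i (Suc j)" using IH[OF Suc.prems] by blast
    have "r (Suc i) (Suc j) = process_cell N sel p n q m (Suc i) (Suc j)
       (north_apx (r (Suc i) j)) (east_apx (r i (Suc j))) (corner_val (r i (Suc j))) (corner_val (r (Suc i) j))"
      by (simp add: r_def)
    then show ?case
      using process_cell_inv[OF \<open>Suc i \<le> n\<close> Suc.prems sel, of "north_apx (r (Suc i) j)" _ "east_apx (r i (Suc j))"] S W
      by simp
  qed
qed

end

theorem theorem14:
  fixes N :: "real^2 \<Rightarrow> real"
    and p q :: "nat \<Rightarrow> real^2"
    and n m :: nat
    and sel :: selection
  assumes "is_norm N"
    and "polygonal_curve p n"
    and "polygonal_curve q m"
    and "minimiser_rule sel"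
  shows "cdtw N p n q m \<le> propagation_value N sel p n q m \<and>
         propagation_value N sel p n q m \<le> 5 * cdtw N p n q m"
proof -
  interpret curves N p n q m by unfold_locales (rule assms)+
  have n: "1 \<le> n" using assms(2) by (simp add: polygonal_curve_def)
  let ?r = "propagate N sel p n q m n m"
  have inv: "border_inv H.D (\<lambda>t. (t, Q.L)) (P.l (n - 1)) P.L (north_apx ?r)" "corner_val ?r = north_apx ?r P.L"
    using propagate_inv[OF assms(4) order_refl order_refl] n by auto
  \<comment> \<open>The returned value is that of the last north border at its right end, the point
    \<open>(P.L, Q.L)\<close>.\<close>
  show ?thesis
    unfolding propagation_value_def inv(2) cdtw_eq
    using border_invD(1,2)[OF inv(1) _ order_refl] P.l_mono[of "n - 1" n] by simp
qed

end
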